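(* Let $d\geq 1$, let $V:\mathbb{R}^d\to\mathbb{R}$ and $W:\mathbb{R}^d\times\mathbb{R}^d\to(-\infty,+\infty]$ satisfy (H1), (H2), (H3) below, and let $(\beta_N)_N$ be positive reals with $\beta_N/(N\log N)\to+\infty$. For $N\geq N_0$ let $P_N$, $\mu_N$, $Z_N$, $I$ be as in the context. Then: (1) $I$ has compact level sets $\{I\leq r\}$ (hence is lower semi-continuous) and $\inf_{\mathcal{M}_1(\mathbb{R}^d)}I>-\infty$. (2) For every Borel set $A\subset\mathcal{M}_1(\mathbb{R}^d)$, writing $Z_NP_N(\mu_N\in A)=\int_{(\mathbb{R}^d)^N}\mathbf{1}_{\{\mu_N\in A\}}e^{-\beta_NH_N(x)}\,dx$, $$\limsup_{N\to\infty}\frac{\log Z_NP_N(\mu_N\in A)}{\beta_N}\leq-\inf_{\mu\in\mathrm{clo}(A)}I(\mu),$$ $$\liminf_{N\to\infty}\frac{\log Z_NP_N(\mu_N\in A)}{\beta_N}\geq-\inf\{I(\mu):\mu\in\mathrm{int}(A),\ \mu\ \text{absolutely continuous w.r.t. Lebesgue measure}\}.$$ (3) If moreover (H4) holds, then with $I_\star:=I-\inf_{\mathcal{M}_1(\mathbb{R}^d)}I$, for every Borel $A\subset\mathcal{M}_1(\mathbb{R}^d)$, $$-\inf_{\mu\in\mathrm{int}(A)}I_\star(\mu)\leq\liminf_{N\to\infty}\frac{\log P_N(\mu_N\in A)}{\beta_N}\leq\limsup_{N\to\infty}\frac{\log P_N(\mu_N\in A)}{\beta_N}\leq-\inf_{\mu\in\mathrm{clo}(A)}I_\star(\mu),$$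 and in particular $\lim_{N\to\infty}\beta_N^{-1}\log Z_N=\inf_{\mathcal{M}_1(\mathbb{R}^d)}I_\star$ (as printed in the paper). (4) The set $I_{\min}:=\{\mu\in\mathcal{M}_1(\mathbb{R}^d):I_\star(\mu)=0\}$ is nonempty, and if (H4) holds and the random configurations with laws $P_N$ are all defined on the same probability space, then almost surely $\lim_{N\to\infty}d_{\mathrm{FM}}(\mu_N,I_{\min})=0$.
   Context: $|\cdot|$ is the Euclidean norm. Hypotheses: (H1) $W$ is continuous on $\mathbb{R}^d\times\mathbb{R}^d$ (as a map into $(-\infty,+\infty]$), symmetric, finite off the diagonal $\{(x,x)\}$, and for every compact $K\subset\mathbb{R}^d$ the function $z\mapsto\sup\{W(x,y):|x-y|\geq|z|,\ x,y\in K\}$ is locally Lebesgue integrable on $\mathbb{R}^d$. (H2) $V$ is continuous, $V(x)\to+\infty$ as $|x|\to\infty$, and $\int_{\mathbb{R}^d}e^{-V(x)}dx<\infty$. (H3) There are $c\in\mathbb{R}$ and $\varepsilon_o\in(0,1)$ with $W(x,y)\geq c-\varepsilon_o(V(x)+V(y))$ for all $x,y$. (H4) For every probability measure $\nu$ with $I(\nu)<\infty$ there exist probability measures $\nu_n$ absolutely continuous w.r.t. Lebesgue measure with $\nu_n\to\nu$ weakly and $I(\nu_n)\to I(\nu)$. For $x=(x_1,\dots,x_N)\in(\mathbb{R}^d)^N$, $\mu_N:=\frac1N\sum_{i=1}^N\delta_{x_i}$ and $H_N(x):=\frac1N\sum_iV(x_i)+\frac1{N^2}\sum_{i<j}W(x_i,x_j)$.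 Under (H2),(H3) there is $N_0$ such that $Z_N:=\int e^{-\beta_NH_N(x)}dx<\infty$ for $N\geq N_0$; then $P_N$ is the probability measure on $(\mathbb{R}^d)^N$ with density $e^{-\beta_NH_N}/Z_N$, and $\mu_N$ is regarded as a random element of $\mathcal{M}_1(\mathbb{R}^d)$ (probability measures on $\mathbb{R}^d$) under $P_N$. $I(\mu):=\frac12\iint(V(x)+V(y)+W(x,y))\,d\mu(x)d\mu(y)\in(-\infty,+\infty]$. $\mathcal{M}_1(\mathbb{R}^d)$ carries the weak topology (duality with bounded continuous functions), with interior $\mathrm{int}$ and closure $\mathrm{clo}$; it is metrized by the Fortet–Mourier distance $d_{\mathrm{FM}}(\mu,\nu)=\sup\{\int f\,d\mu-\int f\,d\nu:\ \sup|f|\leq1,\ \sup_{x\neq y}|f(x)-f(y)|/|x-y|\leq1\}$, and $d_{\mathrm{FM}}(\mu,S)=\inf_{\nu\in S}d_{\mathrm{FM}}(\mu,\nu)$.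
   Formalization: The printed limit of log Z_N / β_N, inf I_⋆ (always 0), is false in general (W=0, V=|x|²+k) and is replaced by −inf I; in (H1) the supremum over an empty set is taken as 0; the parenthetical lower semi-continuity of I is not stated separately. *)

theory Defs
  imports "HOL-Probability.Probability"
begin

text \<open>The state space is an arbitrary Euclidean space 'a (playing the role of R^d, d = DIM('a) >= 1).
  Probability measures on it are Borel probability measures.\<close>

definition M1 :: "'a::euclidean_space measure set" where
  "M1 = {M. prob_space M \<and> sets M = sets borel}"

definition weak_top :: "'a::euclidean_space measure topology" where
  "weak_top = topology_generated_by
     {{M \<in> M1. (\<integral>x. f x \<partial>M) \<in> U} | (f :: 'a \<Rightarrow> real) U.
        continuous_on UNIV f \<and> bounded (range f) \<and> open U}"

definition weak_borel :: "'a::euclidean_space measure set set" where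
  "weak_borel = sigma_sets M1 {U. openin weak_top U}"

definition d_FM :: "'a::euclidean_space measure \<Rightarrow> 'a measure \<Rightarrow> real" where
  "d_FM \<mu> \<nu> = (SUP f \<in> {f :: 'a \<Rightarrow> real. (\<forall>x. \<bar>f x\<bar> \<le> 1) \<and>
                                 (\<forall>x y. \<bar>f x - f y\<bar> \<le> dist x y)}.
                  (\<integral>x. f x \<partial>\<mu>) - (\<integral>x. f x \<partial>\<nu>))"

definition d_FM_set :: "'a::euclidean_space measure \<Rightarrow> 'a measure set \<Rightarrow> real" where
  "d_FM_set \<mu> S = (INF \<nu> \<in> S. d_FM \<mu> \<nu>)"

text \<open>Integral of an extended-real valued function as (positive part) - (negative part).
  It is used only for integrands bounded below, where the negative part is finite.\<close>

definition eint :: "'b measure \<Rightarrow> ('b \<Rightarrow> ereal) \<Rightarrow> ereal" where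
  "eint M f = enn2ereal (\<integral>\<^sup>+ z. e2ennreal (f z) \<partial>M) - enn2ereal (\<integral>\<^sup>+ z. e2ennreal (- f z) \<partial>M)"

definition eln :: "ennreal \<Rightarrow> ereal" where
  "eln t = (if t = 0 then - \<infinity> else if t = \<top> then \<infinity> else ereal (ln (enn2real t)))"

definition locally_integrable :: "('a::euclidean_space \<Rightarrow> ereal) \<Rightarrow> bool" where
  "locally_integrable g \<longleftrightarrow> g \<in> borel_measurable lborel \<and>
     (\<forall>B. compact B \<longrightarrow> (\<integral>\<^sup>+ z. e2ennreal \<bar>g z\<bar> * indicator B z \<partial>lborel) < \<infinity>)"

definition W_sup :: "('a::euclidean_space \<Rightarrow> 'a \<Rightarrow> ereal) \<Rightarrow> 'a set \<Rightarrow> 'a \<Rightarrow> ereal" where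
  "W_sup W K z = (let S = {W x y | x y. x \<in> K \<and> y \<in> K \<and> norm (x - y) \<ge> norm z}
                  in if S = {} then 0 else Sup S)"

definition H1 :: "('a::euclidean_space \<Rightarrow> 'a \<Rightarrow> ereal) \<Rightarrow> bool" where
  "H1 W \<longleftrightarrow> continuous_on UNIV (\<lambda>p. W (fst p) (snd p)) \<and>
     (\<forall>x y. W x y \<noteq> - \<infinity>) \<and>
     (\<forall>x y. W x y = W y x) \<and>
     (\<forall>x y. x \<noteq> y \<longrightarrow> W x y \<noteq> \<infinity>) \<and>
     (\<forall>K. compact K \<longrightarrow> locally_integrable (W_sup W K))"

definition H2 :: "('a::euclidean_space \<Rightarrow> real) \<Rightarrow> bool" where
  "H2 V \<longleftrightarrow> continuous_on UNIV V \<and> filterlim V at_top at_infinity \<and>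
     (\<integral>\<^sup>+ x. ennreal (exp (- V x)) \<partial>lborel) < \<infinity>"

definition H3 :: "('a::euclidean_space \<Rightarrow> real) \<Rightarrow> ('a \<Rightarrow> 'a \<Rightarrow> ereal) \<Rightarrow> bool" where
  "H3 V W \<longleftrightarrow> (\<exists>c \<epsilon>. 0 < \<epsilon> \<and> \<epsilon> < 1 \<and>
     (\<forall>x y. W x y \<ge> ereal (c - \<epsilon> * (V x + V y))))"

definition I_fun :: "('a::euclidean_space \<Rightarrow> real) \<Rightarrow> ('a \<Rightarrow> 'a \<Rightarrow> ereal) \<Rightarrow> 'a measure \<Rightarrow> ereal" where
  "I_fun V W \<mu> = ereal (1/2) *
     eint (\<mu> \<Otimes>\<^sub>M \<mu>) (\<lambda>p. ereal (V (fst p)) + ereal (V (snd p)) + W (fst p) (snd p))"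

definition H4 :: "('a::euclidean_space \<Rightarrow> real) \<Rightarrow> ('a \<Rightarrow> 'a \<Rightarrow> ereal) \<Rightarrow> bool" where
  "H4 V W \<longleftrightarrow> (\<forall>\<nu> \<in> M1. I_fun V W \<nu> < \<infinity> \<longrightarrow>
     (\<exists>\<nu>s :: nat \<Rightarrow> 'a measure. (\<forall>n. \<nu>s n \<in> M1 \<and> absolutely_continuous lborel (\<nu>s n)) \<and>
        limitin weak_top \<nu>s \<nu> sequentially \<and>
        (\<lambda>n. I_fun V W (\<nu>s n)) \<longlonglongrightarrow> I_fun V W \<nu>))"

definition config_space :: "nat \<Rightarrow> (nat \<Rightarrow> 'a::euclidean_space) measure" where
  "config_space N = PiM {..<N} (\<lambda>_. lborel)"

text \<open>Empirical measure mu_N = (1/N) sum_i delta_{x_i}.\<close>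

definition empirical :: "nat \<Rightarrow> (nat \<Rightarrow> 'a::euclidean_space) \<Rightarrow> 'a measure" where
  "empirical N x = distr (uniform_count_measure {..<N}) borel x"

definition H_N :: "('a::euclidean_space \<Rightarrow> real) \<Rightarrow> ('a \<Rightarrow> 'a \<Rightarrow> ereal) \<Rightarrow> nat \<Rightarrow> (nat \<Rightarrow> 'a) \<Rightarrow> ereal" where
  "H_N V W N x = ereal (1 / real N) * ereal (\<Sum>i<N. V (x i)) +
      ereal (1 / (real N)\<^sup>2) * (\<Sum>j<N. \<Sum>i<j. W (x i) (x j))"

definition gibbs_weight :: "('a::euclidean_space \<Rightarrow> real) \<Rightarrow> ('a \<Rightarrow> 'a \<Rightarrow> ereal) \<Rightarrow> (nat \<Rightarrow> real)
    \<Rightarrow> nat \<Rightarrow> (nat \<Rightarrow> 'a) \<Rightarrow> ennreal" where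
  "gibbs_weight V W \<beta> N x =
     (if H_N V W N x = \<infinity> then 0
      else if H_N V W N x = - \<infinity> then \<infinity>
      else ennreal (exp (- \<beta> N * real_of_ereal (H_N V W N x))))"

definition Z_N :: "('a::euclidean_space \<Rightarrow> real) \<Rightarrow> ('a \<Rightarrow> 'a \<Rightarrow> ereal) \<Rightarrow> (nat \<Rightarrow> real) \<Rightarrow> nat \<Rightarrow> ennreal" where
  "Z_N V W \<beta> N = (\<integral>\<^sup>+ x. gibbs_weight V W \<beta> N x \<partial>config_space N)"

definition ZP_N :: "('a::euclidean_space \<Rightarrow> real) \<Rightarrow> ('a \<Rightarrow> 'a \<Rightarrow> ereal) \<Rightarrow> (nat \<Rightarrow> real)
    \<Rightarrow> nat \<Rightarrow> 'a measure set \<Rightarrow> ennreal" where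
  "ZP_N V W \<beta> N A = (\<integral>\<^sup>+ x. indicator {y. empirical N y \<in> A} x * gibbs_weight V W \<beta> N x \<partial>config_space N)"

text \<open>P_N(mu_N in A) (meaningful once 0 < Z_N < infinity, i.e. for N >= N_0).\<close>

definition P_N_prob :: "('a::euclidean_space \<Rightarrow> real) \<Rightarrow> ('a \<Rightarrow> 'a \<Rightarrow> ereal) \<Rightarrow> (nat \<Rightarrow> real)
    \<Rightarrow> nat \<Rightarrow> 'a measure set \<Rightarrow> ennreal" where
  "P_N_prob V W \<beta> N A = ZP_N V W \<beta> N A / Z_N V W \<beta> N"

definition P_N :: "('a::euclidean_space \<Rightarrow> real) \<Rightarrow> ('a \<Rightarrow> 'a \<Rightarrow> ereal) \<Rightarrow> (nat \<Rightarrow> real)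
    \<Rightarrow> nat \<Rightarrow> (nat \<Rightarrow> 'a) measure" where
  "P_N V W \<beta> N = density (config_space N) (\<lambda>x. gibbs_weight V W \<beta> N x / Z_N V W \<beta> N)"

end

(*
  Write phi(x,y) = V(x) + V(y) + W(x,y) + C, with C so large that phi >= kappa (G(x) + G(y)) for
  G = V + v0 >= 0 and kappa = 1 - epsilon_o. Then I is, up to affine normalisation, the supremum of
  the integrals of the bounded continuous functions min(phi, n) against mu x mu, and a bound on I
  bounds the integral of G. The sets where the integral of G is bounded are weakly compact: by
  Tychonoff the corresponding positive functionals on bounded continuous functions form a compact
  set, and a tight functional is represented by a measure (Daniell: tightness and Dini give
  sigma-continuity).

  Upper bound: if H_N < r on configurations with mu_N in A for infinitely many N, the empirical
  measures have a cluster point in the closure of A at which I <= r. The weight e^{-beta_N H_N} is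
  then split into e^{-(beta_N - N/kappa) r} and an integrable factor contributing const^N = e^{o(beta_N)}.

  Lower bound: an absolutely continuous mu is replaced by its conditioning on a set where its
  density and |x| are bounded. Under the N-fold product of the conditioned measure, Markov's
  inequality keeps H_N below I(mu) + delta with probability bounded away from 0 while mu_N
  concentrates; comparing the product with Lebesgue measure costs only M^N. No entropy and no
  separated configurations are needed, and the condition on W near the diagonal serves only to
  make inf I finite.
*)

theory Submission
  imports Defs
begin

text \<open>The weak topology is known here only through its subbasis, which tests a measure against
  functions of one variable. Two obstacles follow. First, compactness and cluster points are treated
  with open covers instead of sequences, and \<open>d_FM\<close> enters only through the fact that
  its balls contain weak neighbourhoods. Second, the energy tests \<mu> x \<mu> against functions of
  two variables; such integrals are shown to be continuous only on tight sets, by approximation with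
  finite sums of tensor products. Hence every topological argument about the energy is first moved
  into a tight set by coercivity. H_N omits the diagonal while I integrates over it. The truncation
  at n is therefore made before the diagonal is filled in: it then costs only O(n/N), even where W
  is infinite on the diagonal. Two growth rates are at work: beta_N / N tending to infinity makes
  every factor const^N invisible after division by beta_N, and beta_N growing faster than any
  multiple of log N makes exp(- eta beta_N) summable for Borel-Cantelli.\<close>

definition bcont :: "('a::euclidean_space \<Rightarrow> real) set" where
  "bcont = {f. continuous_on UNIV f \<and> bounded (range f)}"

lemma bcontI:
  assumes "continuous_on UNIV f" "\<And>x. \<bar>f x\<bar> \<le> B"
  shows "f \<in> bcont"
  using assms by (auto simp: bcont_def bounded_iff)

lemma bcont_continuous: "f \<in> bcont \<Longrightarrow> continuous_on UNIV f"
  by (simp add: bcont_def)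

lemma bcont_bounded:
  assumes "f \<in> bcont"
  obtains B where "0 \<le> B" "\<And>x. \<bar>f x\<bar> \<le> B"
  using assms unfolding bcont_def bounded_pos by (auto intro: less_imp_le)

lemma bcont_measurable: "f \<in> bcont \<Longrightarrow> f \<in> borel_measurable borel"
  by (simp add: bcont_def borel_measurable_continuous_onI)

lemma bcont_const: "(\<lambda>_. c) \<in> bcont"
  by (rule bcontI[of _ "\<bar>c\<bar>"]) auto

lemma bcont_add: "f \<in> bcont \<Longrightarrow> g \<in> bcont \<Longrightarrow> (\<lambda>x. f x + g x) \<in> bcont"
  by (auto simp: bcont_def intro!: continuous_intros bounded_plus_comp)

lemma bcont_diff: "f \<in> bcont \<Longrightarrow> g \<in> bcont \<Longrightarrow> (\<lambda>x. f x - g x) \<in> bcont"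
  by (auto simp: bcont_def intro!: continuous_intros bounded_minus_comp)

lemma bcont_scale: "f \<in> bcont \<Longrightarrow> (\<lambda>x. c * f x) \<in> bcont"
  using bounded_scaling[of "range f" c]
  by (auto simp: bcont_def image_image intro!: continuous_intros)

lemma bcont_min:
  assumes "f \<in> bcont" "g \<in> bcont"
  shows "(\<lambda>x. min (f x) (g x)) \<in> bcont"
proof -
  obtain B where B: "\<And>x. \<bar>f x\<bar> \<le> B" using bcont_bounded[OF assms(1)] by blast
  obtain C where C: "\<And>x. \<bar>g x\<bar> \<le> C" using bcont_bounded[OF assms(2)] by blast
  have "\<bar>min (f x) (g x)\<bar> \<le> max B C" for x
    using B[of x] C[of x] by (simp add: min_def max_def)
  then show ?thesis
    using assms by (intro bcontI[of _ "max B C"] continuous_on_min) (auto intro: bcont_continuous)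
qed

lemma bcont_max: "f \<in> bcont \<Longrightarrow> g \<in> bcont \<Longrightarrow> (\<lambda>x. max (f x) (g x)) \<in> bcont"
  using bcont_scale[OF bcont_min[OF bcont_scale[of f "-1"] bcont_scale[of g "-1"]], of "-1"]
  by (simp add: minus_min_eq_max)

lemma bcont_sum: "(\<And>i. i \<in> A \<Longrightarrow> f i \<in> bcont) \<Longrightarrow> (\<lambda>x. \<Sum>i\<in>A. f i x) \<in> bcont"
  by (induction A rule: infinite_finite_induct) (auto intro: bcont_const bcont_add)

lemma integrable_bcont:
  assumes "f \<in> bcont" "\<mu> \<in> M1"
  shows "integrable \<mu> f"
proof -
  interpret prob_space \<mu> using assms by (simp add: M1_def)
  obtain B where B: "\<And>x. \<bar>f x\<bar> \<le> B" using bcont_bounded[OF assms(1)] by blast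
  have "f \<in> borel_measurable \<mu>"
    using bcont_measurable[OF assms(1)] assms(2) by (simp add: M1_def cong: measurable_cong_sets)
  then show ?thesis by (intro integrable_const_bound[where B = B]) (auto simp: B)
qed

subsection \<open>Representation of tight positive functionals\<close>

text \<open>The sublevel sets of \<open>G\<close> serve as the compact sets of tightness: if
  \<open>G\<close> has integral at most R, the mass outside {G <= c} is at most R / c. Continuity
  turns the truncations of \<open>G\<close> into admissible test functions.\<close>

locale confining =
  fixes G :: "'a::euclidean_space \<Rightarrow> real"
  assumes G_cont: "continuous_on UNIV G"
    and G_nonneg: "0 \<le> G x"
    and G_compact: "compact {x. G x \<le> r}"
begin

lemma min_G_bcont: "0 \<le> m \<Longrightarrow> (\<lambda>x. min (G x) m) \<in> bcont"
  using G_nonneg by (intro bcontI[of _ m]) (auto intro!: continuous_intros G_cont)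

end

text \<open>\<open>L_tight\<close> expresses a bound on the value of \<open>G\<close>, which is
  unbounded and so outside the domain \<open>bcont\<close>, through its truncations. Values of
  \<open>L\<close> outside \<open>bcont\<close> carry no meaning.\<close>

locale tight_functional = confining G
  for G :: "'a::euclidean_space \<Rightarrow> real" +
  fixes L :: "('a \<Rightarrow> real) \<Rightarrow> real" and R :: real
  assumes L_add: "f \<in> bcont \<Longrightarrow> g \<in> bcont \<Longrightarrow> L (\<lambda>x. f x + g x) = L f + L g"
    and L_scale: "f \<in> bcont \<Longrightarrow> L (\<lambda>x. c * f x) = c * L f"
    and L_pos: "f \<in> bcont \<Longrightarrow> (\<And>x. 0 \<le> f x) \<Longrightarrow> 0 \<le> L f"
    and L_one: "L (\<lambda>_. 1) = 1"
    and L_tight: "\<And>m. 0 \<le> m \<Longrightarrow> L (\<lambda>x. min (G x) m) \<le> R"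
begin

lemma L_const: "L (\<lambda>_. c) = c"
  using L_scale[OF bcont_const, of c 1] L_one by simp

lemma L_diff: "f \<in> bcont \<Longrightarrow> g \<in> bcont \<Longrightarrow> L (\<lambda>x. f x - g x) = L f - L g"
  using L_add[of f "\<lambda>x. -1 * g x"] L_scale[of g "-1"] bcont_scale[of g "-1"] by simp

lemma L_mono: "f \<in> bcont \<Longrightarrow> g \<in> bcont \<Longrightarrow> (\<And>x. f x \<le> g x) \<Longrightarrow> L f \<le> L g"
  using L_pos[of "\<lambda>x. g x - f x"] L_diff[of g f] bcont_diff[of g f] by simp

lemma L_sum: "(\<And>i. i \<in> A \<Longrightarrow> f i \<in> bcont) \<Longrightarrow> L (\<lambda>x. \<Sum>i\<in>A. f i x) = (\<Sum>i\<in>A. L (f i))"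
  by (induction A rule: infinite_finite_induct) (auto simp: L_const L_add bcont_sum)

text \<open>Daniell's condition. On the compact set {G <= c} the decreasing functions become small
  uniformly (Dini); off it they are at most 1, hence at most \<open>min (G x) c / c\<close>, and
  tightness bounds the contribution by R / c. Countable subadditivity of the constructed outer
  measure rests on this.\<close>

lemma L_sigma_continuous:
  assumes d: "\<And>m. d m \<in> bcont" and bd: "\<And>m x. 0 \<le> d m x" "\<And>m x. d m x \<le> 1"
    and dec: "\<And>m x. d (Suc m) x \<le> d m x" and lim: "\<And>x. \<exists>m. d m x = 0" and e: "0 < e"
  shows "\<exists>m. L (d m) \<le> e"
proof -
  have dec': "d n x \<le> d m x" if "m \<le> n" for m n x
    using that by (induction n rule: dec_induct) (auto intro: order_trans[OF dec])
  \<comment> \<open>Large enough for R / c <= e / 2; the maximum with 1 keeps c positive when R is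
    not.\<close>
  define c where "c = max 1 (2 * R / e)"
  have c: "c > 0" "R / c \<le> e / 2"
    using e by (auto simp: c_def field_simps max_def)
  let ?K = "{x. G x \<le> c}"
  have op: "open {x. d m x < e / 2}" for m
    by (intro open_Collect_less bcont_continuous[OF d] continuous_intros)
  have cov: "?K \<subseteq> (\<Union>m\<in>UNIV. {x. d m x < e / 2})"
  proof
    fix x show "x \<in> (\<Union>m\<in>UNIV. {x. d m x < e / 2})"
      using lim[of x] e by (metis (mono_tags, lifting) UN_I UNIV_I half_gt_zero mem_Collect_eq)
  qed
  obtain J where J: "finite J" "?K \<subseteq> (\<Union>m\<in>J. {x. d m x < e / 2})"
    using compactE_image[OF G_compact op cov] by auto
  define M where "M = Max (insert 0 J)"
  have *: "d M x \<le> e / 2 + (1 / c) * min (G x) c" for x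
  proof (cases "G x \<le> c")
    case True
    then obtain m where "m \<in> J" "d m x < e / 2" using J by auto
    moreover have "m \<le> M" using J \<open>m \<in> J\<close> by (simp add: M_def)
    ultimately have "d M x \<le> e / 2" using dec'[of m M x] by simp
    then show ?thesis using G_nonneg[of x] c(1) by (simp add: add_increasing2)
  next
    case False
    then show ?thesis using bd(2)[of M x] c(1) e by (simp add: min_def)
  qed
  have "L (d M) \<le> L (\<lambda>x. e / 2 + (1 / c) * min (G x) c)"
    using c(1) by (intro L_mono d * bcont_add bcont_const bcont_scale min_G_bcont) auto
  also have "\<dots> = e / 2 + (1 / c) * L (\<lambda>x. min (G x) c)"
    using c(1) by (simp only: L_add L_scale L_const bcont_const bcont_scale min_G_bcont less_imp_le)
  also have "\<dots> \<le> e / 2 + R / c"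
    using L_tight[of c] c(1) by (simp add: divide_right_mono)
  finally have "L (d M) \<le> e" using c(2) by linarith
  then show ?thesis ..
qed

section \<open>Caratheodory construction of the representing measure\<close>

definition under :: "'a set \<Rightarrow> ('a \<Rightarrow> real) set" where
  "under U = {f \<in> bcont. (\<forall>x. 0 \<le> f x \<and> f x \<le> 1) \<and> (\<forall>x. x \<notin> U \<longrightarrow> f x = 0)}"

text \<open>The Riesz formula for the mass of an open set: the supremum of \<open>L\<close> over
  test functions below its indicator. \<open>outer\<close> then extends it to all sets by outer
  regularity.\<close>

definition inner :: "'a set \<Rightarrow> ennreal" where
  "inner U = (SUP f \<in> under U. ennreal (L f))"

definition outer :: "'a set \<Rightarrow> ennreal" where
  "outer A = (INF U \<in> {U. open U \<and> A \<subseteq> U}. inner U)"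

lemma zero_under: "(\<lambda>_. 0) \<in> under U"
  by (simp add: under_def bcont_const)

lemma inner_upper: "f \<in> under U \<Longrightarrow> ennreal (L f) \<le> inner U"
  unfolding inner_def by (rule SUP_upper)

lemma inner_mono: "U \<subseteq> U' \<Longrightarrow> inner U \<le> inner U'"
  unfolding inner_def by (rule SUP_subset_mono) (auto simp: under_def)

lemma outer_open: "open U \<Longrightarrow> outer U = inner U"
  unfolding outer_def by (intro antisym INF_lower INF_greatest) (auto intro: inner_mono)

lemma outer_le: "open U \<Longrightarrow> A \<subseteq> U \<Longrightarrow> outer A \<le> inner U"
  unfolding outer_def by (rule INF_lower) auto

lemma outer_mono: "A \<subseteq> B \<Longrightarrow> outer A \<le> outer B"
  unfolding outer_def by (rule INF_superset_mono) auto

lemma inner_UNIV: "inner UNIV = 1"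
proof (rule antisym)
  show "inner UNIV \<le> 1"
    unfolding inner_def
  proof (rule SUP_least)
    fix f :: "'a \<Rightarrow> real" assume "f \<in> under UNIV"
    then have "L f \<le> L (\<lambda>_. 1)" by (intro L_mono bcont_const) (auto simp: under_def)
    then show "ennreal (L f) \<le> 1" by (simp add: L_one ennreal_le_1)
  qed
  show "1 \<le> inner UNIV"
    using inner_upper[of "\<lambda>_. 1" UNIV] by (simp add: under_def bcont_const L_one)
qed

lemma inner_empty: "inner {} = 0"
proof -
  have "under {} = {\<lambda>_. 0}" using zero_under by (auto simp: under_def)
  then show ?thesis by (simp add: inner_def L_const)
qed

text \<open>A function f below the union is compared with finite sums of functions below the single
  sets. The part of f not covered by the sum decreases and reaches 0 at every point, so
  \<open>L_sigma_continuous\<close> makes its value arbitrarily small.\<close>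

lemma inner_countably_subadditive:
  assumes U: "\<And>i::nat. open (U i)"
  shows "inner (\<Union>i. U i) \<le> (\<Sum>i. inner (U i))"
  unfolding inner_def[of "\<Union>i. U i"]
proof (rule SUP_least)
  fix f assume f: "f \<in> under (\<Union>i. U i)"
  \<comment> \<open>For growing m these functions increase to the indicator of \<open>U i\<close>.
    The whole space is a separate case because \<open>infdist\<close> to the empty complement is 0
    by convention. In \<open>s\<close>, the index m is both the steepness and the number of
    terms.\<close>
  define h where "h i m x = (if U i = UNIV then 1 else min 1 (real m * infdist x (- U i)))" for i m x
  define s where "s m x = (\<Sum>i<m. h i m x)" for m x
  define d where "d m x = f x - min (f x) (s m x)" for m x
  have h01: "0 \<le> h i m x" "h i m x \<le> 1" for i m x
    by (auto simp: h_def infdist_nonneg)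
  have hb: "h i m \<in> bcont" for i m
  proof (rule bcontI[of _ 1])
    show "continuous_on UNIV (h i m)"
      unfolding h_def by (cases "U i = UNIV") (auto intro!: continuous_intros)
    show "\<bar>h i m x\<bar> \<le> 1" for x using h01[of i m x] by simp
  qed
  have hu: "h i m \<in> under (U i)" for i m
    using hb[of i m] h01[of i m] by (auto simp: under_def h_def)
  have s0: "0 \<le> s m x" for m x by (simp add: s_def sum_nonneg h01)
  have fb: "f \<in> bcont" "\<And>x. 0 \<le> f x" "\<And>x. f x \<le> 1" using f by (auto simp: under_def)
  have sb: "s m \<in> bcont" for m
    unfolding s_def by (intro bcont_sum hb)
  have mb: "(\<lambda>x. min (f x) (s m x)) \<in> bcont" for m
    by (intro bcont_min fb sb)
  have hmono: "h i m x \<le> h i (Suc m) x" for i m x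
  proof -
    have "real m * infdist x (- U i) \<le> real (Suc m) * infdist x (- U i)"
      by (intro mult_right_mono infdist_nonneg) auto
    then show ?thesis by (auto simp: h_def)
  qed
  have smono: "s m x \<le> s (Suc m) x" for m x
  proof -
    have "s m x \<le> (\<Sum>i<m. h i (Suc m) x)" unfolding s_def by (intro sum_mono hmono)
    also have "\<dots> \<le> s (Suc m) x" unfolding s_def by (simp add: h01)
    finally show ?thesis .
  qed
  have dlim: "\<exists>m. d m x = 0" for x
  proof (cases "x \<in> (\<Union>i. U i)")
    case False
    then have "f x = 0" using f by (auto simp: under_def)
    then show ?thesis using s0 by (auto simp: d_def)
  next
    case True
    then obtain i where i: "x \<in> U i" by auto
    have "\<exists>m. m > i \<and> h i m x = 1"
    proof (cases "U i = UNIV")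
      case True then show ?thesis by (auto simp: h_def)
    next
      case False
      have "infdist x (- U i) > 0"
        using i False infdist_pos_not_in_closed[of "- U i" x] U[of i] by auto
      then obtain n where n: "real n * infdist x (- U i) > 1" using reals_Archimedean3 by blast
      have "real (max n (Suc i)) * infdist x (- U i) \<ge> real n * infdist x (- U i)"
        by (intro mult_right_mono infdist_nonneg) auto
      then show ?thesis using n False
        by (intro exI[of _ "max n (Suc i)"]) (auto simp: h_def)
    qed
    then obtain m where m: "m > i" "h i m x = 1" by auto
    have "h i m x \<le> s m x"
      unfolding s_def using m(1) h01 by (intro member_le_sum) auto
    then have "f x \<le> s m x" using fb(3)[of x] m by simp
    then show ?thesis by (intro exI[of _ m]) (simp add: d_def)
  qed
  show "ennreal (L f) \<le> (\<Sum>i. inner (U i))"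
  proof (rule ennreal_le_epsilon)
    fix e :: real assume e: "0 < e"
    have "\<exists>m. L (d m) \<le> e"
    proof (rule L_sigma_continuous[OF _ _ _ _ _ e])
      show "d m \<in> bcont" for m unfolding d_def by (intro bcont_diff mb fb)
      show "0 \<le> d m x" for m x by (simp add: d_def)
      show "d m x \<le> 1" for m x using fb(2,3)[of x] s0[of m x] by (simp add: d_def)
      show "d (Suc m) x \<le> d m x" for m x using smono[of m x] by (simp add: d_def)
    qed (rule dlim)
    then obtain m where m: "L (d m) \<le> e" by blast
    have "L f = L (d m) + L (\<lambda>x. min (f x) (s m x))"
      unfolding d_def using fb mb[of m] by (simp add: L_diff)
    also have "\<dots> \<le> e + L (s m)" using m by (intro add_mono L_mono mb sb) auto
    also have "L (s m) = (\<Sum>i<m. L (h i m))" unfolding s_def by (intro L_sum hb)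
    finally have "ennreal (L f) \<le> ennreal ((\<Sum>i<m. L (h i m)) + e)" by (simp add: add.commute ennreal_leI)
    also have "\<dots> = (\<Sum>i<m. ennreal (L (h i m))) + ennreal e"
      using e by (subst ennreal_plus) (auto simp: sum_ennreal L_pos hb h01 intro!: sum_nonneg)
    also have "\<dots> \<le> (\<Sum>i<m. inner (U i)) + ennreal e"
      by (intro add_mono sum_mono inner_upper hu) auto
    also have "\<dots> \<le> (\<Sum>i. inner (U i)) + ennreal e"
      by (intro add_mono sum_le_suminf) auto
    finally show "ennreal (L f) \<le> (\<Sum>i. inner (U i)) + ennreal e" .
  qed
qed

lemma outer_countably_subadditive: "outer (\<Union>i. A i) \<le> (\<Sum>i::nat. outer (A i))"
proof (rule ennreal_le_epsilon)
  fix e :: real assume e: "0 < e" and fin: "(\<Sum>i. outer (A i)) < top"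
  have "\<exists>U. open U \<and> A i \<subseteq> U \<and> inner U \<le> outer (A i) + ennreal (e * (1/2) ^ Suc i)" for i
  proof -
    have "outer (A i) \<noteq> top"
      using ennreal_suminf_lessD[OF fin, of i] by auto
    then have "outer (A i) < outer (A i) + ennreal (e * (1/2) ^ Suc i)"
      using e by (simp add: ennreal_less_zero_iff)
    then obtain U where "open U" "A i \<subseteq> U" "inner U < outer (A i) + ennreal (e * (1/2) ^ Suc i)"
      unfolding outer_def[of "A i"] INF_less_iff by blast
    then show ?thesis by (intro exI[of _ U]) auto
  qed
  then obtain U where U: "\<And>i. open (U i)" "\<And>i. A i \<subseteq> U i"
      "\<And>i. inner (U i) \<le> outer (A i) + ennreal (e * (1/2) ^ Suc i)" by metis
  have "outer (\<Union>i. A i) \<le> inner (\<Union>i. U i)" using U by (intro outer_le) auto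
  also have "\<dots> \<le> (\<Sum>i. inner (U i))" by (intro inner_countably_subadditive U)
  also have "\<dots> \<le> (\<Sum>i. outer (A i) + ennreal (e * (1/2) ^ Suc i))"
    by (intro suminf_le U) auto
  also have "\<dots> = (\<Sum>i. outer (A i)) + (\<Sum>i. ennreal (e * (1/2) ^ Suc i))"
    by (intro suminf_add[symmetric]) auto
  also have "(\<Sum>i. ennreal (e * (1/2) ^ Suc i)) = ennreal e"
    using sums_mult[OF power_half_series, of e] e
    by (intro sums_unique[symmetric]) (subst sums_ennreal; auto simp: mult_ac)
  finally show "outer (\<Union>i. A i) \<le> (\<Sum>i. outer (A i)) + ennreal e" .
qed

lemma outer_measure_space_outer: "outer_measure_space UNIV outer"
  unfolding outer_measure_space_def
proof (intro conjI)
  show "positive UNIV outer" by (simp add: positive_def outer_open inner_empty)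
  show "increasing UNIV outer" by (simp add: increasing_def outer_mono)
  show "countably_subadditive UNIV outer"
    by (simp add: countably_subadditive_def outer_countably_subadditive)
qed

text \<open>Given f below Y \<inter> U, the open set Q = Y \<inter> {f < e} still covers A - U,
  since f vanishes off U. The function (f - e)^+ vanishes on Q, so any g below Q may be added to it
  without exceeding 1 or leaving Y. Passing from f to (f - e)^+ loses at most e.\<close>

lemma outer_open_split:
  assumes U: "open U"
  shows "outer (A \<inter> U) + outer (A - U) \<le> outer A"
  unfolding outer_def[of A]
proof (rule INF_greatest, clarify)
  fix Y assume Y: "open Y" "A \<subseteq> Y"
  have "inner (Y \<inter> U) + outer (A - U) \<le> inner Y"
    unfolding inner_def[of "Y \<inter> U"]
  proof (subst ennreal_SUP_add_left[symmetric])
    show "under (Y \<inter> U) \<noteq> {}" using zero_under by blast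
    show "(SUP f \<in> under (Y \<inter> U). ennreal (L f) + outer (A - U)) \<le> inner Y"
    proof (rule SUP_least)
      fix f assume f: "f \<in> under (Y \<inter> U)"
      have fb: "f \<in> bcont" "\<And>x. 0 \<le> f x" "\<And>x. f x \<le> 1" using f by (auto simp: under_def)
      show "ennreal (L f) + outer (A - U) \<le> inner Y"
      proof (rule ennreal_le_epsilon)
        fix e :: real assume e: "0 < e"
        define Q where "Q = Y \<inter> {x. f x < e}"
        define fe where "fe x = max 0 (f x - e)" for x
        have "open Q" unfolding Q_def using Y
          by (intro open_Int open_Collect_less bcont_continuous fb continuous_intros)
        moreover have "A - U \<subseteq> Q" using f Y e by (auto simp: Q_def under_def)
        ultimately have AQ: "outer (A - U) \<le> inner Q" by (rule outer_le)
        have feb: "fe \<in> bcont" unfolding fe_def by (intro bcont_max bcont_diff bcont_const fb)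
        have Lfe: "L f \<le> L fe + e"
        proof -
          have "L f \<le> L (\<lambda>x. fe x + e)"
            using e by (intro L_mono bcont_add bcont_const feb fb) (simp add: fe_def)
          then show ?thesis by (simp add: L_add feb bcont_const L_const)
        qed
        have fe0: "0 \<le> L fe" by (intro L_pos feb) (simp add: fe_def)
        have "ennreal (L fe) + inner Q \<le> inner Y"
          unfolding inner_def[of Q]
        proof (subst ennreal_SUP_add_right)
          show "under Q \<noteq> {}" using zero_under by blast
          show "(SUP g \<in> under Q. ennreal (L fe) + ennreal (L g)) \<le> inner Y"
          proof (rule SUP_least)
            fix g assume g: "g \<in> under Q"
            have gb: "g \<in> bcont" "\<And>x. 0 \<le> g x" "\<And>x. g x \<le> 1" using g by (auto simp: under_def)
            have "(\<lambda>x. fe x + g x) \<in> under Y"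
            proof -
              have "0 \<le> fe x + g x \<and> fe x + g x \<le> 1 \<and> (x \<notin> Y \<longrightarrow> fe x + g x = 0)" for x
              proof (cases "x \<in> Q")
                case True
                then have "fe x = 0" by (simp add: Q_def fe_def)
                then show ?thesis using gb(2)[of x] gb(3)[of x] True by (auto simp: Q_def)
              next
                case False
                then have "g x = 0" using g by (auto simp: under_def)
                moreover have "fe x \<le> 1" "0 \<le> fe x" using fb(3)[of x] e by (auto simp: fe_def)
                moreover have "x \<notin> Y \<longrightarrow> fe x = 0" using f e by (auto simp: under_def fe_def)
                ultimately show ?thesis by auto
              qed
              then show ?thesis by (auto simp: under_def intro!: bcont_add feb gb)
            qed
            from inner_upper[OF this] show "ennreal (L fe) + ennreal (L g) \<le> inner Y"
              by (simp add: L_add feb gb ennreal_plus fe0 L_pos)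
          qed
        qed
        then have 1: "ennreal (L fe) + outer (A - U) \<le> inner Y"
          using AQ by (meson add_left_mono order_trans)
        have "ennreal (L f) \<le> ennreal (L fe) + ennreal e"
          using Lfe e fe0 by (simp add: ennreal_plus[symmetric] ennreal_leI del: ennreal_plus)
        then have "ennreal (L f) + outer (A - U) \<le> (ennreal (L fe) + outer (A - U)) + ennreal e"
          by (metis add.assoc add.commute add_left_mono)
        also have "\<dots> \<le> inner Y + ennreal e" by (intro add_right_mono 1)
        finally show "ennreal (L f) + outer (A - U) \<le> inner Y + ennreal e" .
      qed
    qed
  qed
  moreover have "outer (A \<inter> U) \<le> inner (Y \<inter> U)" using Y U by (intro outer_le) auto
  ultimately show "outer (A \<inter> U) + outer (A - U) \<le> inner Y"
    by (meson add_right_mono order_trans)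
qed

text \<open>The Caratheodory measurable sets form a sigma-algebra; \<open>outer_open_split\<close>
  and subadditivity put the open sets, hence all Borel sets, into it.\<close>

lemma measure_space_outer: "measure_space UNIV (sets borel) outer"
proof -
  interpret S: sigma_algebra UNIV "UNIV :: 'a set set"
    using sigma_algebra_Pow[of "UNIV :: 'a set"] by simp
  let ?L = "lambda_system UNIV UNIV outer"
  have ms: "measure_space UNIV ?L outer"
    by (rule S.caratheodory_lemma[OF outer_measure_space_outer])
  then have sa: "sigma_algebra UNIV ?L" by (simp add: measure_space_def)
  have sub: "subadditive UNIV outer"
    using S.countably_subadditive_subadditive[of outer] outer_measure_space_outer
    by (simp add: outer_measure_space_def)
  have "U \<in> ?L" if "open U" for U
  proof -
    have "outer (A \<inter> U) + outer (A - U) = outer A" for A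
    proof (rule antisym[OF outer_open_split[OF that]])
      have "outer ((A \<inter> U) \<union> (A - U)) \<le> outer (A \<inter> U) + outer (A - U)"
        using sub unfolding subadditive_def by (metis Diff_disjoint Int_Diff_disjoint UNIV_I)
      then show "outer A \<le> outer (A \<inter> U) + outer (A - U)" by (simp add: Int_Diff_Un)
    qed
    then show ?thesis by (simp add: S.lambda_system_eq)
  qed
  then have "sigma_sets UNIV {S :: 'a set. open S} \<subseteq> ?L"
    by (intro sigma_algebra.sigma_sets_subset[OF sa]) auto
  then have "sets (borel :: 'a measure) \<subseteq> ?L" by (simp add: borel_def)
  with ms show ?thesis
    using sets.sigma_algebra_axioms[of "borel :: 'a measure"] by (intro measure_down[OF ms]) auto
qed

definition repr :: "'a measure" where
  "repr = measure_of UNIV (sets borel) outer"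

lemma sets_repr: "sets repr = sets borel"
  unfolding repr_def using sets.sigma_sets_eq[of "borel :: 'a measure"]
  by (subst sets_measure_of) auto

lemma emeasure_repr: "A \<in> sets borel \<Longrightarrow> emeasure repr A = outer A"
  unfolding repr_def using measure_space_outer sets.sigma_sets_eq[of "borel :: 'a measure"]
  by (intro emeasure_measure_of_sigma) (auto simp: measure_space_def)

lemma repr_M1: "repr \<in> M1"
proof -
  have "space repr = UNIV" using sets_eq_imp_space_eq[OF sets_repr] by simp
  then have "prob_space repr"
    by (intro prob_spaceI) (simp add: emeasure_repr outer_open inner_UNIV)
  then show ?thesis by (simp add: M1_def sets_repr)
qed

text \<open>N f is cut into N slices \<open>g k\<close> of height 1. The slice
  \<open>g (Suc k)\<close> lives on the open set {N f > k + 1}, whose mass therefore bounds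
  \<open>L (g (Suc k))\<close>, while the previous slice \<open>g k\<close> equals 1 there. The
  shift by one slice leaves only \<open>g 0\<close> uncovered, an error of 1 / N after
  division.\<close>

lemma L_le_integral_repr:
  assumes f: "f \<in> bcont" "\<And>x. 0 \<le> f x" "\<And>x. f x \<le> 1"
  shows "L f \<le> (\<integral>x. f x \<partial>repr)"
proof -
  interpret prob_space repr using repr_M1 by (simp add: M1_def)
  have sp: "space repr = UNIV" using sets_eq_imp_space_eq[OF sets_repr] by simp
  have "L f \<le> (\<integral>x. f x \<partial>repr) + 1 / real (Suc n)" for n
  proof -
    define N where "N = Suc n"
    define g where "g k x = min 1 (max 0 (real N * f x - real k))" for k x
    have g: "g k \<in> bcont" for k
      unfolding g_def by (intro bcont_min bcont_max bcont_diff bcont_const bcont_scale f)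
    have g01: "0 \<le> g k x" "g k x \<le> 1" for k x by (auto simp: g_def)
    have clamp: "(\<Sum>k<m. min 1 (max 0 (t - real k))) = min t (real m)" if "0 \<le> t" for t :: real and m
      using that by (induction m) (auto simp: min_def max_def)
    have sumg: "(\<Sum>k<N. g k x) = real N * f x" for x
    proof -
      have "real N * f x \<le> real N" using f(3)[of x] by (simp add: mult_left_le)
      then show ?thesis
        unfolding g_def by (subst clamp) (auto simp: f)
    qed
    have Lg: "L (g k) \<le> prob {x. real k < real N * f x}" for k
    proof -
      have op: "open {x. real k < real N * f x}"
        by (intro open_Collect_less continuous_intros bcont_continuous f)
      have "g k \<in> under {x. real k < real N * f x}"
        using g[of k] by (auto simp: under_def g_def)
      from inner_upper[OF this] have "ennreal (L (g k)) \<le> emeasure repr {x. real k < real N * f x}"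
        using op by (simp add: emeasure_repr outer_open)
      then show ?thesis
        by (simp add: emeasure_eq_measure ennreal_le_iff)
    qed
    have Lg': "L (g (Suc k)) \<le> (\<integral>x. g k x \<partial>repr)" for k
    proof -
      have op: "open {x. real (Suc k) < real N * f x}"
        by (intro open_Collect_less continuous_intros bcont_continuous f)
      have "L (g (Suc k)) \<le> prob {x. real (Suc k) < real N * f x}" by (rule Lg)
      also have "\<dots> = (\<integral>x. indicator {x. real (Suc k) < real N * f x} x \<partial>repr)"
        using op by (simp add: sp sets_repr)
      also have "\<dots> \<le> (\<integral>x. g k x \<partial>repr)"
        using op by (intro integral_mono integrable_bcont g repr_M1 integrable_real_indicator)
          (auto simp: sets_repr g_def emeasure_eq_measure split: split_indicator)
      finally show ?thesis .
    qed
    have gi: "0 \<le> (\<integral>x. g k x \<partial>repr)" for k by (simp add: g01)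
    have "real N * L f = L (\<lambda>x. \<Sum>k<N. g k x)" using f by (simp add: sumg L_scale)
    also have "\<dots> = (\<Sum>k<Suc n. L (g k))" unfolding N_def[symmetric] by (intro L_sum g)
    also have "\<dots> = L (g 0) + (\<Sum>k<n. L (g (Suc k)))" by (rule sum.lessThan_Suc_shift)
    also have "\<dots> \<le> 1 + (\<Sum>k<n. \<integral>x. g k x \<partial>repr)"
    proof (intro add_mono sum_mono Lg')
      have "L (g 0) \<le> L (\<lambda>_. 1)" by (intro L_mono g bcont_const g01)
      then show "L (g 0) \<le> 1" by (simp add: L_one)
    qed
    also have "\<dots> \<le> 1 + (\<Sum>k<N. \<integral>x. g k x \<partial>repr)" unfolding N_def by (simp add: gi)
    also have "(\<Sum>k<N. \<integral>x. g k x \<partial>repr) = (\<integral>x. (\<Sum>k<N. g k x) \<partial>repr)"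
      by (intro Bochner_Integration.integral_sum[symmetric] integrable_bcont g repr_M1)
    also have "\<dots> = real N * (\<integral>x. f x \<partial>repr)" by (simp add: sumg)
    finally have "real N * L f \<le> 1 + real N * (\<integral>x. f x \<partial>repr)" .
    then show ?thesis by (simp add: N_def field_simps)
  qed
  then have "\<forall>n. L f - 1 / real (Suc n) \<le> (\<integral>x. f x \<partial>repr)" by (simp add: algebra_simps)
  moreover have "(\<lambda>n. L f - 1 / real (Suc n)) \<longlonglongrightarrow> L f - 0"
    by (intro tendsto_intros LIMSEQ_Suc lim_1_over_n)
  ultimately show ?thesis using LIMSEQ_le_const2[of _ "L f - 0"] by auto
qed

text \<open>An affine change brings f into [0, 1]; the one-sided bound applied to g and to 1 - g
  gives both inequalities.\<close>

lemma integral_repr: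
  assumes f: "f \<in> bcont"
  shows "(\<integral>x. f x \<partial>repr) = L f"
proof -
  interpret prob_space repr using repr_M1 by (simp add: M1_def)
  obtain B where B: "0 \<le> B" "\<And>x. \<bar>f x\<bar> \<le> B" using bcont_bounded[OF f] by blast
  \<comment> \<open>Makes |c f| at most 1/2, so that adding 1/2 lands in [0, 1]; B + 1 avoids a
    division by 0.\<close>
  define c where "c = 1 / (2 * (B + 1))"
  have c: "c > 0" using B by (simp add: c_def)
  define g where "g x = c * f x + 1 / 2" for x
  have cf: "(\<lambda>x. c * f x) \<in> bcont" by (intro bcont_scale f)
  have g: "g \<in> bcont" unfolding g_def by (intro bcont_add cf bcont_const)
  have g01: "0 \<le> g x" "g x \<le> 1" for x
    using B(2)[of x] B(1) by (auto simp: g_def c_def field_simps)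
  have int: "(\<integral>x. g x \<partial>repr) = c * (\<integral>x. f x \<partial>repr) + 1 / 2"
    unfolding g_def using integrable_bcont[OF f repr_M1] by (simp add: prob_space)
  have Lg: "L g = c * L f + 1 / 2"
    unfolding g_def using L_add[OF cf bcont_const[of "1/2"]] by (simp add: L_const L_scale f)
  have "L g \<le> (\<integral>x. g x \<partial>repr)" by (intro L_le_integral_repr g g01)
  moreover have "L (\<lambda>x. 1 - g x) \<le> (\<integral>x. 1 - g x \<partial>repr)"
    using g01 by (intro L_le_integral_repr bcont_diff bcont_const g) auto
  then have "(\<integral>x. g x \<partial>repr) \<le> L g"
    using integrable_bcont[OF g repr_M1] by (simp add: L_diff bcont_const g L_one prob_space)
  ultimately have "c * (\<integral>x. f x \<partial>repr) = c * L f" using int Lg by simp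
  then show ?thesis using c by simp
qed

end

subsection \<open>The weak topology\<close>

lemma topspace_weak_top: "topspace (weak_top :: 'a::euclidean_space measure topology) = M1"
proof -
  have "(M1 :: 'a measure set) \<in> {{M \<in> M1. (\<integral>x. f x \<partial>M) \<in> U} | (f :: 'a \<Rightarrow> real) U.
        continuous_on UNIV f \<and> bounded (range f) \<and> open U}"
    by (rule CollectI, rule exI[of _ "\<lambda>_. 0"], rule exI[of _ UNIV]) auto
  then show ?thesis unfolding weak_top_def topology_generated_by_topspace by blast
qed

lemma openin_weak_top_basic:
  "f \<in> bcont \<Longrightarrow> open U \<Longrightarrow> openin weak_top {\<mu> \<in> M1. (\<integral>x. f x \<partial>\<mu>) \<in> U}"
  unfolding weak_top_def by (intro topology_generated_by_Basis) (auto simp: bcont_def)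

lemma continuous_map_integral:
  "f \<in> bcont \<Longrightarrow> continuous_map weak_top euclideanreal (\<lambda>\<mu>. \<integral>x. f x \<partial>\<mu>)"
  by (simp add: continuous_map_def topspace_weak_top openin_weak_top_basic)

text \<open>Passage from the subbasis to a neighbourhood basis: finitely many tests with one common
  tolerance. Intersections are handled by uniting the tests and taking the smaller
  tolerance.\<close>

lemma weak_top_nbhd:
  assumes "openin weak_top U" "\<mu> \<in> U"
  obtains F e where "finite F" "F \<subseteq> bcont" "0 < e"
    "{\<nu> \<in> M1. \<forall>f\<in>F. \<bar>(\<integral>x. f x \<partial>\<nu>) - (\<integral>x. f x \<partial>\<mu>)\<bar> < e} \<subseteq> U"
proof -
  let ?N = "\<lambda>F e. {\<nu> \<in> M1. \<forall>f\<in>F. \<bar>(\<integral>x. f x \<partial>\<nu>) - (\<integral>x. f x \<partial>\<mu>)\<bar> < e}"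
  have "\<exists>F e. finite F \<and> F \<subseteq> bcont \<and> 0 < e \<and> ?N F e \<subseteq> U"
    using assms[unfolded weak_top_def openin_topology_generated_by_iff]
  proof (induction rule: generate_topology_on.induct)
    case Empty
    then show ?case by simp
  next
    case (Int a b)
    have "\<exists>F e. finite F \<and> F \<subseteq> bcont \<and> 0 < e \<and> ?N F e \<subseteq> a" using Int by blast
    then obtain F e where 1: "finite F" "F \<subseteq> bcont" "0 < e" "?N F e \<subseteq> a" by (elim exE conjE)
    have "\<exists>F e. finite F \<and> F \<subseteq> bcont \<and> 0 < e \<and> ?N F e \<subseteq> b" using Int by blast
    then obtain F' e' where 2: "finite F'" "F' \<subseteq> bcont" "0 < e'" "?N F' e' \<subseteq> b" by (elim exE conjE)
    have "?N (F \<union> F') (min e e') \<subseteq> ?N F e" "?N (F \<union> F') (min e e') \<subseteq> ?N F' e'" by auto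
    then have "?N (F \<union> F') (min e e') \<subseteq> a \<inter> b" using 1(4) 2(4) by (meson le_inf_iff order_trans)
    with 1 2 show ?case by (intro exI[of _ "F \<union> F'"] exI[of _ "min e e'"] conjI) simp_all
  next
    case (UN K)
    then obtain k where "k \<in> K" "\<mu> \<in> k" by auto
    then show ?case using UN.IH[OF \<open>k \<in> K\<close> \<open>\<mu> \<in> k\<close>] by (meson Union_upper order_trans)
  next
    case (Basis s)
    then obtain f U where f: "f \<in> bcont" "open U" "s = {M \<in> M1. (\<integral>x. f x \<partial>M) \<in> U}"
      by (auto simp: bcont_def)
    then obtain e where "e > 0" "ball (\<integral>x. f x \<partial>\<mu>) e \<subseteq> U"
      using Basis by (auto simp: open_contains_ball)
    then show ?case
      using f by (intro exI[of _ "{f}"] exI[of _ e]) (auto simp: subset_iff dist_real_def abs_minus_commute)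
  qed
  then show thesis using that by blast
qed

lemma continuous_map_real_uniform_approx:
  assumes "\<And>e::real. 0 < e \<Longrightarrow> \<exists>P. continuous_map X euclideanreal P \<and> (\<forall>x \<in> topspace X. \<bar>P x - Q x\<bar> \<le> e)"
  shows "continuous_map X euclideanreal Q"
proof -
  have "\<exists>P. continuous_map X euclideanreal P \<and> (\<forall>x \<in> topspace X. \<bar>P x - Q x\<bar> \<le> 1 / real (Suc n))" for n
    using assms[of "1 / real (Suc n)"] by auto
  then obtain P where P: "\<And>n. continuous_map X euclideanreal (P n)"
      "\<And>n x. x \<in> topspace X \<Longrightarrow> \<bar>P n x - Q x\<bar> \<le> 1 / real (Suc n)" by metis
  have "continuous_map X Met_TC.mtopology Q"
  proof (rule Met_TC.continuous_map_uniform_limit[where F = sequentially and f = P])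
    show "\<forall>\<^sub>F n in sequentially. continuous_map X Met_TC.mtopology (P n)" using P(1) by simp
    fix e :: real assume e: "0 < e"
    have "\<forall>\<^sub>F n in sequentially. 1 / real (Suc n) < e"
      using order_tendstoD(2)[OF LIMSEQ_Suc[OF lim_1_over_n], of e] e by simp
    then show "\<forall>\<^sub>F n in sequentially. \<forall>x\<in>topspace X. Q x \<in> UNIV \<and> dist (P n x) (Q x) < e"
      by eventually_elim (auto simp: dist_real_def intro: le_less_trans[OF P(2)])
  qed simp
  then show ?thesis by simp
qed

lemma closedin_Collect_ball:
  assumes "\<And>i. i \<in> I \<Longrightarrow> continuous_map X Y (\<phi> i)" "\<And>i. i \<in> I \<Longrightarrow> closedin Y (C i)"
  shows "closedin X {x \<in> topspace X. \<forall>i\<in>I. \<phi> i x \<in> C i}"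
proof (cases "I = {}")
  case False
  have "closedin X (\<Inter>i\<in>I. {x \<in> topspace X. \<phi> i x \<in> C i})"
    using assms False by (intro closedin_INT closedin_continuous_map_preimage) auto
  also have "(\<Inter>i\<in>I. {x \<in> topspace X. \<phi> i x \<in> C i}) = {x \<in> topspace X. \<forall>i\<in>I. \<phi> i x \<in> C i}"
    using False by auto
  finally show ?thesis .
qed simp

subsection \<open>Compactness of uniformly tight sets\<close>

text \<open>The bound on the integral of \<open>G\<close> is stated through truncations, so that
  each single condition concerns the integral of a bounded continuous function and is weakly
  closed.\<close>

definition tight_set :: "('a::euclidean_space \<Rightarrow> real) \<Rightarrow> real \<Rightarrow> 'a measure set" where
  "tight_set G R = {\<mu> \<in> M1. \<forall>m\<ge>0. (\<integral>x. min (G x) m \<partial>\<mu>) \<le> R}"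

context confining
begin

text \<open>Positivity and normalisation confine \<open>L f\<close> to the interval [- B f, B f], so
  Tychonoff applies. Each axiom of \<open>tight_functional\<close> involves finitely many
  coordinates and defines a closed set. Extensional functions are used because the product topology
  lives on them.\<close>

lemma compactin_tight_functionals:
  defines "P \<equiv> product_topology (\<lambda>_. euclideanreal) bcont"
  shows "compactin P {L \<in> bcont \<rightarrow>\<^sub>E UNIV. tight_functional G L R}"
proof -
  define B :: "('a \<Rightarrow> real) \<Rightarrow> real" where "B f = (SUP x. \<bar>f x\<bar>)" for f
  have B: "\<bar>f x\<bar> \<le> B f" if "f \<in> bcont" for f x
  proof -
    obtain C where "\<And>x. \<bar>f x\<bar> \<le> C" using bcont_bounded[OF \<open>f \<in> bcont\<close>] by blast
    then show ?thesis unfolding B_def by (intro cSUP_upper) (auto simp: bdd_above_def)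
  qed
  have top: "topspace P = bcont \<rightarrow>\<^sub>E UNIV" by (simp add: P_def topspace_product_topology)
  have proj: "continuous_map P euclideanreal (\<lambda>L. L f)" if "f \<in> bcont" for f
    unfolding P_def using that by (rule continuous_map_product_projection)
  have cpt: "compactin P (PiE bcont (\<lambda>f. {- B f..B f}))"
    unfolding P_def compactin_PiE by simp
  let ?Z1 = "{L \<in> topspace P. \<forall>i\<in>bcont \<times> bcont. (\<lambda>(f, g) L. L (\<lambda>x. f x + g x) - (L f + L g)) i L \<in> {0}}"
  let ?Z2 = "{L \<in> topspace P. \<forall>i\<in>UNIV \<times> bcont. (\<lambda>(c, f) L. L (\<lambda>x. c * f x) - c * L f) i L \<in> {0}}"
  let ?Z3 = "{L \<in> topspace P. \<forall>f\<in>{f\<in>bcont. \<forall>x. 0 \<le> f x}. L f \<in> {0..}}"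
  let ?Z4 = "{L \<in> topspace P. L (\<lambda>_. 1) \<in> {1}}"
  let ?Z5 = "{L \<in> topspace P. \<forall>m\<in>{0..}. L (\<lambda>x. min (G x) m) \<in> {..R}}"
  have "closedin P ?Z1"
    by (rule closedin_Collect_ball[where Y = euclideanreal])
      (auto intro!: continuous_map_diff continuous_map_add proj bcont_add)
  moreover have "closedin P ?Z2"
    by (rule closedin_Collect_ball[where Y = euclideanreal])
      (auto intro!: continuous_map_diff continuous_map_real_mult_left proj bcont_scale)
  moreover have "closedin P ?Z3"
    by (rule closedin_Collect_ball[where Y = euclideanreal]) (auto intro!: proj)
  moreover have "closedin P ?Z4"
    by (rule closedin_continuous_map_preimage[where Y = euclideanreal]) (auto intro!: proj bcont_const)
  moreover have "closedin P ?Z5"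
    by (rule closedin_Collect_ball[where Y = euclideanreal]) (auto intro!: proj min_G_bcont)
  ultimately have "compactin P ((?Z1 \<inter> (?Z2 \<inter> (?Z3 \<inter> (?Z4 \<inter> ?Z5)))) \<inter> (PiE bcont (\<lambda>f. {- B f..B f})))"
    by (intro closed_Int_compactin closedin_Int cpt)
  also have "(?Z1 \<inter> (?Z2 \<inter> (?Z3 \<inter> (?Z4 \<inter> ?Z5)))) \<inter> (PiE bcont (\<lambda>f. {- B f..B f}))
      = {L \<in> bcont \<rightarrow>\<^sub>E UNIV. tight_functional G L R}" (is "?lhs = ?rhs")
  proof (intro equalityI subsetI)
    fix L assume "L \<in> ?lhs"
    then show "L \<in> ?rhs"
      by (auto simp: top tight_functional_def tight_functional_axioms_def confining_axioms)
  next
    fix L assume L: "L \<in> ?rhs"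
    then interpret L: tight_functional G L R by simp
    have "L f \<le> B f" "- B f \<le> L f" if f: "f \<in> bcont" for f
    proof -
      have "L f \<le> L (\<lambda>_. B f)" using B[OF f]
        by (intro L.L_mono bcont_const f) (simp add: abs_le_iff)
      moreover have "L (\<lambda>_. - B f) \<le> L f" using B[OF f]
        by (intro L.L_mono bcont_const f) (simp add: abs_le_iff minus_le_iff)
      ultimately show "L f \<le> B f" "- B f \<le> L f" by (simp_all add: L.L_const)
    qed
    then show "L \<in> ?lhs" using L L.L_add L.L_scale L.L_pos L.L_one L.L_tight
      by (auto simp: top PiE_iff)
  qed
  finally show ?thesis .
qed

text \<open>The map \<open>repr\<close> from functionals to measures is continuous, because a
  subbasic weakly open set pulls back to a condition on one coordinate. Its image is thus compact,
  and a cover of the tight set can be tested on this image.\<close>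

lemma compactin_tight_set: "compactin weak_top (tight_set G R)"
proof -
  define Z where "Z = {L \<in> bcont \<rightarrow>\<^sub>E UNIV. tight_functional G L R}"
  let ?P = "product_topology (\<lambda>_. euclideanreal) (bcont :: ('a \<Rightarrow> real) set)"
  have Zc: "compactin ?P Z" unfolding Z_def by (rule compactin_tight_functionals)
  have int: "(\<integral>x. f x \<partial>tight_functional.repr L) = L f" if "L \<in> Z" "f \<in> bcont" for L f
    using that tight_functional.integral_repr[of G L R f] by (simp add: Z_def)
  have M1: "tight_functional.repr L \<in> M1" if "L \<in> Z" for L
    using that tight_functional.repr_M1[of G L R] by (simp add: Z_def)
  have topZ: "topspace (subtopology ?P Z) = Z"
    by (auto simp: Z_def topspace_product_topology)
  have "continuous_map (subtopology ?P Z) weak_top tight_functional.repr"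
    unfolding weak_top_def continuous_on_generated_topo_iff
  proof (intro conjI allI impI)
    fix U assume "U \<in> {{M \<in> M1. (\<integral>x. f x \<partial>M) \<in> U} | (f :: 'a \<Rightarrow> real) U.
        continuous_on UNIV f \<and> bounded (range f) \<and> open U}"
    then obtain f T where f: "f \<in> bcont" "open T" "U = {M \<in> M1. (\<integral>x. f x \<partial>M) \<in> T}"
      by (auto simp: bcont_def)
    have "tight_functional.repr -` U \<inter> topspace (subtopology ?P Z)
        = {L \<in> topspace (subtopology ?P Z). L f \<in> T}"
      unfolding topZ using f int M1 by auto
    also have "openin (subtopology ?P Z) \<dots>"
      using f by (intro openin_continuous_map_preimage[where Y = euclideanreal]
          continuous_map_from_subtopology continuous_map_product_projection) auto
    finally show "openin (subtopology ?P Z) (tight_functional.repr -` U \<inter> topspace (subtopology ?P Z))" .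
  next
    show "tight_functional.repr ` topspace (subtopology ?P Z) \<subseteq> \<Union> {{M \<in> M1. (\<integral>x. f x \<partial>M) \<in> U} | (f :: 'a \<Rightarrow> real) U.
        continuous_on UNIV f \<and> bounded (range f) \<and> open U}"
      unfolding topology_generated_by_topspace[symmetric] weak_top_def[symmetric] topspace_weak_top topZ
      using M1 by auto
  qed
  moreover have "compactin (subtopology ?P Z) Z"
    using Zc by (simp add: compactin_subtopology)
  ultimately have cpt: "compactin weak_top (tight_functional.repr ` Z)" by (rule image_compactin[rotated])
  let ?L = "\<lambda>\<mu>. restrict (\<lambda>f. \<integral>x. f x \<partial>\<mu>) bcont"
  have LZ: "?L \<mu> \<in> Z" if \<mu>: "\<mu> \<in> tight_set G R" for \<mu>
  proof -
    have \<mu>1: "\<mu> \<in> M1" and tight: "\<And>m. m \<ge> 0 \<Longrightarrow> (\<integral>x. min (G x) m \<partial>\<mu>) \<le> R"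
      using \<mu> by (auto simp: tight_set_def)
    interpret prob_space \<mu> using \<mu>1 by (simp add: M1_def)
    have "tight_functional G (?L \<mu>) R"
      using tight by unfold_locales
        (auto simp: bcont_add bcont_scale bcont_const min_G_bcont integrable_bcont \<mu>1 prob_space)
    then show ?thesis by (simp add: Z_def)
  qed
  \<comment> \<open>Measures with the same integrals belong to the same weakly open sets, so uniqueness of the
    representing measure is not needed.\<close>
  have mem: "\<mu> \<in> U"
    if U: "openin weak_top U" "tight_functional.repr (?L \<mu>) \<in> U" and \<mu>: "\<mu> \<in> tight_set G R" for \<mu> U
  proof -
    from U obtain F e where F: "F \<subseteq> bcont" "0 < e"
      "{\<nu> \<in> M1. \<forall>f\<in>F. \<bar>(\<integral>x. f x \<partial>\<nu>) - (\<integral>x. f x \<partial>tight_functional.repr (?L \<mu>))\<bar> < e} \<subseteq> U"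
      by (rule weak_top_nbhd)
    have "(\<integral>x. f x \<partial>\<mu>) = (\<integral>x. f x \<partial>tight_functional.repr (?L \<mu>))" if "f \<in> F" for f
      using int[OF LZ[OF \<mu>], of f] that F(1) by auto
    moreover have "\<mu> \<in> M1" using \<mu> by (simp add: tight_set_def)
    ultimately show ?thesis using F(2,3) by auto
  qed
  show ?thesis
    unfolding compactin_def
  proof (intro conjI allI impI)
    show "tight_set G R \<subseteq> topspace weak_top" by (auto simp: topspace_weak_top tight_set_def)
    fix \<U> assume \<U>: "Ball \<U> (openin weak_top) \<and> tight_set G R \<subseteq> \<Union> \<U>"
    have "tight_functional.repr L \<in> tight_set G R" if "L \<in> Z" for L
      using that M1[OF that] int[OF that min_G_bcont]
      by (auto simp: tight_set_def Z_def tight_functional.L_tight)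
    then have "tight_functional.repr ` Z \<subseteq> \<Union> \<U>" using \<U> by blast
    then obtain \<F> where \<F>: "finite \<F>" "\<F> \<subseteq> \<U>" "tight_functional.repr ` Z \<subseteq> \<Union> \<F>"
      using cpt \<U> unfolding compactin_def by meson
    have "tight_set G R \<subseteq> \<Union> \<F>"
    proof
      fix \<mu> assume \<mu>: "\<mu> \<in> tight_set G R"
      have "tight_functional.repr (?L \<mu>) \<in> \<Union> \<F>" using \<F>(3) LZ[OF \<mu>] by auto
      then obtain U where U: "U \<in> \<F>" "tight_functional.repr (?L \<mu>) \<in> U" by auto
      then have "openin weak_top U" using \<U> \<F>(2) by auto
      then have "\<mu> \<in> U" using U(2) \<mu> by (rule mem)
      then show "\<mu> \<in> \<Union> \<F>" using U(1) by auto
    qed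
    with \<F> show "\<exists>\<F>. finite \<F> \<and> \<F> \<subseteq> \<U> \<and> tight_set G R \<subseteq> \<Union> \<F>" by blast
  qed
qed

end

subsection \<open>Partitions of unity and uniform approximation of integrals\<close>

text \<open>Hat functions of radius \<delta> around a (\<delta>/2)-net of K, divided by the larger
  of their sum and \<delta>/2. On K the sum is at least \<delta>/2, so the division normalises
  exactly; elsewhere the floor \<delta>/2 keeps the quotient continuous and the total at most
  1.\<close>

lemma partition_of_unity_compact:
  fixes K :: "'a::euclidean_space set"
  assumes K: "compact K" and \<delta>: "0 < \<delta>"
  obtains J g where "finite J" "J \<subseteq> K"
    "\<And>j. g j \<in> bcont" "\<And>j x. 0 \<le> g j x" "\<And>j x. g j x \<noteq> 0 \<Longrightarrow> dist x j < \<delta>"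
    "\<And>x. (\<Sum>j\<in>J. g j x) \<le> (1::real)" "\<And>x. x \<in> K \<Longrightarrow> (\<Sum>j\<in>J. g j x) = 1"
proof -
  obtain J where J: "finite J" "J \<subseteq> K" "K \<subseteq> (\<Union>j\<in>J. ball j (\<delta>/2))"
    using compactE_image[OF K, of K "\<lambda>j. ball j (\<delta>/2)"] \<delta> by (metis UN_I centre_in_ball half_gt_zero open_ball subsetI)
  define h where "h j x = max 0 (\<delta> - dist x j)" for j x :: 'a
  define D where "D x = max (\<delta>/2) (\<Sum>j\<in>J. h j x)" for x
  define g where "g j x = (if j \<in> J then h j x / D x else 0)" for j x
  have D: "D x > 0" "D x \<ge> (\<Sum>j\<in>J. h j x)" for x using \<delta> by (auto simp: D_def)
  have h0: "0 \<le> h j x" for j x by (simp add: h_def)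
  have hc: "continuous_on UNIV (h j)" for j unfolding h_def by (intro continuous_intros)
  have Dc: "continuous_on UNIV D"
    unfolding D_def by (intro continuous_intros hc)
  have hD: "h j x \<le> D x" if "j \<in> J" for j x
  proof -
    have "h j x \<le> (\<Sum>j\<in>J. h j x)" using that J h0 by (intro member_le_sum) auto
    then show ?thesis using D(2)[of x] by simp
  qed
  have sum: "(\<Sum>j\<in>J. g j x) = (\<Sum>j\<in>J. h j x) / D x" for x
    by (simp add: g_def sum_divide_distrib)
  show thesis
  proof
    show "finite J" "J \<subseteq> K" by fact+
    show "0 \<le> g j x" for j x using h0 D(1)[of x] by (auto simp: g_def)
    show "g j \<in> bcont" for j
    proof (cases "j \<in> J")
      case True
      have "continuous_on UNIV (\<lambda>x. h j x / D x)"
        using D(1) by (intro continuous_on_divide hc Dc) (auto simp: less_imp_neq[THEN not_sym])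
      then show ?thesis unfolding g_def using True h0 D(1) hD[OF True]
        by (intro bcontI[of _ 1]) (auto simp: abs_of_pos)
    next
      case False
      then show ?thesis unfolding g_def by (simp add: bcont_const)
    qed
    show "dist x j < \<delta>" if "g j x \<noteq> 0" for j x
      using that by (auto simp: g_def h_def max_def split: if_splits)
    show "(\<Sum>j\<in>J. g j x) \<le> 1" for x unfolding sum using D[of x] by simp
    show "(\<Sum>j\<in>J. g j x) = 1" if "x \<in> K" for x
    proof -
      obtain j where j: "j \<in> J" "dist j x < \<delta>/2" using J \<open>x \<in> K\<close> by auto
      then have "\<delta>/2 \<le> \<delta> - dist x j" by (simp add: dist_commute field_simps)
      also have "\<dots> \<le> h j x" by (simp add: h_def)
      also have "\<dots> \<le> (\<Sum>j\<in>J. h j x)" using j J h0 by (intro member_le_sum) auto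
      finally have "D x = (\<Sum>j\<in>J. h j x)" by (simp add: D_def)
      then show ?thesis unfolding sum using D(1)[of x] by simp
    qed
  qed
qed

lemma M1_prob: "\<mu> \<in> M1 \<Longrightarrow> prob_space \<mu>"
  by (simp add: M1_def)

lemma M1_sets: "\<mu> \<in> M1 \<Longrightarrow> sets \<mu> = sets borel"
  by (simp add: M1_def)

lemma M1_space: "\<mu> \<in> M1 \<Longrightarrow> space \<mu> = UNIV"
  by (metis M1_sets sets_eq_imp_space_eq space_borel)

lemma M1_borel_measurable: "\<mu> \<in> M1 \<Longrightarrow> f \<in> borel_measurable borel \<Longrightarrow> f \<in> borel_measurable \<mu>"
  by (simp add: M1_def cong: measurable_cong_sets)

lemma integral_M1_const: "\<mu> \<in> M1 \<Longrightarrow> (\<integral>x. c \<partial>\<mu>) = (c::real)"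
  using prob_space.prob_space[OF M1_prob, of \<mu>] by simp

lemma integral_M1_mono:
  "\<mu> \<in> M1 \<Longrightarrow> f \<in> bcont \<Longrightarrow> g \<in> bcont \<Longrightarrow> (\<And>x. f x \<le> g x) \<Longrightarrow> (\<integral>x. f x \<partial>\<mu>) \<le> (\<integral>x. g x \<partial>\<mu>)"
  by (intro integral_mono integrable_bcont)

text \<open>All 1-Lipschitz functions bounded by 1 are controlled at once by finitely many
  integrals: on a compact set of almost full \<nu>-mass, f is within e/8 of the sum of f j * g j,
  whose coefficients are bounded by 1. The test functions \<open>g j\<close> do not depend on
  f.\<close>

lemma d_FM_weak_nbhd:
  fixes \<nu> :: "'a::euclidean_space measure"
  assumes \<nu>: "\<nu> \<in> M1" and e: "0 < e"
  obtains U where "openin weak_top U" "\<nu> \<in> U" "\<And>\<mu>. \<mu> \<in> U \<Longrightarrow> d_FM \<mu> \<nu> < e"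
proof -
  interpret \<nu>: prob_space \<nu> by (rule M1_prob[OF \<nu>])
  have "(\<lambda>n. measure \<nu> (cball 0 (real n))) \<longlonglongrightarrow> measure \<nu> (\<Union>n. cball 0 (real n))"
  proof (rule \<nu>.finite_Lim_measure_incseq)
    show "range (\<lambda>n. cball 0 (real n)) \<subseteq> sets \<nu>" by (auto simp: M1_sets[OF \<nu>])
    show "incseq (\<lambda>n. cball (0::'a) (real n))" by (auto simp: incseq_def)
  qed
  moreover have "(\<Union>n. cball 0 (real n)) = (UNIV :: 'a set)"
    using real_arch_simple by (auto simp: dist_norm)
  ultimately have "(\<lambda>n. measure \<nu> (cball 0 (real n))) \<longlonglongrightarrow> 1"
    using \<nu>.prob_space M1_space[OF \<nu>] by simp
  then have "\<forall>\<^sub>F n in sequentially. measure \<nu> (cball 0 (real n)) > 1 - e/8"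
    using e by (intro order_tendstoD) auto
  then obtain n where n: "measure \<nu> (cball 0 (real n)) > 1 - e/8"
    by (auto simp: eventually_sequentially)
  define K :: "'a set" where "K = cball 0 (real n)"
  have "compact K" "0 < e/8" using e by (auto simp: K_def)
  then obtain J g where J: "finite J" "J \<subseteq> K" and g: "\<And>j. g j \<in> bcont"
    and g0: "\<And>j x. 0 \<le> g j x" and gd: "\<And>j x. g j x \<noteq> 0 \<Longrightarrow> dist x j < e/8"
    and g1: "\<And>x. (\<Sum>j\<in>J. g j x) \<le> (1::real)" and gK: "\<And>x. x \<in> K \<Longrightarrow> (\<Sum>j\<in>J. g j x) = 1"
    by (rule partition_of_unity_compact) blast
  define s where "s x = (\<Sum>j\<in>J. g j x)" for x
  have s: "s \<in> bcont" unfolding s_def by (intro bcont_sum g)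
  have s01: "0 \<le> s x" "s x \<le> 1" for x using g0 g1 by (auto simp: s_def sum_nonneg)
  \<comment> \<open>The tolerance per test function, so that all of J together costs at most e/8;
    the + 1 covers an empty J.\<close>
  define \<eta> where "\<eta> = e / (8 * (real (card J) + 1))"
  have \<eta>: "\<eta> > 0" "real (card J) * \<eta> \<le> e / 8"
    using e by (auto simp: \<eta>_def field_simps)
  define U where "U = {\<mu> \<in> topspace weak_top. \<forall>j\<in>J. (\<integral>x. g j x \<partial>\<mu>) \<in> ball (\<integral>x. g j x \<partial>\<nu>) \<eta>}"
  have "openin weak_top (topspace weak_top \<inter> (\<Inter>j\<in>J. {\<mu> \<in> topspace weak_top. (\<integral>x. g j x \<partial>\<mu>) \<in> ball (\<integral>x. g j x \<partial>\<nu>) \<eta>}))"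
  proof (cases "J = {}")
    case False
    then show ?thesis using J(1)
      by (intro openin_Int openin_topspace openin_INT2
          openin_continuous_map_preimage[where Y = euclideanreal] continuous_map_integral g) auto
  qed simp
  also have "\<dots> = U" by (auto simp: U_def)
  finally have Uo: "openin weak_top U" .
  have s\<nu>: "1 - (\<integral>x. s x \<partial>\<nu>) \<le> e / 8"
  proof -
    have "measure \<nu> K = (\<integral>x. indicator K x \<partial>\<nu>)"
      using M1_space[OF \<nu>] M1_sets[OF \<nu>] by (simp add: K_def)
    also have "\<dots> \<le> (\<integral>x. s x \<partial>\<nu>)"
      using M1_sets[OF \<nu>] gK s01
      by (intro integral_mono integrable_bcont s \<nu> integrable_real_indicator)
        (auto simp: K_def s_def \<nu>.emeasure_eq_measure split: split_indicator)
    finally show ?thesis using n by (simp add: K_def)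
  qed
  show thesis
  proof (rule that[of U])
    show "openin weak_top U" by (rule Uo)
    show "\<nu> \<in> U" using \<nu> \<eta> by (simp add: U_def topspace_weak_top)
    fix \<mu> assume "\<mu> \<in> U"
    then have \<mu>: "\<mu> \<in> M1" and close: "\<And>j. j \<in> J \<Longrightarrow> \<bar>(\<integral>x. g j x \<partial>\<mu>) - (\<integral>x. g j x \<partial>\<nu>)\<bar> \<le> \<eta>"
      by (auto simp: U_def topspace_weak_top dist_real_def abs_minus_commute less_imp_le)
    have sint: "(\<integral>x. s x \<partial>\<rho>) = (\<Sum>j\<in>J. \<integral>x. g j x \<partial>\<rho>)" if "\<rho> \<in> M1" for \<rho>
      unfolding s_def using that by (intro Bochner_Integration.integral_sum integrable_bcont g)
    have sdiff: "\<bar>(\<integral>x. s x \<partial>\<mu>) - (\<integral>x. s x \<partial>\<nu>)\<bar> \<le> e / 8"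
    proof -
      have "\<bar>(\<integral>x. s x \<partial>\<mu>) - (\<integral>x. s x \<partial>\<nu>)\<bar> \<le> (\<Sum>j\<in>J. \<bar>(\<integral>x. g j x \<partial>\<mu>) - (\<integral>x. g j x \<partial>\<nu>)\<bar>)"
        by (simp add: sint \<mu> \<nu> sum_subtractf[symmetric] sum_abs)
      also have "\<dots> \<le> real (card J) * \<eta>" by (rule sum_bounded_above[OF close])
      finally show ?thesis using \<eta> by simp
    qed
    have "(\<integral>x. f x \<partial>\<mu>) - (\<integral>x. f x \<partial>\<nu>) \<le> 3 * e / 4"
      if f: "\<And>x. \<bar>f x\<bar> \<le> 1" "\<And>x y. \<bar>f x - f y\<bar> \<le> dist x y" for f
    proof -
      have fb: "f \<in> bcont"
      proof (rule bcontI[OF _ f(1)])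
        have "1-lipschitz_on UNIV f" by (rule lipschitz_onI) (use f(2) in \<open>auto simp: dist_real_def\<close>)
        then show "continuous_on UNIV f" by (rule lipschitz_on_continuous_on)
      qed
      define t where "t x = (\<Sum>j\<in>J. f j * g j x)" for x
      have t: "t \<in> bcont" unfolding t_def by (intro bcont_sum bcont_scale g)
      have tint: "(\<integral>x. t x \<partial>\<rho>) = (\<Sum>j\<in>J. f j * (\<integral>x. g j x \<partial>\<rho>))" if "\<rho> \<in> M1" for \<rho>
        unfolding t_def using that
        by (subst Bochner_Integration.integral_sum) (auto intro!: integrable_bcont g)
      have "\<bar>f x - t x\<bar> \<le> e / 8 + (1 - s x)" for x
      proof -
        have "f x - t x = f x * (1 - s x) + (\<Sum>j\<in>J. (f x - f j) * g j x)"
          by (simp add: t_def s_def left_diff_distrib sum_subtractf sum_distrib_left right_diff_distrib)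
        also have "\<bar>\<dots>\<bar> \<le> \<bar>f x * (1 - s x)\<bar> + (\<Sum>j\<in>J. \<bar>(f x - f j) * g j x\<bar>)"
          by (intro order_trans[OF abs_triangle_ineq] add_left_mono sum_abs)
        also have "\<dots> \<le> 1 * (1 - s x) + (\<Sum>j\<in>J. e / 8 * g j x)"
        proof (intro add_mono sum_mono)
          show "\<bar>f x * (1 - s x)\<bar> \<le> 1 * (1 - s x)"
            unfolding abs_mult using s01[of x] f(1)[of x] by (intro mult_mono) auto
          show "\<bar>(f x - f j) * g j x\<bar> \<le> e / 8 * g j x" for j
            using gd[of j x] f(2)[of x j] g0[of j x]
            by (cases "g j x = 0") (auto simp: abs_mult intro!: mult_right_mono)
        qed
        also have "(\<Sum>j\<in>J. e / 8 * g j x) = e / 8 * s x" by (simp add: s_def sum_distrib_left)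
        also have "\<dots> \<le> e / 8" using s01[of x] e by (simp add: mult_left_le)
        finally show ?thesis by simp
      qed
      note approx = this
      have *: "f x \<le> t x + (e / 8 + (1 - s x))" "t x \<le> f x + (e / 8 + (1 - s x))" for x
        using approx[of x] by linarith+
      have b: "(\<lambda>x. e / 8 + (1 - s x)) \<in> bcont" by (intro bcont_add bcont_diff bcont_const s)
      have bint: "(\<integral>x. h x + (e / 8 + (1 - s x)) \<partial>\<rho>) = (\<integral>x. h x \<partial>\<rho>) + (e / 8 + (1 - (\<integral>x. s x \<partial>\<rho>)))"
        if "\<rho> \<in> M1" "h \<in> bcont" for \<rho> h
        using that prob_space.prob_space[OF M1_prob[OF \<open>\<rho> \<in> M1\<close>]]
        by (simp add: integrable_bcont bcont_const bcont_add bcont_diff s)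
      have "(\<integral>x. f x \<partial>\<mu>) \<le> (\<integral>x. t x + (e / 8 + (1 - s x)) \<partial>\<mu>)"
        by (intro integral_M1_mono \<mu> fb bcont_add t b *)
      then have 1: "(\<integral>x. f x \<partial>\<mu>) \<le> (\<integral>x. t x \<partial>\<mu>) + (e / 8 + (1 - (\<integral>x. s x \<partial>\<mu>)))"
        by (simp add: bint \<mu> t)
      have "(\<integral>x. t x \<partial>\<nu>) \<le> (\<integral>x. f x + (e / 8 + (1 - s x)) \<partial>\<nu>)"
        by (intro integral_M1_mono \<nu> fb bcont_add t b *)
      then have 2: "(\<integral>x. t x \<partial>\<nu>) \<le> (\<integral>x. f x \<partial>\<nu>) + (e / 8 + (1 - (\<integral>x. s x \<partial>\<nu>)))"
        by (simp add: bint \<nu> fb)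
      have "(\<integral>x. t x \<partial>\<mu>) - (\<integral>x. t x \<partial>\<nu>) = (\<Sum>j\<in>J. f j * ((\<integral>x. g j x \<partial>\<mu>) - (\<integral>x. g j x \<partial>\<nu>)))"
        by (simp add: tint \<mu> \<nu> sum_subtractf right_diff_distrib)
      also have "\<dots> \<le> (\<Sum>j\<in>J. \<eta>)"
      proof (rule sum_mono)
        fix j assume "j \<in> J"
        have "f j * ((\<integral>x. g j x \<partial>\<mu>) - (\<integral>x. g j x \<partial>\<nu>)) \<le> \<bar>f j\<bar> * \<bar>(\<integral>x. g j x \<partial>\<mu>) - (\<integral>x. g j x \<partial>\<nu>)\<bar>"
          by (metis abs_ge_self abs_mult)
        also have "\<dots> \<le> 1 * \<eta>" by (intro mult_mono f close \<open>j \<in> J\<close>) auto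
        finally show "f j * ((\<integral>x. g j x \<partial>\<mu>) - (\<integral>x. g j x \<partial>\<nu>)) \<le> \<eta>" by simp
      qed
      also have "\<dots> \<le> e / 8" using \<eta> by simp
      \<comment> \<open>Six errors of e/8: two from replacing f by its node values, one from the
        node integrals, two from the \<nu>-mass missed by s, and one from comparing the s-masses of
        \<mu> and \<nu>.\<close>
      finally show ?thesis using 1 2 s\<nu> abs_le_D2[OF sdiff] by linarith
    qed
    then have "d_FM \<mu> \<nu> \<le> 3 * e / 4"
      unfolding d_FM_def by (intro cSUP_least) (auto intro!: exI[of _ "\<lambda>_. 0"])
    then show "d_FM \<mu> \<nu> < e" using e by simp
  qed
qed

section \<open>Integrals against the square of a measure\<close>

lemma M1_pair:
  assumes "\<mu> \<in> M1" "\<nu> \<in> M1"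
  shows "\<mu> \<Otimes>\<^sub>M \<nu> \<in> M1"
proof -
  interpret A: prob_space \<mu> using assms by (intro M1_prob)
  interpret B: prob_space \<nu> using assms by (intro M1_prob)
  interpret pair_prob_space \<mu> \<nu> ..
  have "sets (\<mu> \<Otimes>\<^sub>M \<nu>) = sets (borel \<Otimes>\<^sub>M borel)"
    using assms by (intro sets_pair_measure_cong M1_sets)
  then show ?thesis unfolding M1_def using prob_space_axioms by (simp only: borel_prod mem_Collect_eq simp_thms)
qed

lemma bcont_tensor:
  assumes "f \<in> bcont" "g \<in> bcont"
  shows "(\<lambda>p. f (fst p) * g (snd p)) \<in> bcont"
proof -
  obtain B where B: "0 \<le> B" "\<And>x. \<bar>f x\<bar> \<le> B" using bcont_bounded[OF assms(1)] by blast
  obtain C where C: "0 \<le> C" "\<And>x. \<bar>g x\<bar> \<le> C" using bcont_bounded[OF assms(2)] by blast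
  have "continuous_on UNIV (\<lambda>p. f (fst p))" "continuous_on UNIV (\<lambda>p. g (snd p))"
    using assms[THEN bcont_continuous]
    by (auto intro!: continuous_on_compose2[where f = fst] continuous_on_compose2[where f = snd]
        continuous_on_fst continuous_on_snd continuous_on_id)
  then show ?thesis
    by (intro bcontI[of _ "B * C"] continuous_on_mult) (auto simp: abs_mult intro!: mult_mono B C)
qed

lemma integral_tensor:
  assumes f: "f \<in> bcont" and g: "g \<in> bcont" and \<mu>: "\<mu> \<in> M1"
  shows "(\<integral>p. f (fst p) * g (snd p) \<partial>(\<mu> \<Otimes>\<^sub>M \<mu>)) = (\<integral>x. f x \<partial>\<mu>) * (\<integral>x. g x \<partial>\<mu>)"
proof -
  interpret A: prob_space \<mu> using \<mu> by (rule M1_prob)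
  interpret pair_prob_space \<mu> \<mu> ..
  have "integrable (\<mu> \<Otimes>\<^sub>M \<mu>) (\<lambda>p. f (fst p) * g (snd p))"
    by (intro integrable_bcont bcont_tensor f g M1_pair \<mu>)
  then have "(\<integral>p. f (fst p) * g (snd p) \<partial>(\<mu> \<Otimes>\<^sub>M \<mu>)) = (\<integral>x. (\<integral>y. f x * g y \<partial>\<mu>) \<partial>\<mu>)"
    by (subst integral_fst'[symmetric]) simp_all
  then show ?thesis by simp
qed

context confining
begin

lemma tight_set_M1: "\<mu> \<in> tight_set G R \<Longrightarrow> \<mu> \<in> M1"
  by (simp add: tight_set_def)

text \<open>With a partition of unity on a compact K, f is replaced by the sum of f (i, j) times g i
  tensor g j. The integral of this sum is a polynomial in finitely many one-variable integrals,
  hence weakly continuous. Away from K x K the error is governed by 1 - s, whose integral is at most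
  R / c for all measures of the tight set, so the approximation is uniform.\<close>

lemma continuous_map_integral_pair:
  assumes f: "f \<in> bcont"
  shows "continuous_map (subtopology weak_top (tight_set G R)) euclideanreal (\<lambda>\<mu>. \<integral>p. f p \<partial>(\<mu> \<Otimes>\<^sub>M \<mu>))"
proof (rule continuous_map_real_uniform_approx)
  fix e :: real assume e: "0 < e"
  obtain B where B: "0 \<le> B" "\<And>p. \<bar>f p\<bar> \<le> B" using bcont_bounded[OF f] by blast
  \<comment> \<open>Both variables may leave K, and f is bounded by B, so the escaping mass costs 2
    * B * (R / c) <= e / 2. The other e / 2 pays for the oscillation of f.\<close>
  define c where "c = max 1 (4 * B * R / e)"
  have c: "0 < c" "2 * B * (R / c) \<le> e / 2" using e by (auto simp: c_def max_def field_simps)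
  define K where "K = {x. G x \<le> c}"
  have K: "compact K" unfolding K_def by (rule G_compact)
  obtain r where r: "K \<subseteq> cball 0 r" using compact_imp_bounded[OF K] bounded_iff[of K] by (auto simp: subset_iff)
  have "uniformly_continuous_on (cball 0 (r + 1) \<times> cball 0 (r + 1)) f"
    by (intro compact_uniformly_continuous continuous_on_subset[OF bcont_continuous[OF f]] compact_Times) auto
  then obtain d where d: "0 < d" "\<And>p q. p \<in> cball 0 (r + 1) \<times> cball 0 (r + 1) \<Longrightarrow>
      q \<in> cball 0 (r + 1) \<times> cball 0 (r + 1) \<Longrightarrow> dist p q < d \<Longrightarrow> dist (f p) (f q) < e / 2"
    unfolding uniformly_continuous_on_def using e by (metis dist_commute half_gt_zero)
  \<comment> \<open>A distance in the product is at most the sum of the two coordinate distances,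
    hence d / 2 each; the bound 1 keeps the supports of the \<open>g j\<close> inside the ball of
    radius r + 1.\<close>
  define \<delta> where "\<delta> = min 1 (d / 2)"
  have \<delta>: "0 < \<delta>" "\<delta> \<le> 1" "2 * \<delta> \<le> d" using d(1) by (auto simp: \<delta>_def)
  obtain J g where J: "finite J" "J \<subseteq> K" and g: "\<And>j. g j \<in> bcont"
    and g0: "\<And>j x. 0 \<le> g j x" and gd: "\<And>j x. g j x \<noteq> 0 \<Longrightarrow> dist x j < \<delta>"
    and g1: "\<And>x. (\<Sum>j\<in>J. g j x) \<le> (1::real)" and gK: "\<And>x. x \<in> K \<Longrightarrow> (\<Sum>j\<in>J. g j x) = 1"
    by (rule partition_of_unity_compact[OF K \<delta>(1)]) blast
  define s where "s x = (\<Sum>j\<in>J. g j x)" for x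
  have s: "s \<in> bcont" unfolding s_def by (intro bcont_sum g)
  have s01: "0 \<le> s x" "s x \<le> 1" for x using g0 g1 by (auto simp: s_def sum_nonneg)
  define t where "t p = (\<Sum>i\<in>J. \<Sum>j\<in>J. f (i, j) * (g i (fst p) * g j (snd p)))" for p
  have t: "t \<in> bcont" unfolding t_def by (intro bcont_sum bcont_scale bcont_tensor g)
  have tint: "(\<integral>p. t p \<partial>(\<mu> \<Otimes>\<^sub>M \<mu>)) = (\<Sum>i\<in>J. \<Sum>j\<in>J. f (i, j) * ((\<integral>x. g i x \<partial>\<mu>) * (\<integral>x. g j x \<partial>\<mu>)))"
    if "\<mu> \<in> M1" for \<mu>
    unfolding t_def using that
    by (simp add: Bochner_Integration.integral_sum integrable_bcont bcont_sum bcont_scale bcont_tensor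
        g M1_pair integral_tensor)
  define b where "b p = e / 2 + B * ((1 - s (fst p)) * 1 + 1 * (1 - s (snd p)))" for p :: "'a \<times> 'a"
  have b: "b \<in> bcont" unfolding b_def
    using bcont_tensor[OF bcont_diff[OF bcont_const[of 1] s] bcont_const[of 1]]
      bcont_tensor[OF bcont_const[of 1] bcont_diff[OF bcont_const[of 1] s]]
    by (intro bcont_add[OF bcont_const] bcont_scale[OF bcont_add])
  have bound: "\<bar>t p - f p\<bar> \<le> b p" for p
  proof -
    obtain x y where p: "p = (x, y)" by (cases p)
    have ss: "s x * s y = (\<Sum>i\<in>J. \<Sum>j\<in>J. g i x * g j y)"
      unfolding s_def by (simp add: sum_product)
    have "t p - f p = (\<Sum>i\<in>J. \<Sum>j\<in>J. (f (i, j) - f p) * (g i x * g j y)) - f p * (1 - s x * s y)"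
      unfolding ss by (simp add: t_def p left_diff_distrib right_diff_distrib sum_subtractf sum_distrib_left)
    also have "\<bar>\<dots>\<bar> \<le> (\<Sum>i\<in>J. \<Sum>j\<in>J. \<bar>(f (i, j) - f p) * (g i x * g j y)\<bar>) + \<bar>f p * (1 - s x * s y)\<bar>"
      by (intro order_trans[OF abs_triangle_ineq4] add_right_mono order_trans[OF sum_abs] sum_mono sum_abs)
    also have "\<dots> \<le> (\<Sum>i\<in>J. \<Sum>j\<in>J. e / 2 * (g i x * g j y)) + B * ((1 - s x) + (1 - s y))"
    proof (intro add_mono sum_mono)
      fix i j assume ij: "i \<in> J" "j \<in> J"
      show "\<bar>(f (i, j) - f p) * (g i x * g j y)\<bar> \<le> e / 2 * (g i x * g j y)"
      proof (cases "g i x * g j y = 0")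
        case False
        then have dx: "dist x i < \<delta>" "dist y j < \<delta>" using gd by auto
        have "norm i \<le> r" "norm j \<le> r" using ij J r by (auto simp: subset_iff)
        moreover have "norm x \<le> norm i + dist x i" "norm y \<le> norm j + dist y j"
          by (metis dist_norm norm_triangle_sub add.commute)+
        ultimately have "(x, y) \<in> cball 0 (r + 1) \<times> cball 0 (r + 1)" "(i, j) \<in> cball 0 (r + 1) \<times> cball 0 (r + 1)"
          using dx \<delta> by auto
        moreover have "dist (i, j) (x, y) < d"
        proof -
          have "dist (i, j) (x, y) \<le> dist i x + dist j y"
            unfolding dist_prod_def by (simp add: real_sqrt_sum_squares_triangle_ineq sqrt_sum_squares_le_sum)
          then show ?thesis using dx \<delta> by (simp add: dist_commute)
        qed
        ultimately have "dist (f (i, j)) (f p) < e / 2" using d(2)[of "(i, j)" "(x, y)"] p by auto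
        then have "\<bar>f (i, j) - f p\<bar> \<le> e / 2" by (simp add: dist_real_def)
        then have "\<bar>f (i, j) - f p\<bar> * (g i x * g j y) \<le> e / 2 * (g i x * g j y)"
          using g0 by (intro mult_right_mono) auto
        then show ?thesis using g0[of i x] g0[of j y] by (simp add: abs_mult)
      qed auto
    next
      have "1 - s x * s y \<le> (1 - s x) + (1 - s y)"
      proof -
        have "0 \<le> (1 - s x) * (1 - s y)" using s01 by simp
        then show ?thesis by (simp add: algebra_simps)
      qed
      moreover have "0 \<le> 1 - s x * s y" using s01[of x] s01[of y] by (simp add: mult_le_one)
      ultimately show "\<bar>f p * (1 - s x * s y)\<bar> \<le> B * ((1 - s x) + (1 - s y))"
        unfolding abs_mult by (intro mult_mono B) auto
    qed
    also have "(\<Sum>i\<in>J. \<Sum>j\<in>J. e / 2 * (g i x * g j y)) = e / 2 * (s x * s y)"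
      by (simp add: ss sum_distrib_left)
    also have "\<dots> \<le> e / 2" using e s01[of x] s01[of y] by (simp add: mult_left_le mult_le_one)
    finally show ?thesis by (simp add: b_def p)
  qed
  show "\<exists>P. continuous_map (subtopology weak_top (tight_set G R)) euclideanreal P \<and>
     (\<forall>\<mu>\<in>topspace (subtopology weak_top (tight_set G R)). \<bar>P \<mu> - (\<integral>p. f p \<partial>(\<mu> \<Otimes>\<^sub>M \<mu>))\<bar> \<le> e)"
  proof (intro exI[of _ "\<lambda>\<mu>. \<Sum>i\<in>J. \<Sum>j\<in>J. f (i, j) * ((\<integral>x. g i x \<partial>\<mu>) * (\<integral>x. g j x \<partial>\<mu>))"] conjI ballI)
    show "continuous_map (subtopology weak_top (tight_set G R)) euclideanreal
        (\<lambda>\<mu>. \<Sum>i\<in>J. \<Sum>j\<in>J. f (i, j) * ((\<integral>x. g i x \<partial>\<mu>) * (\<integral>x. g j x \<partial>\<mu>)))"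
      by (intro continuous_map_from_subtopology continuous_map_sum continuous_map_real_mult_left
          continuous_map_real_mult continuous_map_integral g J)
    fix \<mu> assume "\<mu> \<in> topspace (subtopology weak_top (tight_set G R))"
    then have \<mu>T: "\<mu> \<in> tight_set G R" and \<mu>: "\<mu> \<in> M1" by (auto simp: tight_set_M1)
    have \<mu>2: "\<mu> \<Otimes>\<^sub>M \<mu> \<in> M1" using \<mu> by (intro M1_pair)
    have s\<mu>: "1 - (\<integral>x. s x \<partial>\<mu>) \<le> R / c"
    proof -
      have "(\<integral>x. 1 - s x \<partial>\<mu>) \<le> (\<integral>x. (1 / c) * min (G x) c \<partial>\<mu>)"
      proof (rule integral_M1_mono[OF \<mu>])
        show "1 - s x \<le> (1 / c) * min (G x) c" for x
          using gK[of x] s01[of x] c(1) G_nonneg[of x]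
          by (cases "G x \<le> c") (auto simp: K_def s_def)
        show "(\<lambda>x. 1 / c * min (G x) c) \<in> bcont"
          using c(1) by (intro bcont_scale min_G_bcont) simp
      qed (intro bcont_diff bcont_const s)
      also have "\<dots> = (1 / c) * (\<integral>x. min (G x) c \<partial>\<mu>)" by simp
      also have "\<dots> \<le> (1 / c) * R" using \<mu>T c(1) by (intro mult_left_mono) (auto simp: tight_set_def)
      finally show ?thesis
        using prob_space.prob_space[OF M1_prob[OF \<mu>]] by (simp add: integrable_bcont bcont_const s \<mu>)
    qed
    have "\<bar>(\<integral>p. t p \<partial>(\<mu> \<Otimes>\<^sub>M \<mu>)) - (\<integral>p. f p \<partial>(\<mu> \<Otimes>\<^sub>M \<mu>))\<bar> = \<bar>\<integral>p. t p - f p \<partial>(\<mu> \<Otimes>\<^sub>M \<mu>)\<bar>"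
      by (simp add: integrable_bcont t f \<mu>2)
    also have "\<dots> \<le> (\<integral>p. \<bar>t p - f p\<bar> \<partial>(\<mu> \<Otimes>\<^sub>M \<mu>))" by (rule integral_abs_bound)
    also have "\<dots> \<le> (\<integral>p. b p \<partial>(\<mu> \<Otimes>\<^sub>M \<mu>))"
      by (intro integral_mono integrable_abs integrable_bcont bcont_diff t f b \<mu>2 bound)
    also have "\<dots> = e / 2 + B * ((1 - (\<integral>x. s x \<partial>\<mu>)) + (1 - (\<integral>x. s x \<partial>\<mu>)))"
    proof -
      have 1: "(\<lambda>p. (1 - s (fst p)) * 1) \<in> bcont" "(\<lambda>p. 1 * (1 - s (snd p))) \<in> bcont"
        by (rule bcont_tensor[OF bcont_diff[OF bcont_const s] bcont_const],
            rule bcont_tensor[OF bcont_const bcont_diff[OF bcont_const s]])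
      have 2: "(\<integral>p. (1 - s (fst p)) * 1 \<partial>(\<mu> \<Otimes>\<^sub>M \<mu>)) = 1 - (\<integral>x. s x \<partial>\<mu>)"
        using integral_tensor[OF bcont_diff[OF bcont_const[of 1] s] bcont_const[of 1] \<mu>]
          prob_space.prob_space[OF M1_prob[OF \<mu>]] by (simp add: integrable_bcont bcont_const s \<mu>)
      have 3: "(\<integral>p. 1 * (1 - s (snd p)) \<partial>(\<mu> \<Otimes>\<^sub>M \<mu>)) = 1 - (\<integral>x. s x \<partial>\<mu>)"
        using integral_tensor[OF bcont_const[of 1] bcont_diff[OF bcont_const[of 1] s] \<mu>]
          prob_space.prob_space[OF M1_prob[OF \<mu>]] by (simp add: integrable_bcont bcont_const s \<mu>)
      have 4: "(\<integral>p. h p + k p \<partial>(\<mu> \<Otimes>\<^sub>M \<mu>)) = (\<integral>p. h p \<partial>(\<mu> \<Otimes>\<^sub>M \<mu>)) + (\<integral>p. k p \<partial>(\<mu> \<Otimes>\<^sub>M \<mu>))"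
        if "h \<in> bcont" "k \<in> bcont" for h k
        using that by (simp add: integrable_bcont \<mu>2)
      show ?thesis unfolding b_def
        by (subst 4[OF bcont_const bcont_scale[OF bcont_add[OF 1]]], subst integral_mult_right_zero)
          (simp only: 4[OF 1] 2 3 integral_M1_const[OF \<mu>2])
    qed
    also have "\<dots> \<le> e / 2 + B * (R / c + R / c)" by (intro add_left_mono mult_left_mono add_mono s\<mu> B)
    also have "\<dots> = e / 2 + 2 * B * (R / c)" by (simp add: algebra_simps)
    also have "\<dots> \<le> e" using c(2) by linarith
    finally show "\<bar>(\<Sum>i\<in>J. \<Sum>j\<in>J. f (i, j) * ((\<integral>x. g i x \<partial>\<mu>) * (\<integral>x. g j x \<partial>\<mu>))) - (\<integral>p. f p \<partial>(\<mu> \<Otimes>\<^sub>M \<mu>))\<bar> \<le> e"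
      by (simp add: tint \<mu>)
  qed
qed

end

subsection \<open>The energy functional\<close>

text \<open>Pointwise, f^+ + C = (f + C) + f^-. Since f^- is at most C, its integral is finite, and
  after integration it may be subtracted from both sides.\<close>

lemma eint_bounded_below:
  assumes M: "prob_space M" and f[measurable]: "f \<in> borel_measurable M"
    and C: "0 \<le> C" "\<And>x. 0 \<le> f x + ereal C"
  shows "eint M f = enn2ereal (\<integral>\<^sup>+ x. e2ennreal (f x + ereal C) \<partial>M) - ereal C"
proof -
  interpret prob_space M by fact
  define p n q where "p = (\<integral>\<^sup>+ x. e2ennreal (f x) \<partial>M)" and "n = (\<integral>\<^sup>+ x. e2ennreal (- f x) \<partial>M)"
    and "q = (\<integral>\<^sup>+ x. e2ennreal (f x + ereal C) \<partial>M)"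
  have pt: "e2ennreal (f x) + ennreal C = e2ennreal (f x + ereal C) + e2ennreal (- f x)"
    and nt: "e2ennreal (- f x) \<le> ennreal C" for x
  proof -
    have "e2ennreal (f x) + ennreal C = e2ennreal (f x + ereal C) + e2ennreal (- f x) \<and> e2ennreal (- f x) \<le> ennreal C"
    proof (cases "f x")
      case (real r)
      have r: "0 \<le> r + C" using C(2)[of x] real by simp
      have "ennreal r + ennreal C = ennreal (r + C) + ennreal (- r)"
      proof (cases "0 \<le> r")
        case True
        then show ?thesis using C by (simp add: ennreal_neg)
      next
        case False
        then have "ennreal (r + C) + ennreal (- r) = ennreal (r + C + - r)"
          using r by (intro ennreal_plus[symmetric]) auto
        then show ?thesis using False by (simp add: ennreal_neg)
      qed
      then show ?thesis using real r by (simp add: ennreal.abs_eq[symmetric] e2ennreal_ereal ennreal_leI)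
    next
      case PInf
      then show ?thesis by (simp add: e2ennreal_neg)
    next
      case MInf
      then show ?thesis using C(2)[of x] by simp
    qed
    then show "e2ennreal (f x) + ennreal C = e2ennreal (f x + ereal C) + e2ennreal (- f x)"
      "e2ennreal (- f x) \<le> ennreal C" by auto
  qed
  have "(\<integral>\<^sup>+ x. e2ennreal (f x) + ennreal C \<partial>M) = (\<integral>\<^sup>+ x. e2ennreal (f x + ereal C) + e2ennreal (- f x) \<partial>M)"
    by (simp add: pt)
  then have eq: "p + ennreal C = q + n"
    unfolding p_def q_def n_def by (simp add: nn_integral_add emeasure_space_1)
  have "n \<le> (\<integral>\<^sup>+ x. ennreal C \<partial>M)" unfolding n_def by (intro nn_integral_mono nt)
  then have "n < top" by (simp add: emeasure_space_1 order.strict_trans1)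
  then obtain s where s: "0 \<le> s" "n = ennreal s" by (cases n) auto
  have "enn2ereal p + ereal C = enn2ereal q + ereal s"
    using arg_cong[OF eq, of enn2ereal] s C(1) by (simp add: plus_ennreal.rep_eq)
  then have "enn2ereal p - ereal s = enn2ereal q - ereal C"
    by (cases "enn2ereal p"; cases "enn2ereal q") auto
  then show ?thesis unfolding eint_def p_def[symmetric] n_def[symmetric] q_def[symmetric] s
    using s(1) by simp
qed

text \<open>\<open>W_lower\<close> keeps the real terms on one side, so that it stays meaningful
  where W is infinite. The bound \<kappa> \<le> 1 is what later lets the single-particle sum in H_N
  supply a missing pair contribution.\<close>

locale energy =
  fixes V :: "'a::euclidean_space \<Rightarrow> real" and W :: "'a \<Rightarrow> 'a \<Rightarrow> ereal" and v0 \<kappa> C :: real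
  assumes V_cont: "continuous_on UNIV V"
    and W_cont: "continuous_on UNIV (\<lambda>p. W (fst p) (snd p))"
    and W_sym: "W x y = W y x"
    and \<kappa>: "0 < \<kappa>" "\<kappa> \<le> 1" and v0: "0 \<le> v0" and C: "0 \<le> C"
    and V_lower: "0 \<le> V x + v0"
    and V_compact: "compact {x. V x + v0 \<le> r}"
    and W_lower: "ereal (\<kappa> * ((V x + v0) + (V y + v0)) - (V x + V y + C)) \<le> W x y"
begin

sublocale confining "\<lambda>x. V x + v0"
  using V_lower V_compact by unfold_locales (auto intro!: continuous_intros V_cont)

lemma W_not_MInf: "W x y \<noteq> - \<infinity>"
  using W_lower[of x y] by auto

definition phi :: "'a \<times> 'a \<Rightarrow> ereal" where
  "phi p = ereal (V (fst p)) + ereal (V (snd p)) + W (fst p) (snd p) + ereal C"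

text \<open>This is min(phi, n). The minimum is taken on the level of W before conversion to a real
  number, so \<open>real_of_ereal\<close> only meets finite values and continuity survives where W
  is infinite.\<close>

definition phin :: "nat \<Rightarrow> 'a \<times> 'a \<Rightarrow> real" where
  "phin n p = V (fst p) + V (snd p) + C
     + real_of_ereal (min (W (fst p) (snd p)) (ereal (real n - (V (fst p) + V (snd p) + C))))"

lemma phi_cases:
  obtains (real) w where "W (fst p) (snd p) = ereal w" "phi p = ereal (V (fst p) + V (snd p) + C + w)"
      "\<And>n. phin n p = min (V (fst p) + V (snd p) + C + w) (real n)"
      "\<kappa> * ((V (fst p) + v0) + (V (snd p) + v0)) \<le> V (fst p) + V (snd p) + C + w"
    | (infinite) "W (fst p) (snd p) = \<infinity>" "phi p = \<infinity>" "\<And>n. phin n p = real n"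
proof (cases "W (fst p) (snd p)")
  case (real w)
  have "phin n p = min (V (fst p) + V (snd p) + C + w) (real n)" for n
    by (simp add: phin_def real min_def)
  then show thesis using that(1)[OF real] W_lower[of "fst p" "snd p"] real by (simp add: phi_def)
next
  case PInf
  have "phin n p = real n" for n by (simp add: phin_def PInf min_def)
  then show thesis using that(2)[OF PInf] PInf by (simp add: phi_def)
qed (simp add: W_not_MInf)

lemma phi_ge: "ereal (\<kappa> * ((V (fst p) + v0) + (V (snd p) + v0))) \<le> phi p"
  by (rule phi_cases[of p]) auto

lemma \<kappa>_V_nonneg: "0 \<le> \<kappa> * ((V x + v0) + (V y + v0))"
  using \<kappa> by (intro mult_nonneg_nonneg add_nonneg_nonneg V_lower) simp

lemma phi_nonneg: "0 \<le> phi p"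
proof -
  have "0 \<le> \<kappa> * ((V (fst p) + v0) + (V (snd p) + v0))" by (rule \<kappa>_V_nonneg)
  then show ?thesis using phi_ge[of p] by (metis ereal_less_eq(5) order_trans)
qed

lemma phin_bounds: "0 \<le> phin n p" "phin n p \<le> real n"
proof -
  have "0 \<le> \<kappa> * ((V (fst p) + v0) + (V (snd p) + v0))" by (rule \<kappa>_V_nonneg)
  then show "0 \<le> phin n p" "phin n p \<le> real n"
    by (rule_tac [!] phi_cases[of p]) auto
qed

lemma phin_bcont: "phin n \<in> bcont"
proof (rule bcontI)
  show "\<bar>phin n p\<bar> \<le> real n" for p using phin_bounds[of n p] by simp
  have V1: "continuous_on UNIV (\<lambda>p. V (fst p) + V (snd p) + C)"
    by (intro continuous_intros continuous_on_compose2[OF V_cont]) auto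
  let ?m = "\<lambda>p. min (W (fst p) (snd p)) (ereal (real n - (V (fst p) + V (snd p) + C)))"
  have "continuous_on UNIV ?m"
    by (intro continuous_on_min W_cont continuous_on_ereal continuous_intros V1)
  moreover have "range ?m \<subseteq> UNIV - {\<infinity>, -\<infinity>}"
    using W_not_MInf by (auto simp: min_def)
  ultimately have "continuous_on UNIV (\<lambda>p. real_of_ereal (?m p))"
    by (intro continuous_on_compose2[OF continuous_on_real]) auto
  from continuous_on_add[OF V1 this] show "continuous_on UNIV (phin n)"
    unfolding phin_def[abs_def] .
qed

lemma phi_measurable: "phi \<in> borel_measurable borel"
proof -
  have [measurable]: "V \<in> borel_measurable borel" by (intro borel_measurable_continuous_onI V_cont)
  have [measurable]: "(\<lambda>p. W (fst p) (snd p)) \<in> borel_measurable (borel \<Otimes>\<^sub>M borel)"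
    unfolding borel_prod by (intro borel_measurable_continuous_onI W_cont)
  have "(\<lambda>p. ereal (V (fst p)) + ereal (V (snd p)) + W (fst p) (snd p) + ereal C) \<in> borel_measurable (borel \<Otimes>\<^sub>M borel)"
    by measurable
  then show ?thesis unfolding borel_prod phi_def[abs_def] .
qed

definition J :: "'a measure \<Rightarrow> ennreal" where
  "J \<mu> = (\<integral>\<^sup>+ p. e2ennreal (phi p) \<partial>(\<mu> \<Otimes>\<^sub>M \<mu>))"

definition Jn :: "nat \<Rightarrow> 'a measure \<Rightarrow> real" where
  "Jn n \<mu> = (\<integral>p. phin n p \<partial>(\<mu> \<Otimes>\<^sub>M \<mu>))"

lemma ereal_half_le: "ereal (1/2) * (x - ereal C) \<le> ereal r \<longleftrightarrow> x \<le> ereal (2 * r + C)"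
  by (cases x) (auto simp: field_simps)

lemma I_fun_eq:
  assumes "\<mu> \<in> M1"
  shows "I_fun V W \<mu> = ereal (1/2) * (enn2ereal (J \<mu>) - ereal C)"
proof -
  have m: "\<mu> \<Otimes>\<^sub>M \<mu> \<in> M1" by (intro M1_pair assms)
  have "(\<lambda>p. phi p - ereal C) \<in> borel_measurable borel"
    using phi_measurable by measurable
  also have "(\<lambda>p. phi p - ereal C) = (\<lambda>p. ereal (V (fst p)) + ereal (V (snd p)) + W (fst p) (snd p))"
  proof
    show "phi p - ereal C = ereal (V (fst p)) + ereal (V (snd p)) + W (fst p) (snd p)" for p
      by (rule phi_cases[of p]) auto
  qed
  finally have meas: "(\<lambda>p. ereal (V (fst p)) + ereal (V (snd p)) + W (fst p) (snd p)) \<in> borel_measurable borel" .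
  let ?f = "\<lambda>p. ereal (V (fst p)) + ereal (V (snd p)) + W (fst p) (snd p)"
  have "eint (\<mu> \<Otimes>\<^sub>M \<mu>) ?f = enn2ereal (\<integral>\<^sup>+ p. e2ennreal (?f p + ereal C) \<partial>(\<mu> \<Otimes>\<^sub>M \<mu>)) - ereal C"
    using phi_nonneg unfolding phi_def
    by (rule eint_bounded_below[OF M1_prob[OF m] M1_borel_measurable[OF m meas] C])
  then show ?thesis by (simp only: I_fun_def J_def phi_def)
qed

text \<open>Monotone convergence in the truncation level. A supremum of functionals that are
  continuous on tight sets is lower semicontinuous there.\<close>

lemma J_eq_SUP:
  assumes "\<mu> \<in> M1"
  shows "J \<mu> = (SUP n. ennreal (Jn n \<mu>))"
proof -
  have m: "\<mu> \<Otimes>\<^sub>M \<mu> \<in> M1" by (intro M1_pair assms)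
  have inc: "phin n p \<le> phin m p" if "n \<le> m" for n m p
    using that by (rule_tac phi_cases[of p]) (auto simp: min_def)
  have "e2ennreal (phi p) = (SUP n. ennreal (phin n p))" for p
  proof (rule phi_cases[of p])
    fix w assume w: "phi p = ereal (V (fst p) + V (snd p) + C + w)"
      "\<And>n. phin n p = min (V (fst p) + V (snd p) + C + w) (real n)"
    show ?thesis
    proof (rule antisym)
      obtain n where "V (fst p) + V (snd p) + C + w \<le> real n" using real_arch_simple by blast
      then have "ennreal (phin n p) = e2ennreal (phi p)"
        by (simp add: w(1) w(2)[of n] e2ennreal_ereal)
      then show "e2ennreal (phi p) \<le> (SUP n. ennreal (phin n p))" by (metis SUP_upper UNIV_I)
      show "(SUP n. ennreal (phin n p)) \<le> e2ennreal (phi p)"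
        by (intro SUP_least) (simp add: w e2ennreal_ereal ennreal_leI)
    qed
  next
    assume "phi p = \<infinity>" "\<And>n. phin n p = real n"
    then show ?thesis by (simp add: ennreal_SUP_of_nat_eq_top ennreal_of_nat_eq_real_of_nat[symmetric])
  qed
  then have "J \<mu> = (\<integral>\<^sup>+ p. (SUP n. ennreal (phin n p)) \<partial>(\<mu> \<Otimes>\<^sub>M \<mu>))" by (simp add: J_def)
  also have "\<dots> = (SUP n. \<integral>\<^sup>+ p. ennreal (phin n p) \<partial>(\<mu> \<Otimes>\<^sub>M \<mu>))"
    using inc M1_borel_measurable[OF assms]
    by (intro nn_integral_monotone_convergence_SUP)
      (auto simp: incseq_def le_fun_def ennreal_leI intro!: measurable_compose[OF _ measurable_ennreal]
        borel_measurable_integrable[OF integrable_bcont[OF phin_bcont m]])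
  also have "\<dots> = (SUP n. ennreal (Jn n \<mu>))"
    unfolding Jn_def using phin_bounds
    by (intro SUP_cong nn_integral_eq_integral integrable_bcont phin_bcont m) auto
  finally show ?thesis .
qed

text \<open>Since I = (J - C) / 2, a level set becomes a countable family of closed conditions on
  the real-valued \<open>Jn\<close>, the form in which all topological arguments use the
  energy.\<close>

lemma I_fun_le_iff:
  assumes "\<mu> \<in> M1"
  shows "I_fun V W \<mu> \<le> ereal r \<longleftrightarrow> (\<forall>n. Jn n \<mu> \<le> 2 * r + C)"
proof -
  have nn: "0 \<le> Jn n \<mu>" for n unfolding Jn_def by (simp add: phin_bounds)
  have "I_fun V W \<mu> \<le> ereal r \<longleftrightarrow> enn2ereal (J \<mu>) \<le> ereal (2 * r + C)"
    by (simp add: I_fun_eq[OF assms] ereal_half_le)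
  also have "\<dots> \<longleftrightarrow> 0 \<le> 2 * r + C \<and> J \<mu> \<le> ennreal (2 * r + C)"
  proof (cases "0 \<le> 2 * r + C")
    case True
    then show ?thesis by (simp add: less_eq_ennreal.rep_eq enn2ereal_ennreal)
  next
    case False
    then have "\<not> enn2ereal (J \<mu>) \<le> ereal (2 * r + C)"
      using order_trans[OF enn2ereal_nonneg[of "J \<mu>"]] by (metis ereal_less_eq(5))
    then show ?thesis using False by simp
  qed
  also have "\<dots> \<longleftrightarrow> (\<forall>n. Jn n \<mu> \<le> 2 * r + C)"
  proof (intro iffI conjI allI)
    show "Jn n \<mu> \<le> 2 * r + C" if "0 \<le> 2 * r + C \<and> J \<mu> \<le> ennreal (2 * r + C)" for n
      using that ennreal_le_iff[of "2 * r + C" "Jn n \<mu>"] unfolding J_eq_SUP[OF assms] SUP_le_iff by blast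
    assume *: "\<forall>n. Jn n \<mu> \<le> 2 * r + C"
    show "0 \<le> 2 * r + C" by (rule order_trans[OF nn[of 0]]) (rule *[rule_format])
    show "J \<mu> \<le> ennreal (2 * r + C)"
      unfolding J_eq_SUP[OF assms] by (rule SUP_least, rule ennreal_leI) (rule *[rule_format])
  qed
  finally show ?thesis .
qed

lemma I_fun_lower:
  assumes "\<mu> \<in> M1"
  shows "ereal (- C / 2) \<le> I_fun V W \<mu>"
  using enn2ereal_nonneg[of "J \<mu>"] unfolding I_fun_eq[OF assms]
  by (cases "enn2ereal (J \<mu>)") (auto simp: field_simps)

text \<open>Coercivity: phi dominates \<kappa> (V + v0) in the first variable alone, the second term
  being nonnegative. Truncating at m is compatible with \<open>phin n\<close> as soon as n is at
  least \<kappa> m.\<close>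

lemma I_fun_le_tight:
  assumes \<mu>: "\<mu> \<in> M1" and I: "I_fun V W \<mu> \<le> ereal r"
  shows "\<mu> \<in> tight_set (\<lambda>x. V x + v0) ((2 * r + C) / \<kappa>)"
  unfolding tight_set_def
proof (intro CollectI conjI allI impI \<mu>)
  fix m :: real assume m: "0 \<le> m"
  have m2: "\<mu> \<Otimes>\<^sub>M \<mu> \<in> M1" by (intro M1_pair \<mu>)
  obtain n where n: "\<kappa> * m \<le> real n" using real_arch_simple by blast
  let ?f = "\<lambda>x. min (V x + v0) m"
  have b: "(\<lambda>p. ?f (fst p) * 1) \<in> bcont" by (intro bcont_tensor min_G_bcont m bcont_const)
  have "\<kappa> * (\<integral>x. ?f x \<partial>\<mu>) = \<kappa> * (\<integral>p. ?f (fst p) * 1 \<partial>(\<mu> \<Otimes>\<^sub>M \<mu>))"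
    by (subst integral_tensor[OF min_G_bcont[OF m] bcont_const \<mu>]) (simp only: integral_M1_const[OF \<mu>] mult_1_right)
  also have "\<dots> = (\<integral>p. \<kappa> * (?f (fst p) * 1) \<partial>(\<mu> \<Otimes>\<^sub>M \<mu>))" by (rule integral_mult_right_zero[symmetric])
  also have "\<dots> \<le> Jn n \<mu>"
    unfolding Jn_def
  proof (intro integral_M1_mono m2 bcont_scale b phin_bcont)
    fix p :: "'a \<times> 'a"
    have 1: "\<kappa> * ?f (fst p) \<le> real n"
      using n \<kappa> by (meson min.cobounded2 mult_left_mono order_trans less_imp_le)
    have 2: "\<kappa> * ?f (fst p) \<le> \<kappa> * ((V (fst p) + v0) + (V (snd p) + v0))"
      using \<kappa> V_lower[of "snd p"] by (intro mult_left_mono) auto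
    show "\<kappa> * (?f (fst p) * 1) \<le> phin n p"
      using 1 2 by (rule_tac phi_cases[of p]) auto
  qed
  also have "\<dots> \<le> 2 * r + C" using I I_fun_le_iff[OF \<mu>] by simp
  finally show "(\<integral>x. ?f x \<partial>\<mu>) \<le> (2 * r + C) / \<kappa>" using \<kappa> by (simp add: field_simps)
qed

lemma continuous_map_Jn:
  "continuous_map (subtopology weak_top (tight_set (\<lambda>x. V x + v0) R)) euclideanreal (Jn n)"
  unfolding Jn_def[abs_def] by (intro continuous_map_integral_pair phin_bcont)

text \<open>Coercivity places the level set inside one compact \<open>T\<close>. Continuity of
  \<open>Jn\<close> is established on tight sets, so closedness is checked in the subspace
  \<open>T\<close> and compactness is inherited from it.\<close>

lemma compactin_level_set: "compactin weak_top {\<mu> \<in> M1. I_fun V W \<mu> \<le> ereal r}"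
proof -
  define T where "T = tight_set (\<lambda>x. V x + v0) ((2 * r + C) / \<kappa>)"
  let ?X = "subtopology weak_top T"
  have T: "compactin weak_top T" unfolding T_def by (rule compactin_tight_set)
  have TM: "T \<subseteq> M1" unfolding T_def by (auto simp: tight_set_M1)
  have top: "topspace ?X = T" using TM by (auto simp: topspace_weak_top)
  have "{\<mu> \<in> M1. I_fun V W \<mu> \<le> ereal r} = {\<mu> \<in> topspace ?X. \<forall>n\<in>UNIV. Jn n \<mu> \<in> {..2 * r + C}}"
    unfolding top using TM I_fun_le_tight[of _ r] by (auto simp: I_fun_le_iff T_def)
  also have "closedin ?X \<dots>"
    unfolding T_def by (rule closedin_Collect_ball[where Y = euclideanreal]) (auto intro: continuous_map_Jn)
  finally have "closedin ?X {\<mu> \<in> M1. I_fun V W \<mu> \<le> ereal r}" .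
  moreover have "compact_space ?X" using T by (rule compact_space_subtopology)
  ultimately have "compactin ?X {\<mu> \<in> M1. I_fun V W \<mu> \<le> ereal r}"
    by (rule closedin_compact_space[rotated])
  then show ?thesis by (simp add: compactin_subtopology)
qed

end

subsection \<open>Empirical measures\<close>

lemma empirical_M1:
  assumes "0 < N"
  shows "empirical N x \<in> M1"
proof -
  have "prob_space (uniform_count_measure {..<N})"
    using assms by (intro prob_space_uniform_count_measure) auto
  moreover have "x \<in> measurable (uniform_count_measure {..<N}) borel"
    by (simp add: measurable_def space_uniform_count_measure sets_uniform_count_measure)
  ultimately show ?thesis
    by (simp add: M1_def empirical_def prob_space.prob_space_distr)
qed

lemma integral_empirical:
  fixes f :: "'a::euclidean_space \<Rightarrow> real"
  assumes "0 < N" and f: "f \<in> borel_measurable borel"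
  shows "(\<integral>y. f y \<partial>empirical N x) = (\<Sum>i<N. f (x i)) / real N"
proof -
  have "x \<in> measurable (uniform_count_measure {..<N}) borel"
    by (simp add: measurable_def space_uniform_count_measure sets_uniform_count_measure)
  then have "(\<integral>y. f y \<partial>empirical N x) = (\<integral>i. f (x i) \<partial>uniform_count_measure {..<N})"
    unfolding empirical_def using f by (rule integral_distr)
  also have "\<dots> = (\<Sum>i<N. f (x i)) / real N"
    by (subst integral_uniform_count_measure) auto
  finally show ?thesis .
qed

lemma integral_empirical_pair:
  fixes f :: "'a::euclidean_space \<times> 'a \<Rightarrow> real"
  assumes N: "0 < N" and f: "f \<in> bcont"
  shows "(\<integral>p. f p \<partial>(empirical N x \<Otimes>\<^sub>M empirical N x)) = (\<Sum>i<N. \<Sum>j<N. f (x i, x j)) / (real N)\<^sup>2"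
proof -
  let ?\<mu> = "empirical N x"
  have \<mu>: "?\<mu> \<in> M1" by (rule empirical_M1[OF N])
  interpret A: prob_space ?\<mu> using \<mu> by (rule M1_prob)
  interpret pair_prob_space ?\<mu> ?\<mu> ..
  have [measurable]: "f \<in> borel_measurable (borel \<Otimes>\<^sub>M borel)"
    unfolding borel_prod by (rule bcont_measurable[OF f])
  have inner: "(\<integral>b. f (a, b) \<partial>?\<mu>) = (\<Sum>j<N. f (a, x j)) / real N" for a
    by (rule integral_empirical[OF N]) measurable
  have "(\<integral>p. f p \<partial>(?\<mu> \<Otimes>\<^sub>M ?\<mu>)) = (\<integral>a. \<integral>b. f (a, b) \<partial>?\<mu> \<partial>?\<mu>)"
    by (rule integral_fst'[symmetric]) (intro integrable_bcont f M1_pair \<mu>)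
  also have "\<dots> = (\<integral>a. (\<Sum>j<N. f (a, x j)) / real N \<partial>?\<mu>)" by (simp only: inner)
  also have "\<dots> = (\<Sum>i<N. (\<Sum>j<N. f (x i, x j)) / real N) / real N"
    by (rule integral_empirical[OF N]) measurable
  also have "\<dots> = (\<Sum>i<N. \<Sum>j<N. f (x i, x j)) / (real N)\<^sup>2"
    by (simp add: sum_divide_distrib power2_eq_square)
  finally show ?thesis .
qed

lemma sum_pairs_add:
  fixes a :: "nat \<Rightarrow> real"
  shows "(\<Sum>j<N. \<Sum>i<j. a i + a j) = (real N - 1) * (\<Sum>i<N. a i)"
  by (induction N) (simp_all add: sum.distrib algebra_simps)

lemma sum_pairs_const:
  fixes c :: real
  shows "(\<Sum>j<N. \<Sum>i<j. c) = real N * (real N - 1) / 2 * c"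
  by (induction N) (simp_all add: algebra_simps add_divide_distrib diff_divide_distrib)

lemma sum_square_symmetric:
  fixes f :: "nat \<Rightarrow> nat \<Rightarrow> real"
  assumes "\<And>i j. f i j = f j i"
  shows "(\<Sum>i<N. \<Sum>j<N. f i j) = (\<Sum>i<N. f i i) + 2 * (\<Sum>j<N. \<Sum>i<j. f i j)"
proof (induction N)
  case (Suc N)
  have "(\<Sum>i<N. f i N) = (\<Sum>i<N. f N i)" by (intro sum.cong assms refl)
  then show ?case using Suc by (simp add: sum.distrib)
qed simp

subsection \<open>The Hamiltonian\<close>

context energy
begin

lemma phin_sym: "phin n (x, y) = phin n (y, x)"
  by (simp add: phin_def W_sym[of x y] add.commute)

lemma Jn_empirical:
  "0 < N \<Longrightarrow> Jn n (empirical N x) = (\<Sum>i<N. \<Sum>j<N. phin n (x i, x j)) / (real N)\<^sup>2"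
  unfolding Jn_def by (rule integral_empirical_pair[OF _ phin_bcont])

text \<open>Each V (x i) occurs in N - 1 pairs, so the pair sum of phi equals (N - 1) times the sum
  of V, plus the sum of W, plus C N (N - 1) / 2. Division by N^2 leaves one sum of V over and the
  correction in C.\<close>

lemma H_N_cases:
  assumes N: "0 < N"
  obtains (infinite) i j where "i < j" "j < N" "phi (x i, x j) = \<infinity>" "H_N V W N x = \<infinity>"
  | (real) \<phi> where "\<And>i j. i < j \<Longrightarrow> j < N \<Longrightarrow> phi (x i, x j) = ereal (\<phi> i j)"
      "H_N V W N x = ereal (((\<Sum>i<N. V (x i)) + (\<Sum>j<N. \<Sum>i<j. \<phi> i j)) / (real N)\<^sup>2
         - C / 2 * (1 - 1 / real N))"
proof (cases "\<exists>j<N. \<exists>i<j. W (x i) (x j) = \<infinity>")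
  case True
  then obtain i j where ij: "i < j" "j < N" "W (x i) (x j) = \<infinity>" by auto
  then have "(\<Sum>j<N. \<Sum>i<j. W (x i) (x j)) = \<infinity>" by (auto simp: sum_Pinfty)
  then have "H_N V W N x = \<infinity>" using N by (simp add: H_N_def)
  moreover have "phi (x i, x j) = \<infinity>" using ij by (simp add: phi_def)
  ultimately show thesis using ij infinite by blast
next
  case False
  define w where "w i j = real_of_ereal (W (x i) (x j))" for i j
  have w: "W (x i) (x j) = ereal (w i j)" if "i < j" "j < N" for i j
    using False that W_not_MInf[of "x i" "x j"] unfolding w_def by (auto simp: ereal_real)
  define \<phi> where "\<phi> i j = V (x i) + V (x j) + w i j + C" for i j
  have ph: "phi (x i, x j) = ereal (\<phi> i j)" if "i < j" "j < N" for i j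
    using w[OF that] by (simp add: phi_def \<phi>_def)
  let ?V = "\<Sum>i<N. V (x i)"
  have "(\<Sum>j<N. \<Sum>i<j. W (x i) (x j)) = ereal (\<Sum>j<N. \<Sum>i<j. w i j)"
    using w by (simp add: sum_ereal[symmetric] del: sum_ereal)
  then have "H_N V W N x = ereal (?V / real N + (\<Sum>j<N. \<Sum>i<j. w i j) / (real N)\<^sup>2)"
    by (simp add: H_N_def)
  also have "?V / real N + (\<Sum>j<N. \<Sum>i<j. w i j) / (real N)\<^sup>2
     = (?V + (\<Sum>j<N. \<Sum>i<j. \<phi> i j)) / (real N)\<^sup>2 - C / 2 * (1 - 1 / real N)"
  proof -
    have "(\<Sum>j<N. \<Sum>i<j. \<phi> i j)
        = (real N - 1) * ?V + (\<Sum>j<N. \<Sum>i<j. w i j) + real N * (real N - 1) / 2 * C"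
      unfolding \<phi>_def sum.distrib sum_pairs_const
      using sum_pairs_add[of "\<lambda>i. V (x i)" N] by (simp add: sum.distrib)
    then have "?V + (\<Sum>j<N. \<Sum>i<j. \<phi> i j)
        = real N * ?V + (\<Sum>j<N. \<Sum>i<j. w i j) + real N * (real N - 1) / 2 * C"
      by (simp add: algebra_simps)
    then have "(?V + (\<Sum>j<N. \<Sum>i<j. \<phi> i j)) / (real N)\<^sup>2
        = ?V / real N + (\<Sum>j<N. \<Sum>i<j. w i j) / (real N)\<^sup>2 + C / 2 * ((real N - 1) / real N)"
      using N by (simp add: add_divide_distrib power2_eq_square)
    moreover have "(real N - 1) / real N = 1 - 1 / real N" using N by (simp add: diff_divide_distrib)
    ultimately show ?thesis by simp
  qed
  finally show thesis using ph real by blast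
qed

text \<open>With S the sum of V + v0, the pairs supply N - 1 copies of \<kappa> S. The left-over sum
  of V is S - N v0 and supplies the N-th copy, because \<kappa> S \<le> S.\<close>

lemma H_N_confining:
  assumes N: "0 < N"
  shows "ereal (\<kappa> / real N * (\<Sum>i<N. V (x i) + v0) - (v0 + C / 2)) \<le> H_N V W N x"
proof (rule H_N_cases[OF N, of x])
  fix \<phi> assume \<phi>: "\<And>i j. i < j \<Longrightarrow> j < N \<Longrightarrow> phi (x i, x j) = ereal (\<phi> i j)"
    and H: "H_N V W N x = ereal (((\<Sum>i<N. V (x i)) + (\<Sum>j<N. \<Sum>i<j. \<phi> i j)) / (real N)\<^sup>2
         - C / 2 * (1 - 1 / real N))"
  define S where "S = (\<Sum>i<N. V (x i) + v0)"
  have S: "0 \<le> S" unfolding S_def by (intro sum_nonneg V_lower)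
  have VS: "(\<Sum>i<N. V (x i)) = S - real N * v0" unfolding S_def by (simp add: sum.distrib)
  have "(\<Sum>j<N. \<Sum>i<j. \<phi> i j) \<ge> (\<Sum>j<N. \<Sum>i<j. \<kappa> * (V (x i) + v0) + \<kappa> * (V (x j) + v0))"
  proof (intro sum_mono)
    fix j i assume "j \<in> {..<N}" "i \<in> {..<j}"
    then show "\<kappa> * (V (x i) + v0) + \<kappa> * (V (x j) + v0) \<le> \<phi> i j"
      using phi_ge[of "(x i, x j)"] \<phi>[of i j] by (simp add: distrib_left)
  qed
  also have "(\<Sum>j<N. \<Sum>i<j. \<kappa> * (V (x i) + v0) + \<kappa> * (V (x j) + v0)) = (real N - 1) * (\<kappa> * S)"
    unfolding sum_pairs_add S_def by (simp add: sum_distrib_left)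
  finally have P: "(real N - 1) * (\<kappa> * S) \<le> (\<Sum>j<N. \<Sum>i<j. \<phi> i j)" .
  have "\<kappa> * S \<le> S" using \<kappa> S by (simp add: mult_left_le_one_le)
  then have "real N * (\<kappa> * S) - real N * v0 \<le> (\<Sum>i<N. V (x i)) + (\<Sum>j<N. \<Sum>i<j. \<phi> i j)"
    using P VS by (simp add: algebra_simps)
  then have "(real N * (\<kappa> * S) - real N * v0) / (real N)\<^sup>2
      \<le> ((\<Sum>i<N. V (x i)) + (\<Sum>j<N. \<Sum>i<j. \<phi> i j)) / (real N)\<^sup>2"
    by (intro divide_right_mono) auto
  moreover have "(real N * (\<kappa> * S) - real N * v0) / (real N)\<^sup>2 = \<kappa> / real N * S - v0 / real N"
    using N by (simp add: field_simps power2_eq_square)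
  moreover have "v0 / real N \<le> v0" using N v0 mult_left_mono[of 1 "real N" v0] by (simp add: field_simps)
  moreover have "C / 2 * (1 - 1 / real N) \<le> C / 2" using C by (simp add: mult_left_le)
  ultimately show ?thesis unfolding H S_def[symmetric] ereal_less_eq(3) by linarith
qed simp

text \<open>The square of the empirical measure also charges the diagonal, which H_N omits.
  Truncation bounds the N diagonal terms by n each, which gives n / (2 N); the term v0 / N bounds
  the left-over sum of V from below.\<close>

lemma H_N_ge_Jn:
  assumes N: "0 < N"
  shows "ereal (Jn n (empirical N x) / 2 - (real n / 2 + v0) / real N - C / 2) \<le> H_N V W N x"
proof (rule H_N_cases[OF N, of x])
  fix \<phi> assume \<phi>: "\<And>i j. i < j \<Longrightarrow> j < N \<Longrightarrow> phi (x i, x j) = ereal (\<phi> i j)"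
    and H: "H_N V W N x = ereal (((\<Sum>i<N. V (x i)) + (\<Sum>j<N. \<Sum>i<j. \<phi> i j)) / (real N)\<^sup>2
         - C / 2 * (1 - 1 / real N))"
  have le: "phin n (x i, x j) \<le> \<phi> i j" if "i < j" "j < N" for i j
    using \<phi>[OF that] by (rule_tac phi_cases[of "(x i, x j)"]) auto
  have "(\<Sum>i<N. \<Sum>j<N. phin n (x i, x j)) = (\<Sum>i<N. phin n (x i, x i)) + 2 * (\<Sum>j<N. \<Sum>i<j. phin n (x i, x j))"
    by (rule sum_square_symmetric) (rule phin_sym)
  also have "\<dots> \<le> real N * real n + 2 * (\<Sum>j<N. \<Sum>i<j. \<phi> i j)"
  proof (intro add_mono mult_left_mono sum_mono le)
    show "(\<Sum>i<N. phin n (x i, x i)) \<le> real N * real n"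
      using sum_bounded_above[of "{..<N}" "\<lambda>i. phin n (x i, x i)" "real n"] phin_bounds by simp
  qed auto
  finally have 1: "(\<Sum>i<N. \<Sum>j<N. phin n (x i, x j)) / 2 \<le> real N * real n / 2 + (\<Sum>j<N. \<Sum>i<j. \<phi> i j)" by simp
  have "0 \<le> (\<Sum>i<N. V (x i) + v0)" by (intro sum_nonneg V_lower)
  then have "- (real N * v0) \<le> (\<Sum>i<N. V (x i))" by (simp add: sum.distrib)
  with 1 have "(\<Sum>i<N. \<Sum>j<N. phin n (x i, x j)) / 2 - real N * (real n / 2 + v0)
      \<le> (\<Sum>i<N. V (x i)) + (\<Sum>j<N. \<Sum>i<j. \<phi> i j)" by (simp add: algebra_simps)
  then have "((\<Sum>i<N. \<Sum>j<N. phin n (x i, x j)) / 2 - real N * (real n / 2 + v0)) / (real N)\<^sup>2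
      \<le> ((\<Sum>i<N. V (x i)) + (\<Sum>j<N. \<Sum>i<j. \<phi> i j)) / (real N)\<^sup>2"
    by (intro divide_right_mono) auto
  moreover have "((\<Sum>i<N. \<Sum>j<N. phin n (x i, x j)) / 2 - real N * (real n / 2 + v0)) / (real N)\<^sup>2
     = Jn n (empirical N x) / 2 - (real n / 2 + v0) / real N"
    using N by (simp add: Jn_empirical diff_divide_distrib power2_eq_square)
  moreover have "C / 2 * (1 - 1 / real N) \<le> C / 2" using C by (simp add: mult_left_le)
  ultimately show ?thesis unfolding H ereal_less_eq(3) by linarith
qed simp

text \<open>The bound is uniform over configurations, so a failure yields violating configurations
  \<open>X N\<close> for infinitely many N. \<open>H_N_confining\<close> puts their empirical
  measures into one compact tight set, and a cluster point there contradicts the choice of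
  r.\<close>

lemma eventually_H_N_ge:
  assumes r: "ereal r < (INF \<mu> \<in> weak_top closure_of A. I_fun V W \<mu>)"
  shows "\<forall>\<^sub>F N in sequentially. \<forall>x. empirical N x \<in> A \<longrightarrow> ereal r \<le> H_N V W N x"
proof (rule ccontr)
  assume neg: "\<not> ?thesis"
  define D where "D = {N. 0 < N \<and> (\<exists>x. empirical N x \<in> A \<and> H_N V W N x < ereal r)}"
  have D: "infinite D"
  proof
    assume "finite D"
    then obtain m where m: "\<And>N. N \<in> D \<Longrightarrow> N \<le> m" unfolding finite_nat_set_iff_bounded_le by auto
    have "\<forall>\<^sub>F N in sequentially. \<forall>x. empirical N x \<in> A \<longrightarrow> ereal r \<le> H_N V W N x"
      using eventually_gt_at_top[of m] eventually_gt_at_top[of 0]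
    proof eventually_elim
      case (elim N)
      then have "N \<notin> D" using m[of N] by auto
      then show ?case using elim unfolding D_def by (metis (mono_tags, lifting) mem_Collect_eq not_less)
    qed
    with neg show False by simp
  qed
  have "\<forall>N\<in>D. \<exists>x. empirical N x \<in> A \<and> H_N V W N x < ereal r" by (simp add: D_def)
  then obtain X where X: "\<And>N. N \<in> D \<Longrightarrow> empirical N (X N) \<in> A"
      "\<And>N. N \<in> D \<Longrightarrow> H_N V W N (X N) < ereal r"
    by metis
  define \<mu> where "\<mu> N = empirical N (X N)" for N
  define R where "R = (r + (v0 + C / 2)) / \<kappa>"
  define T where "T = tight_set (\<lambda>x. V x + v0) R"
  have \<mu>M: "\<mu> N \<in> M1" if "N \<in> D" for N
    using that unfolding \<mu>_def D_def by (intro empirical_M1) auto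
  have \<mu>T: "\<mu> N \<in> T" if N: "N \<in> D" for N
    unfolding T_def tight_set_def
  proof (intro CollectI conjI allI impI \<mu>M N)
    fix m :: real assume m: "0 \<le> m"
    have N0: "0 < N" using N by (simp add: D_def)
    have "(\<integral>y. min (V y + v0) m \<partial>\<mu> N) = (\<Sum>i<N. min (V (X N i) + v0) m) / real N"
      unfolding \<mu>_def by (intro integral_empirical N0 bcont_measurable min_G_bcont m)
    also have "\<dots> \<le> (\<Sum>i<N. V (X N i) + v0) / real N"
      by (intro divide_right_mono sum_mono) auto
    also have "\<dots> \<le> R"
    proof -
      have "ereal (\<kappa> / real N * (\<Sum>i<N. V (X N i) + v0) - (v0 + C / 2)) < ereal r"
        using H_N_confining[OF N0, of "X N"] X(2)[OF N] by (rule order.strict_trans1)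
      then show ?thesis unfolding R_def using \<kappa> N0 by (simp add: field_simps)
    qed
    finally show "(\<integral>y. min (V y + v0) m \<partial>\<mu> N) \<le> R" .
  qed
  have Tc: "compactin weak_top T" unfolding T_def by (rule compactin_tight_set)
  \<comment> \<open>Cluster point without subsequences: if every point of \<open>T\<close> had a
    neighbourhood visited only finitely often, a finite subcover would make \<open>D\<close>
    finite.\<close>
  have "\<exists>\<nu>\<in>T. \<forall>U. openin weak_top U \<and> \<nu> \<in> U \<longrightarrow> infinite {N \<in> D. \<mu> N \<in> U}"
  proof (rule ccontr)
    assume "\<not> ?thesis"
    then have "\<forall>\<nu>\<in>T. \<exists>U. openin weak_top U \<and> \<nu> \<in> U \<and> finite {N \<in> D. \<mu> N \<in> U}" by blast
    then obtain U where U: "\<And>\<nu>. \<nu> \<in> T \<Longrightarrow> openin weak_top (U \<nu>)" "\<And>\<nu>. \<nu> \<in> T \<Longrightarrow> \<nu> \<in> U \<nu>"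
        "\<And>\<nu>. \<nu> \<in> T \<Longrightarrow> finite {N \<in> D. \<mu> N \<in> U \<nu>}" by metis
    have "\<forall>Y\<in>U ` T. openin weak_top Y" "T \<subseteq> \<Union> (U ` T)" using U by auto
    then obtain \<F> where \<F>: "finite \<F>" "\<F> \<subseteq> U ` T" "T \<subseteq> \<Union> \<F>"
      using Tc unfolding compactin_def by meson
    have "D \<subseteq> (\<Union>Y\<in>\<F>. {N \<in> D. \<mu> N \<in> Y})" using \<F>(3) \<mu>T by blast
    moreover have "finite (\<Union>Y\<in>\<F>. {N \<in> D. \<mu> N \<in> Y})" using \<F>(1,2) U(3) by auto
    ultimately show False using D finite_subset by blast
  qed
  then obtain \<nu> where \<nu>: "\<nu> \<in> T" "\<And>U. openin weak_top U \<Longrightarrow> \<nu> \<in> U \<Longrightarrow> infinite {N \<in> D. \<mu> N \<in> U}"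
    by blast
  have \<nu>M: "\<nu> \<in> M1" using \<nu>(1) unfolding T_def by (rule tight_set_M1)
  have "\<nu> \<in> weak_top closure_of A"
    unfolding in_closure_of
  proof (intro conjI allI impI)
    show "\<nu> \<in> topspace weak_top" by (simp add: topspace_weak_top \<nu>M)
    fix U assume "\<nu> \<in> U \<and> openin weak_top U"
    then have "{N \<in> D. \<mu> N \<in> U} \<noteq> {}" using \<nu>(2)[of U] by (metis finite.emptyI)
    then show "\<exists>y. y \<in> A \<and> y \<in> U" using X(1) unfolding \<mu>_def by blast
  qed
  moreover have "I_fun V W \<nu> \<le> ereal r"
    unfolding I_fun_le_iff[OF \<nu>M]
  proof (rule allI, rule ccontr)
    fix n assume gt: "\<not> Jn n \<nu> \<le> 2 * r + C"
    \<comment> \<open>The midpoint separates the two values. The set {Jn n > s} is open in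
      \<open>T\<close> and contains \<nu>, so it is visited for arbitrarily large N, whereas
      \<open>H_N_ge_Jn\<close> forces Jn n below 2 * r + C + O(1 / N) on these
      configurations.\<close>
    define s where "s = (Jn n \<nu> + (2 * r + C)) / 2"
    have s: "2 * r + C < s" "s < Jn n \<nu>" using gt by (auto simp: s_def)
    have top: "topspace (subtopology weak_top T) = T"
      using tight_set_M1 by (auto simp: topspace_weak_top T_def)
    have "openin (subtopology weak_top T) {\<rho> \<in> topspace (subtopology weak_top T). Jn n \<rho> \<in> {s<..}}"
      unfolding T_def
      by (rule openin_continuous_map_preimage[OF continuous_map_Jn]) (simp add: open_greaterThan)
    then obtain U where U: "openin weak_top U" "{\<rho> \<in> T. s < Jn n \<rho>} = U \<inter> T"
      unfolding top openin_subtopology by auto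
    have "\<nu> \<in> U" using U(2) s \<nu>(1) by auto
    then have inf: "infinite {N \<in> D. \<mu> N \<in> U}" using U(1) \<nu>(2) by blast
    obtain m where m: "(real n + 2 * v0) / (s - (2 * r + C)) < real m" using reals_Archimedean2 by blast
    obtain N where N: "N \<in> D" "\<mu> N \<in> U" "m < N"
      using inf unfolding infinite_nat_iff_unbounded by blast
    have N0: "0 < N" using N(3) by simp
    have "s < Jn n (\<mu> N)" using U(2) N(2) \<mu>T[OF N(1)] by auto
    moreover have "Jn n (\<mu> N) / 2 - (real n / 2 + v0) / real N - C / 2 < r"
      using order.strict_trans1[OF H_N_ge_Jn[OF N0, of n "X N"] X(2)[OF N(1)]] by (simp add: \<mu>_def)
    moreover have "(real n + 2 * v0) / real N = 2 * ((real n / 2 + v0) / real N)" by simp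
    ultimately have "s - (2 * r + C) < (real n + 2 * v0) / real N" by linarith
    moreover have "(real n + 2 * v0) / real N < s - (2 * r + C)"
    proof -
      have "(real n + 2 * v0) / (s - (2 * r + C)) < real N" using m N(3) by simp
      then show ?thesis using s(1) N0 by (simp add: field_simps)
    qed
    ultimately show False by simp
  qed
  ultimately have "(INF \<mu> \<in> weak_top closure_of A. I_fun V W \<mu>) \<le> ereal r"
    by (rule INF_lower2)
  with r show False by simp
qed

end

subsection \<open>Logarithms of extended nonnegative reals\<close>

lemma eln_le_exp: "t \<le> ennreal (exp a) \<Longrightarrow> eln t \<le> ereal a"
proof -
  assume t: "t \<le> ennreal (exp a)"
  then obtain r where r: "t = ennreal r" "0 \<le> r" by (cases t) (auto simp: top_unique)
  then have "r \<le> exp a" using t by simp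
  then show ?thesis using r ln_le_cancel_iff[of r "exp a"]
    by (cases "r = 0") (auto simp: eln_def)
qed

lemma exp_le_eln: "ennreal (exp a) \<le> t \<Longrightarrow> ereal a \<le> eln t"
proof -
  assume t: "ennreal (exp a) \<le> t"
  show ?thesis
  proof (cases t)
    case (real r)
    then have "exp a \<le> r" using t by simp
    moreover have "0 < r" using \<open>exp a \<le> r\<close> exp_gt_zero[of a] by linarith
    ultimately show ?thesis using real ln_le_cancel_iff[of "exp a" r] by (auto simp: eln_def)
  qed (simp add: eln_def)
qed

lemma eln_divide:
  assumes "0 < z" "z < top"
  shows "eln (t / z) = eln t - eln z"
proof -
  obtain r where r: "z = ennreal r" "0 < r" using assms by (cases z) auto
  show ?thesis
  proof (cases t)
    case (real s)
    then show ?thesis using r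
      by (cases "s = 0") (auto simp: eln_def divide_ennreal ln_div)
  next
    case top
    then show ?thesis using r by (simp add: eln_def ennreal_top_divide)
  qed
qed

subsection \<open>Product measures\<close>

context
  fixes \<nu> :: "'b measure" and I :: "'i set"
  assumes \<nu>: "prob_space \<nu>" and I: "finite I"
begin

lemma indep_vars_PiM_coordinates:
  assumes "I \<noteq> {}"
  shows "prob_space.indep_vars (PiM I (\<lambda>_. \<nu>)) (\<lambda>_. \<nu>) (\<lambda>i x. x i) I"
proof -
  interpret prob_space "PiM I (\<lambda>_. \<nu>)" by (intro prob_space_PiM \<nu>)
  have "distr (PiM I (\<lambda>_. \<nu>)) (PiM I (\<lambda>_. \<nu>)) (\<lambda>x. \<lambda>i\<in>I. x i) = PiM I (\<lambda>_. \<nu>)"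
  proof -
    have "distr (PiM I (\<lambda>_. \<nu>)) (PiM I (\<lambda>_. \<nu>)) (\<lambda>x. \<lambda>i\<in>I. x i) = distr (PiM I (\<lambda>_. \<nu>)) (PiM I (\<lambda>_. \<nu>)) (\<lambda>x. x)"
      by (intro distr_cong) (auto simp: space_PiM)
    then show ?thesis by simp
  qed
  also have "\<dots> = PiM I (\<lambda>i. distr (PiM I (\<lambda>_. \<nu>)) \<nu> (\<lambda>x. x i))"
    using distr_PiM_component[of I "\<lambda>_. \<nu>"] \<nu> by (intro PiM_cong) auto
  finally show ?thesis
    using assms by (subst indep_vars_iff_distr_eq_PiM') auto
qed

lemma distr_PiM_pair:
  assumes ij: "i \<in> I" "j \<in> I" "i \<noteq> j"
  shows "distr (PiM I (\<lambda>_. \<nu>)) (\<nu> \<Otimes>\<^sub>M \<nu>) (\<lambda>x. (x i, x j)) = \<nu> \<Otimes>\<^sub>M \<nu>"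
proof (rule pair_measure_eqI[symmetric])
  interpret P: prob_space "PiM I (\<lambda>_. \<nu>)" by (intro prob_space_PiM \<nu>)
  show "sigma_finite_measure \<nu>" "sigma_finite_measure \<nu>"
    using \<nu> by (simp_all add: prob_space_imp_sigma_finite)
  show "sets (\<nu> \<Otimes>\<^sub>M \<nu>) = sets (distr (PiM I (\<lambda>_. \<nu>)) (\<nu> \<Otimes>\<^sub>M \<nu>) (\<lambda>x. (x i, x j)))" by simp
  fix A B assume A: "A \<in> sets \<nu>" and B: "B \<in> sets \<nu>"
  have [measurable]: "(\<lambda>x. x i) \<in> measurable (PiM I (\<lambda>_. \<nu>)) \<nu>" "(\<lambda>x. x j) \<in> measurable (PiM I (\<lambda>_. \<nu>)) \<nu>"
    using ij by (auto intro!: measurable_component_singleton)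
  have comp: "P.prob ((\<lambda>x. x k) -` D \<inter> space (PiM I (\<lambda>_. \<nu>))) = measure \<nu> D" if "k \<in> I" "D \<in> sets \<nu>" for k D
  proof -
    have "measure \<nu> D = measure (distr (PiM I (\<lambda>_. \<nu>)) \<nu> (\<lambda>x. x k)) D"
      using distr_PiM_component[of I "\<lambda>_. \<nu>" k] \<nu> that by simp
    then show ?thesis using that by (simp add: measure_distr measurable_component_singleton)
  qed
  define D where "D k = (if k = i then A else B)" for k
  have "P.prob (\<Inter>k\<in>{i, j}. (\<lambda>x. x k) -` D k \<inter> space (PiM I (\<lambda>_. \<nu>)))
      = (\<Prod>k\<in>{i, j}. P.prob ((\<lambda>x. x k) -` D k \<inter> space (PiM I (\<lambda>_. \<nu>))))"
    using ij A B by (intro P.indep_varsD[OF indep_vars_PiM_coordinates]) (auto simp: D_def)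
  also have "\<dots> = measure \<nu> A * measure \<nu> B" using ij A B by (simp add: D_def comp)
  also have "(\<Inter>k\<in>{i, j}. (\<lambda>x. x k) -` D k \<inter> space (PiM I (\<lambda>_. \<nu>)))
      = (\<lambda>x. (x i, x j)) -` (A \<times> B) \<inter> space (PiM I (\<lambda>_. \<nu>))"
    using ij by (auto simp: D_def)
  finally have *: "P.prob ((\<lambda>x. (x i, x j)) -` (A \<times> B) \<inter> space (PiM I (\<lambda>_. \<nu>))) = measure \<nu> A * measure \<nu> B" .
  have "emeasure (distr (PiM I (\<lambda>_. \<nu>)) (\<nu> \<Otimes>\<^sub>M \<nu>) (\<lambda>x. (x i, x j))) (A \<times> B)
      = ennreal (measure \<nu> A * measure \<nu> B)"
    using A B by (subst emeasure_distr) (auto simp: P.emeasure_eq_measure * )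
  then show "emeasure \<nu> A * emeasure \<nu> B
      = emeasure (distr (PiM I (\<lambda>_. \<nu>)) (\<nu> \<Otimes>\<^sub>M \<nu>) (\<lambda>x. (x i, x j))) (A \<times> B)"
    by (simp add: ennreal_mult finite_measure.emeasure_eq_measure[OF prob_space.finite_measure[OF \<nu>]])
qed

lemma nn_integral_PiM_pair:
  assumes "i \<in> I" "j \<in> I" "i \<noteq> j" and g: "g \<in> borel_measurable (\<nu> \<Otimes>\<^sub>M \<nu>)"
  shows "(\<integral>\<^sup>+ x. g (x i, x j) \<partial>PiM I (\<lambda>_. \<nu>)) = (\<integral>\<^sup>+ p. g p \<partial>(\<nu> \<Otimes>\<^sub>M \<nu>))"
proof -
  have "(\<lambda>x. (x i, x j)) \<in> measurable (PiM I (\<lambda>_. \<nu>)) (\<nu> \<Otimes>\<^sub>M \<nu>)"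
    using assms by (intro measurable_Pair measurable_component_singleton)
  then show ?thesis
    unfolding distr_PiM_pair[OF assms(1-3), symmetric, THEN arg_cong[where f = "\<lambda>M. integral\<^sup>N M g"]]
    by (intro nn_integral_distr[symmetric]) (use g in simp_all)
qed

text \<open>Hoeffding's inequality for independent, identically distributed values in an interval of
  length 2 * B. It is applied to each of the finitely many tests that define a weak
  neighbourhood.\<close>

lemma prob_average_far_le:
  fixes f :: "'b \<Rightarrow> real"
  assumes ne: "I \<noteq> {}" and f[measurable]: "f \<in> borel_measurable \<nu>" and B: "\<And>x. \<bar>f x\<bar> \<le> B" "0 < B" and e: "0 \<le> e"
  shows "measure (PiM I (\<lambda>_. \<nu>)) {x \<in> space (PiM I (\<lambda>_. \<nu>)).
      \<bar>(\<Sum>i\<in>I. f (x i)) / real (card I) - (\<integral>x. f x \<partial>\<nu>)\<bar> \<ge> e} \<le> 2 * exp (- 2 * real (card I) * e\<^sup>2 / (2 * B)\<^sup>2)"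
proof -
  interpret P: prob_space "PiM I (\<lambda>_. \<nu>)" by (intro prob_space_PiM \<nu>)
  obtain k where k: "k \<in> I" using ne by auto
  have [measurable]: "(\<lambda>x. x i) \<in> measurable (PiM I (\<lambda>_. \<nu>)) \<nu>" if "i \<in> I" for i
    using that by (rule measurable_component_singleton)
  have distr: "distr (PiM I (\<lambda>_. \<nu>)) borel (\<lambda>x. f (x i)) = distr \<nu> borel f" if "i \<in> I" for i
  proof -
    have "distr \<nu> borel f = distr (distr (PiM I (\<lambda>_. \<nu>)) \<nu> (\<lambda>x. x i)) borel f"
      using distr_PiM_component[of I "\<lambda>_. \<nu>" i] \<nu> that by simp
    then show ?thesis using that by (simp add: distr_distr comp_def measurable_component_singleton)
  qed
  have exp: "P.expectation (\<lambda>x. f (x k)) = (\<integral>x. f x \<partial>\<nu>)"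
  proof -
    have "(\<integral>x. f x \<partial>\<nu>) = (\<integral>x. f x \<partial>distr (PiM I (\<lambda>_. \<nu>)) \<nu> (\<lambda>x. x k))"
      using distr_PiM_component[of I "\<lambda>_. \<nu>" k] \<nu> k by simp
    then show ?thesis using k by (subst (asm) integral_distr) auto
  qed
  have bd: "f x \<le> B" "- B \<le> f x" for x using B(1)[of x] by auto
  interpret H: Hoeffding_ineq_iid "PiM I (\<lambda>_. \<nu>)" I "\<lambda>i x. f (x i)" "\<lambda>x. f (x k)" "- B" B "\<integral>x. f x \<partial>\<nu>"
  proof unfold_locales
    show "P.indep_vars (\<lambda>_. borel) (\<lambda>i x. f (x i)) I"
      by (rule P.indep_vars_compose2[OF indep_vars_PiM_coordinates[OF ne]]) (rule f)
    show "(\<lambda>x. f (x k)) \<in> borel_measurable (PiM I (\<lambda>_. \<nu>))" using k by measurable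
  qed (use I k distr exp bd in auto)
  have "B - - B = 2 * B" by simp
  with H.Hoeffding_ineq_abs_ge'[OF e _ ne] B(2) show ?thesis by simp
qed

end

text \<open>The product measure has the product density, as evaluation on boxes shows; each of the
  \<open>card I\<close> factors is at most M.\<close>

lemma nn_integral_PiM_density_le:
  fixes f :: "'a::euclidean_space \<Rightarrow> ennreal"
  assumes I: "finite I" and f[measurable]: "f \<in> borel_measurable lborel" and M: "\<And>x. f x \<le> M"
    and g[measurable]: "g \<in> borel_measurable (PiM I (\<lambda>_. lborel))"
    and prob: "prob_space (density lborel f)"
  shows "(\<integral>\<^sup>+ x. g x \<partial>PiM I (\<lambda>_. density lborel f)) \<le> M ^ card I * (\<integral>\<^sup>+ x. g x \<partial>PiM I (\<lambda>_. lborel))"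
proof -
  interpret L: product_sigma_finite "\<lambda>_::'b. lborel :: 'a measure"
    by standard
  interpret D: product_sigma_finite "\<lambda>_::'b. density lborel f"
    using prob by (simp add: product_sigma_finite_def prob_space_imp_sigma_finite)
  have m[measurable]: "(\<lambda>x. \<Prod>i\<in>I. f (x i)) \<in> borel_measurable (PiM I (\<lambda>_. lborel))"
    by (intro borel_measurable_prod_ennreal measurable_compose[OF _ f] measurable_component_singleton)
  have "density (PiM I (\<lambda>_. lborel)) (\<lambda>x. \<Prod>i\<in>I. f (x i)) = PiM I (\<lambda>_. density lborel f)"
  proof (rule D.PiM_eqI[OF I])
    show "sets (density (PiM I (\<lambda>_. lborel)) (\<lambda>x. \<Prod>i\<in>I. f (x i))) = sets (PiM I (\<lambda>_. density lborel f))"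
      by (simp cong: sets_PiM_cong)
    fix A :: "'b \<Rightarrow> 'a set" assume "\<And>i. i \<in> I \<Longrightarrow> A i \<in> sets (density lborel f)"
    then have A[measurable]: "\<And>i. i \<in> I \<Longrightarrow> A i \<in> sets lborel" by simp
    have "Pi\<^sub>E I A \<in> sets (PiM I (\<lambda>_. lborel))" using I A by (intro sets_PiM_I_finite) auto
    then have "emeasure (density (PiM I (\<lambda>_. lborel)) (\<lambda>x. \<Prod>i\<in>I. f (x i))) (Pi\<^sub>E I A)
        = (\<integral>\<^sup>+ x. (\<Prod>i\<in>I. f (x i)) * indicator (Pi\<^sub>E I A) x \<partial>PiM I (\<lambda>_. lborel))"
      by (simp add: emeasure_density)
    also have "\<dots> = (\<integral>\<^sup>+ x. (\<Prod>i\<in>I. f (x i) * indicator (A i) (x i)) \<partial>PiM I (\<lambda>_. lborel))"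
    proof (intro nn_integral_cong)
      fix x assume "x \<in> space (PiM I (\<lambda>_. lborel :: 'a measure))"
      then have "indicator (Pi\<^sub>E I A) x = (\<Prod>i\<in>I. indicator (A i) (x i) :: ennreal)"
        using I by (auto simp: indicator_def space_PiM PiE_iff prod_eq_1_iff)
      then show "(\<Prod>i\<in>I. f (x i)) * indicator (Pi\<^sub>E I A) x = (\<Prod>i\<in>I. f (x i) * indicator (A i) (x i))"
        by (simp add: prod.distrib)
    qed
    also have "\<dots> = (\<Prod>i\<in>I. \<integral>\<^sup>+ x. f x * indicator (A i) x \<partial>lborel)"
      by (rule L.product_nn_integral_prod[OF I, where f = "\<lambda>i x. f x * indicator (A i) x"]) measurable
    also have "\<dots> = (\<Prod>i\<in>I. emeasure (density lborel f) (A i))"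
      using A by (intro prod.cong refl emeasure_density[symmetric] f)
    finally show "emeasure (density (PiM I (\<lambda>_. lborel)) (\<lambda>x. \<Prod>i\<in>I. f (x i))) (Pi\<^sub>E I A)
        = (\<Prod>i\<in>I. emeasure (density lborel f) (A i))" .
  qed
  then have "(\<integral>\<^sup>+ x. g x \<partial>PiM I (\<lambda>_. density lborel f))
      = (\<integral>\<^sup>+ x. g x \<partial>density (PiM I (\<lambda>_. lborel)) (\<lambda>x. \<Prod>i\<in>I. f (x i)))" by simp
  also have "\<dots> = (\<integral>\<^sup>+ x. (\<Prod>i\<in>I. f (x i)) * g x \<partial>PiM I (\<lambda>_. lborel))"
    by (rule nn_integral_density) measurable
  also have "\<dots> \<le> (\<integral>\<^sup>+ x. M ^ card I * g x \<partial>PiM I (\<lambda>_. lborel))"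
  proof (intro nn_integral_mono mult_right_mono)
    show "(\<Prod>i\<in>I. f (x i)) \<le> M ^ card I" for x
      using I by (induction I rule: finite_induct) (auto intro!: mult_mono M)
  qed simp
  also have "\<dots> = M ^ card I * (\<integral>\<^sup>+ x. g x \<partial>PiM I (\<lambda>_. lborel))"
    by (rule nn_integral_cmult) measurable
  finally show ?thesis .
qed

subsection \<open>The upper bound\<close>

text \<open>Writing the bound on the partition integral as exp q makes its N-th power exp (N q), a
  term linear in N in the exponent.\<close>

locale gas = energy V W v0 \<kappa> C
  for V :: "'a::euclidean_space \<Rightarrow> real" and W :: "'a \<Rightarrow> 'a \<Rightarrow> ereal" and v0 \<kappa> C :: real +
  fixes \<beta> :: "nat \<Rightarrow> real" and q :: real
  assumes \<beta>_pos: "0 < \<beta> N"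
    and \<beta>_growth: "(\<lambda>N. real N / \<beta> N) \<longlonglongrightarrow> 0"
    and exp_integral: "(\<integral>\<^sup>+ x. ennreal (exp (- (V x + v0))) \<partial>lborel) \<le> ennreal (exp q)"
begin

lemma H_N_not_MInf: "0 < N \<Longrightarrow> H_N V W N x \<noteq> - \<infinity>"
  using H_N_confining[of N x] by auto

text \<open>Only a part \<open>\<beta> - N / \<kappa>\<close> of the inverse temperature is spent on the energy bound \<open>r\<close>; the
  remaining \<open>N / \<kappa>\<close> makes the weight integrable.\<close>

lemma gibbs_weight_le:
  assumes N: "0 < N" "real N / \<kappa> \<le> \<beta> N" and r: "ereal r \<le> H_N V W N x"
  shows "gibbs_weight V W \<beta> N x
    \<le> ennreal (exp (- (\<beta> N - real N / \<kappa>) * r + real N * (v0 + C / 2) / \<kappa>)) * (\<Prod>i<N. ennreal (exp (- (V (x i) + v0))))"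
proof (cases "H_N V W N x")
  case (real h)
  define S where "S = (\<Sum>i<N. V (x i) + v0)"
  have h: "r \<le> h" "\<kappa> / real N * S - (v0 + C / 2) \<le> h"
    using r H_N_confining[OF N(1), of x] real by (auto simp: S_def)
  \<comment> \<open>The share N / \<kappa> is chosen so that the confinement bound turns into S with
    coefficient 1, which matches the integrable factor exp (- S).\<close>
  have "(\<beta> N - real N / \<kappa>) * r + real N / \<kappa> * (\<kappa> / real N * S - (v0 + C / 2))
      \<le> (\<beta> N - real N / \<kappa>) * h + real N / \<kappa> * h"
    using N \<kappa> h by (intro add_mono mult_left_mono) auto
  also have "\<dots> = \<beta> N * h" by (simp add: algebra_simps)
  also have "real N / \<kappa> * (\<kappa> / real N * S - (v0 + C / 2)) = S - real N * (v0 + C / 2) / \<kappa>"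
    using N \<kappa> by (simp add: field_simps)
  finally have "- \<beta> N * h \<le> (- (\<beta> N - real N / \<kappa>) * r + real N * (v0 + C / 2) / \<kappa>) + - S"
    by (simp add: algebra_simps)
  then have "exp (- \<beta> N * h) \<le> exp (- (\<beta> N - real N / \<kappa>) * r + real N * (v0 + C / 2) / \<kappa>) * exp (- S)"
    by (simp add: exp_add[symmetric])
  also have "exp (- S) = (\<Prod>i<N. exp (- (V (x i) + v0)))"
    unfolding S_def sum_negf[symmetric] by (rule exp_sum) simp
  finally have "ennreal (exp (- \<beta> N * h)) \<le> ennreal (exp (- (\<beta> N - real N / \<kappa>) * r + real N * (v0 + C / 2) / \<kappa>))
      * ennreal (\<Prod>i<N. exp (- (V (x i) + v0)))"
    by (subst ennreal_mult[symmetric]) (auto intro: ennreal_leI prod_nonneg)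
  also have "ennreal (\<Prod>i<N. exp (- (V (x i) + v0))) = (\<Prod>i<N. ennreal (exp (- (V (x i) + v0))))"
    by (rule prod_ennreal[symmetric]) simp
  finally show ?thesis by (simp add: gibbs_weight_def real)
qed (use H_N_not_MInf[OF N(1)] in \<open>simp_all add: gibbs_weight_def\<close>)

lemma ZP_N_le:
  assumes N: "0 < N" "real N / \<kappa> \<le> \<beta> N" and r: "\<And>x. empirical N x \<in> A \<Longrightarrow> ereal r \<le> H_N V W N x"
  shows "ZP_N V W \<beta> N A \<le> ennreal (exp (- (\<beta> N - real N / \<kappa>) * r + real N * ((v0 + C / 2) / \<kappa> + q)))"
proof -
  interpret L: product_sigma_finite "\<lambda>_::nat. lborel :: 'a measure" by standard
  have [measurable]: "V \<in> borel_measurable borel" by (intro borel_measurable_continuous_onI V_cont)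
  define K where "K = - (\<beta> N - real N / \<kappa>) * r + real N * (v0 + C / 2) / \<kappa>"
  have "ZP_N V W \<beta> N A \<le> (\<integral>\<^sup>+ x. ennreal (exp K) * (\<Prod>i<N. ennreal (exp (- (V (x i) + v0)))) \<partial>config_space N)"
    unfolding ZP_N_def K_def using gibbs_weight_le[OF N] r
    by (intro nn_integral_mono) (auto split: split_indicator)
  also have "\<dots> = ennreal (exp K) * (\<integral>\<^sup>+ x. (\<Prod>i<N. ennreal (exp (- (V (x i) + v0)))) \<partial>config_space N)"
    unfolding config_space_def by (rule nn_integral_cmult) measurable
  also have "(\<integral>\<^sup>+ x. (\<Prod>i<N. ennreal (exp (- (V (x i) + v0)))) \<partial>config_space N)
      = (\<integral>\<^sup>+ x. ennreal (exp (- (V x + v0))) \<partial>lborel) ^ N"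
    unfolding config_space_def
    by (subst L.product_nn_integral_prod[where f = "\<lambda>_ x. ennreal (exp (- (V x + v0)))"]) auto
  also have "\<dots> \<le> ennreal (exp q) ^ N" by (intro power_mono exp_integral) simp
  also have "\<dots> = ennreal (exp (real N * q))" by (simp add: ennreal_power exp_of_nat_mult)
  finally have "ZP_N V W \<beta> N A \<le> ennreal (exp K) * ennreal (exp (real N * q))"
    by (simp add: mult_left_mono)
  also have "\<dots> = ennreal (exp (K + real N * q))" by (simp add: ennreal_mult[symmetric] exp_add)
  also have "K + real N * q = - (\<beta> N - real N / \<kappa>) * r + real N * ((v0 + C / 2) / \<kappa> + q)"
    using \<kappa> by (simp add: K_def field_simps)
  finally show ?thesis .
qed

lemma eventually_N_le_\<beta>: "0 < e \<Longrightarrow> \<forall>\<^sub>F N in sequentially. real N / \<beta> N < e"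
  using \<beta>_growth by (rule order_tendstoD)

theorem limsup_ZP_N_le:
  "limsup (\<lambda>N. ereal (1 / \<beta> N) * eln (ZP_N V W \<beta> N A)) \<le> - (INF \<mu> \<in> weak_top closure_of A. I_fun V W \<mu>)"
proof -
  let ?I = "INF \<mu> \<in> weak_top closure_of A. I_fun V W \<mu>"
  let ?s = "limsup (\<lambda>N. ereal (1 / \<beta> N) * eln (ZP_N V W \<beta> N A))"
  have *: "?s \<le> - ereal r" if r: "ereal r < ?I" for r
  proof -
    \<comment> \<open>Collects all terms of order N in the exponent; divided by \<beta> N they
      vanish in the limit.\<close>
    define k where "k = r / \<kappa> + ((v0 + C / 2) / \<kappa> + q)"
    have "\<forall>\<^sub>F N in sequentially. ereal (1 / \<beta> N) * eln (ZP_N V W \<beta> N A) \<le> ereal (- r + real N / \<beta> N * k)"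
      using eventually_H_N_ge[OF r] eventually_N_le_\<beta>[OF \<kappa>(1)] eventually_gt_at_top[of 0]
    proof eventually_elim
      case (elim N)
      have "eln (ZP_N V W \<beta> N A) \<le> ereal (- (\<beta> N - real N / \<kappa>) * r + real N * ((v0 + C / 2) / \<kappa> + q))"
        using elim \<kappa> \<beta>_pos[of N] by (intro eln_le_exp ZP_N_le) (auto simp: field_simps)
      also have "- (\<beta> N - real N / \<kappa>) * r + real N * ((v0 + C / 2) / \<kappa> + q) = - \<beta> N * r + real N * k"
        by (simp add: k_def algebra_simps)
      finally have "ereal (1 / \<beta> N) * eln (ZP_N V W \<beta> N A) \<le> ereal (1 / \<beta> N) * ereal (- \<beta> N * r + real N * k)"
        using \<beta>_pos[of N] by (intro ereal_mult_left_mono) auto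
      also have "\<dots> = ereal (- r + real N / \<beta> N * k)"
        using \<beta>_pos[of N] by (simp add: field_simps)
      finally show ?case .
    qed
    then have "?s \<le> limsup (\<lambda>N. ereal (- r + real N / \<beta> N * k))" by (rule Limsup_mono)
    also have "(\<lambda>N. ereal (- r + real N / \<beta> N * k)) \<longlonglongrightarrow> ereal (- r + 0 * k)"
      by (intro tendsto_intros \<beta>_growth)
    then have "limsup (\<lambda>N. ereal (- r + real N / \<beta> N * k)) = ereal (- r)"
      by (simp add: lim_imp_Limsup)
    finally show ?thesis by simp
  qed
  \<comment> \<open>Approximation from below by reals, since the infimum may be infinite, for
    instance over an empty closure.\<close>
  have "?I \<le> - ?s"
  proof (rule dense_le)
    fix B assume B: "B < ?I"
    show "B \<le> - ?s"
    proof (cases B)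
      case (real r)
      then have "?s \<le> - ereal r" using * B by simp
      then show ?thesis using real by (metis ereal_minus_le_minus ereal_uminus_uminus)
    qed (use B in auto)
  qed
  then show ?thesis by (metis ereal_minus_le_minus ereal_uminus_uminus)
qed

subsection \<open>The lower bound\<close>

lemma H_N_measurable: "H_N V W N \<in> borel_measurable (config_space N)"
proof -
  have [measurable]: "V \<in> borel_measurable borel" by (intro borel_measurable_continuous_onI V_cont)
  have W: "(\<lambda>p. W (fst p) (snd p)) \<in> borel_measurable (borel \<Otimes>\<^sub>M borel)"
    unfolding borel_prod by (intro borel_measurable_continuous_onI W_cont)
  have c: "(\<lambda>x. x i) \<in> borel_measurable (config_space N)" if "i < N" for i
    unfolding config_space_def using that measurable_component_singleton[of i "{..<N}" "\<lambda>_. lborel"] by simp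
  have WW: "(\<lambda>x. W (x i) (x j)) \<in> borel_measurable (config_space N)" if "i < N" "j < N" for i j
    using measurable_compose[OF measurable_Pair[OF c[OF that(1)] c[OF that(2)]] W] by simp
  have VV: "(\<lambda>x. V (x i)) \<in> borel_measurable (config_space N)" if "i < N" for i
    using c[OF that] by measurable
  have "(\<lambda>x. \<Sum>j<N. \<Sum>i<j. W (x i) (x j)) \<in> borel_measurable (config_space N)"
    by (intro borel_measurable_ereal_sum WW) auto
  moreover have "(\<lambda>x. \<Sum>i<N. V (x i)) \<in> borel_measurable (config_space N)"
    by (intro borel_measurable_sum VV) auto
  ultimately show ?thesis unfolding H_N_def[abs_def] by measurable
qed

text \<open>Under the N-fold product of the measure, three events are excluded: too large a pair
  energy, a test average off by e, and a particle with V above v. On the rest, \<open>H_N\<close> is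
  below the target and the empirical measure lies in U. The probability of the rest stays above a
  constant, which is stored in c.\<close>

lemma ZP_N_ge_bounded_density:
  fixes f :: "'a \<Rightarrow> ennreal"
  assumes f[measurable]: "f \<in> borel_measurable lborel" and fM: "\<And>x. f x \<le> ennreal M" and M: "0 < M"
    and prob: "prob_space (density lborel f)"
    and Vv: "AE x in density lborel f. V x \<le> v" and v: "0 \<le> v"
    and j: "J (density lborel f) = ennreal j" "0 \<le> j"
    and U: "openin weak_top U" "density lborel f \<in> U" "U \<subseteq> A" and \<delta>: "0 < \<delta>"
  shows "\<exists>c. \<forall>\<^sub>F N in sequentially.
    ennreal (exp (- \<beta> N * (j / 2 - C / 2 + \<delta>) - real N * ln M - c)) \<le> ZP_N V W \<beta> N A"
proof -
  define \<nu> where "\<nu> = density lborel f"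
  have \<nu>p: "prob_space \<nu>" using prob by (simp add: \<nu>_def)
  have \<nu>M: "\<nu> \<in> M1" using prob by (simp add: M1_def \<nu>_def)
  have meas\<nu>: "\<And>g :: 'a \<Rightarrow> real. g \<in> borel_measurable borel \<Longrightarrow> g \<in> borel_measurable \<nu>" by (simp add: \<nu>_def)
  have [measurable]: "V \<in> borel_measurable borel" by (intro borel_measurable_continuous_onI V_cont)
  obtain F e where F: "finite F" "F \<subseteq> bcont" and e: "0 < e"
    and FU: "{\<rho> \<in> M1. \<forall>g\<in>F. \<bar>(\<integral>x. g x \<partial>\<rho>) - (\<integral>x. g x \<partial>\<nu>)\<bar> < e} \<subseteq> U"
    using U(1,2) unfolding \<nu>_def[symmetric] by (rule weak_top_nbhd)
  have "\<exists>b>0. \<forall>g\<in>F. \<forall>x. \<bar>g x\<bar> \<le> b"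
    using F
  proof (induction F)
    case (insert g F)
    then obtain b where b: "b > 0" "\<And>h x. h \<in> F \<Longrightarrow> \<bar>h x\<bar> \<le> b" by auto
    have "g \<in> bcont" using insert.prems by simp
    then obtain b' where "0 \<le> b'" and b': "\<And>x. \<bar>g x\<bar> \<le> b'" by (rule bcont_bounded) blast
    show ?case using b b'
      by (intro exI[of _ "max b b'"]) (auto simp: less_max_iff_disj le_max_iff_disj)
  qed (auto intro: exI[of _ 1])
  then obtain b where b: "0 < b" "\<And>g x. g \<in> F \<Longrightarrow> \<bar>g x\<bar> \<le> b" by blast
  define a where "a = j / 2"
  \<comment> \<open>What Markov's inequality leaves for configurations of moderate energy. It is
    positive for every \<delta> > 0; half of it survives once the test averages concentrate.\<close>
  define \<eta> where "\<eta> = 1 - a / (a + \<delta> / 2)"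
  have a: "0 \<le> a" using j by (simp add: a_def)
  have \<eta>: "0 < \<eta>" using a \<delta> by (simp add: \<eta>_def field_simps)
  define t where "t N = 2 * exp (- 2 * real N * e\<^sup>2 / (2 * b)\<^sup>2)" for N :: nat
  have "t \<longlonglongrightarrow> 0"
  proof -
    have "(\<lambda>N. 2 * exp (- (2 * e\<^sup>2 / (2 * b)\<^sup>2)) ^ N) \<longlonglongrightarrow> 2 * 0"
      using e b by (intro tendsto_mult tendsto_const LIMSEQ_power_zero) simp
    then show ?thesis unfolding t_def by (simp add: exp_of_nat_mult[symmetric] mult_ac)
  qed
  then have "(\<lambda>N. real (card F) * t N) \<longlonglongrightarrow> real (card F) * 0" by (intro tendsto_intros)
  then have ev1: "\<forall>\<^sub>F N in sequentially. real (card F) * t N < \<eta> / 2"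
    using \<eta> by (intro order_tendstoD) auto
  have "(\<lambda>N. (v + C / 2) * (1 / real N)) \<longlonglongrightarrow> (v + C / 2) * 0" by (intro tendsto_intros lim_1_over_n)
  then have ev2: "\<forall>\<^sub>F N in sequentially. (v + C / 2) * (1 / real N) < \<delta> / 2"
    using \<delta> by (intro order_tendstoD) auto
  have "\<forall>\<^sub>F N in sequentially.
    ennreal (exp (- \<beta> N * (j / 2 - C / 2 + \<delta>) - real N * ln M - (- ln (\<eta> / 2)))) \<le> ZP_N V W \<beta> N A"
    using ev1 ev2 eventually_gt_at_top[of 0]
  proof eventually_elim
    case (elim N)
    then have N: "0 < N" by simp
    define PN where "PN = PiM {..<N} (\<lambda>_. \<nu>)"
    interpret PN: prob_space PN unfolding PN_def by (intro prob_space_PiM \<nu>p)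
    have setsPN: "sets PN = sets (config_space N)"
      unfolding PN_def config_space_def \<nu>_def by (intro sets_PiM_cong) auto
    have spPN: "space PN = space (config_space N)" using setsPN by (rule sets_eq_imp_space_eq)
    have comp[measurable]: "(\<lambda>x. x i) \<in> borel_measurable PN" if "i < N" for i
      unfolding PN_def using that measurable_component_singleton[of i "{..<N}" "\<lambda>_. \<nu>"] by (simp add: \<nu>_def)
    have phim: "(\<lambda>p. e2ennreal (phi p)) \<in> borel_measurable (borel \<Otimes>\<^sub>M borel)"
      unfolding borel_prod using phi_measurable by measurable
    have phim': "(\<lambda>x. e2ennreal (phi (x i, x j))) \<in> borel_measurable PN" if "i < N" "j < N" for i j
      using measurable_compose[OF measurable_Pair[OF comp[OF that(1)] comp[OF that(2)]] phim] .
    define S where "S x = (\<Sum>j<N. \<Sum>i<j. e2ennreal (phi (x i, x j)))" for x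
    have Sm[measurable]: "S \<in> borel_measurable PN"
      unfolding S_def[abs_def] by (intro borel_measurable_sum phim') auto
    \<comment> \<open>The expected pair energy is j N (N - 1) / 2, at most N^2 a. Exceeding the
      threshold s thus has probability at most a / (a + \<delta> / 2).\<close>
    define s where "s = (real N)\<^sup>2 * (a + \<delta> / 2)"
    have s: "0 < s" using N a \<delta> by (simp add: s_def)
    define bad1 where "bad1 = {x \<in> space PN. ennreal s \<le> S x}"
    define bad2 where "bad2 g = {x \<in> space PN. \<bar>(\<Sum>i<N. g (x i)) / real N - (\<integral>x. g x \<partial>\<nu>)\<bar> \<ge> e}" for g
    \<comment> \<open>Off this null set the left-over single-particle sum contributes at most v / N
      to \<open>H_N\<close>; the second \<delta> / 2 absorbs it.\<close>
    define bad3 where "bad3 = {x \<in> space PN. \<not> (\<forall>i<N. V (x i) \<le> v)}"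
    define B where "B = space PN - (bad1 \<union> (\<Union>g\<in>F. bad2 g) \<union> bad3)"
    have m1: "bad1 \<in> sets PN" unfolding bad1_def by measurable
    have m2: "bad2 g \<in> sets PN" if "g \<in> F" for g
    proof -
      have [measurable]: "g \<in> borel_measurable borel" using that F bcont_measurable by blast
      show ?thesis unfolding bad2_def by measurable
    qed
    have m3: "bad3 \<in> sets PN" unfolding bad3_def by measurable
    have mB: "B \<in> sets PN" unfolding B_def using m1 m2 m3 F by (intro sets.Diff sets.Un sets.finite_UN) auto
    have p1: "PN.prob bad1 \<le> a / (a + \<delta> / 2)"
    proof -
      have "(\<integral>\<^sup>+ x. S x \<partial>PN) = (\<Sum>j<N. \<Sum>i<j. \<integral>\<^sup>+ x. e2ennreal (phi (x i, x j)) \<partial>PN)"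
        unfolding S_def using phim'
        by (subst nn_integral_sum; (intro borel_measurable_sum)?) (auto intro!: sum.cong nn_integral_sum)
      also have "\<dots> = (\<Sum>j<N. \<Sum>i<j. J \<nu>)"
      proof (intro sum.cong refl)
        fix k i assume "k \<in> {..<N}" "i \<in> {..<k}"
        then show "(\<integral>\<^sup>+ x. e2ennreal (phi (x i, x k)) \<partial>PN) = J \<nu>"
          unfolding PN_def J_def
          by (intro nn_integral_PiM_pair[OF \<nu>p, where g = "\<lambda>p. e2ennreal (phi p)"])
            (use phim in \<open>auto simp: \<nu>_def cong: measurable_cong_sets sets_pair_measure_cong\<close>)
      qed
      also have "\<dots> = (\<Sum>k<N. ennreal (\<Sum>i<k. j))"
        unfolding \<nu>_def j(1) using j(2) by (intro sum.cong refl sum_ennreal)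
      also have "\<dots> = ennreal (\<Sum>k<N. \<Sum>i<k. j)" using j(2) by (intro sum_ennreal sum_nonneg)
      also have "(\<Sum>k<N. \<Sum>i<k. j) \<le> (real N)\<^sup>2 * a"
        unfolding sum_pairs_const a_def using j N by (simp add: power2_eq_square mult_left_mono mult_right_mono)
      finally have ES: "(\<integral>\<^sup>+ x. S x \<partial>PN) \<le> ennreal ((real N)\<^sup>2 * a)" by (simp add: ennreal_leI)
      have "emeasure PN bad1 = emeasure PN {x \<in> space PN. 1 \<le> ennreal (1 / s) * S x}"
      proof -
        have "ennreal s \<le> S x \<longleftrightarrow> 1 \<le> ennreal (1 / s) * S x" for x
        proof (cases "S x")
          case (real z)
          then show ?thesis using s by (simp add: ennreal_mult[symmetric] field_simps)
        next
          case top
          then show ?thesis using s by (simp add: ennreal_mult_top)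
        qed
        then show ?thesis by (simp add: bad1_def)
      qed
      also have "\<dots> \<le> ennreal (1 / s) * (\<integral>\<^sup>+ x. S x * indicator (space PN) x \<partial>PN)"
        by (rule nn_integral_Markov_inequality) (use Sm in auto)
      also have "(\<integral>\<^sup>+ x. S x * indicator (space PN) x \<partial>PN) = (\<integral>\<^sup>+ x. S x \<partial>PN)" by (intro nn_integral_cong) simp
      also have "ennreal (1 / s) * \<dots> \<le> ennreal (1 / s) * ennreal ((real N)\<^sup>2 * a)" by (intro mult_left_mono ES) simp
      also have "\<dots> = ennreal (1 / s * ((real N)\<^sup>2 * a))" using s a by (intro ennreal_mult[symmetric]) auto
      also have "1 / s * ((real N)\<^sup>2 * a) = a / (a + \<delta> / 2)" using N by (simp add: s_def)
      finally show ?thesis using a \<delta> by (simp add: PN.emeasure_eq_measure ennreal_le_iff)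
    qed
    have p2: "PN.prob (bad2 g) \<le> t N" if g: "g \<in> F" for g
      unfolding bad2_def t_def PN_def
      using prob_average_far_le[OF \<nu>p, of "{..<N}" g b e] N e b g F meas\<nu>[OF bcont_measurable]
      by auto
    have p3: "PN.prob bad3 = 0"
    proof -
      have "AE x in PN. \<forall>i\<in>{..<N}. V (x i) \<le> v"
        unfolding PN_def using Vv[folded \<nu>_def] \<nu>p by (intro AE_finite_allI AE_PiM_component) auto
      then have "AE x in PN. x \<notin> bad3" by eventually_elim (auto simp: bad3_def)
      then show ?thesis by (simp add: PN.prob_eq_0 m3)
    qed
    have "1 - PN.prob B = PN.prob (space PN - B)" using mB by (simp add: PN.prob_compl)
    also have "space PN - B = bad1 \<union> (\<Union>g\<in>F. bad2 g) \<union> bad3"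
      by (auto simp: B_def bad1_def bad2_def bad3_def)
    also have "PN.prob \<dots> \<le> PN.prob bad1 + (\<Sum>g\<in>F. PN.prob (bad2 g)) + PN.prob bad3"
      using m1 m2 m3 F
      by (intro order_trans[OF measure_Un_le] add_mono measure_UNION_le) auto
    also have "\<dots> \<le> a / (a + \<delta> / 2) + (\<Sum>g\<in>F. t N) + 0" by (intro add_mono sum_mono p1 p2) (simp_all add: p3)
    also have "\<dots> = 1 - \<eta> + real (card F) * t N" by (simp add: \<eta>_def)
    also have "\<dots> \<le> 1 - \<eta> / 2" using elim(1) by linarith
    finally have PB: "\<eta> / 2 \<le> PN.prob B" by simp
    have HB: "H_N V W N x \<le> ereal (j / 2 - C / 2 + \<delta>)" "empirical N x \<in> U" if x: "x \<in> B" for x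
    proof -
      have Sx: "S x < ennreal s" and gx: "\<And>g. g \<in> F \<Longrightarrow> \<bar>(\<Sum>i<N. g (x i)) / real N - (\<integral>x. g x \<partial>\<nu>)\<bar> < e"
        and Vx: "\<And>i. i < N \<Longrightarrow> V (x i) \<le> v"
        using x unfolding B_def bad1_def bad2_def bad3_def by (auto simp: not_le)
      show "H_N V W N x \<le> ereal (j / 2 - C / 2 + \<delta>)"
      proof (rule H_N_cases[OF N, of x])
        fix i k assume ik: "i < k" "k < N" "phi (x i, x k) = \<infinity>"
        have "e2ennreal (phi (x i, x k)) \<le> (\<Sum>i<k. e2ennreal (phi (x i, x k)))"
          using ik by (intro member_le_sum) auto
        also have "\<dots> \<le> S x" unfolding S_def using ik
          by (intro member_le_sum[of k "{..<N}" "\<lambda>k. \<Sum>i<k. e2ennreal (phi (x i, x k))"]) auto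
        finally have "top \<le> S x" using ik by simp
        then show ?thesis using Sx by (simp add: top_unique)
      next
        fix \<phi> assume \<phi>: "\<And>i j. i < j \<Longrightarrow> j < N \<Longrightarrow> phi (x i, x j) = ereal (\<phi> i j)"
          and H: "H_N V W N x = ereal (((\<Sum>i<N. V (x i)) + (\<Sum>j<N. \<Sum>i<j. \<phi> i j)) / (real N)\<^sup>2
             - C / 2 * (1 - 1 / real N))"
        have \<phi>0: "0 \<le> \<phi> i j" if "i < j" "j < N" for i j
          using phi_nonneg[of "(x i, x j)"] \<phi>[OF that] by simp
        have "S x = (\<Sum>j<N. \<Sum>i<j. ennreal (\<phi> i j))"
          unfolding S_def using \<phi> by (intro sum.cong refl) (simp add: e2ennreal_ereal)
        also have "\<dots> = (\<Sum>j<N. ennreal (\<Sum>i<j. \<phi> i j))"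
          using \<phi>0 by (intro sum.cong refl sum_ennreal) auto
        also have "\<dots> = ennreal (\<Sum>j<N. \<Sum>i<j. \<phi> i j)"
          using \<phi>0 by (intro sum_ennreal sum_nonneg) auto
        finally have "(\<Sum>j<N. \<Sum>i<j. \<phi> i j) < s"
          using Sx by (metis ennreal_leI linorder_not_le)
        moreover have "(\<Sum>i<N. V (x i)) \<le> real N * v"
          using sum_bounded_above[of "{..<N}" "\<lambda>i. V (x i)" v] Vx by simp
        ultimately have "((\<Sum>i<N. V (x i)) + (\<Sum>j<N. \<Sum>i<j. \<phi> i j)) / (real N)\<^sup>2 \<le> (real N * v + s) / (real N)\<^sup>2"
          by (intro divide_right_mono) auto
        also have "\<dots> = v * (1 / real N) + (a + \<delta> / 2)"
          using N by (simp add: s_def field_simps power2_eq_square)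
        finally have "((\<Sum>i<N. V (x i)) + (\<Sum>j<N. \<Sum>i<j. \<phi> i j)) / (real N)\<^sup>2 - C / 2 * (1 - 1 / real N)
           \<le> (v + C / 2) * (1 / real N) + a + \<delta> / 2 - C / 2" by (simp add: algebra_simps)
        also have "\<dots> \<le> j / 2 - C / 2 + \<delta>" using elim(2) unfolding a_def by linarith
        finally show ?thesis by (simp add: H)
      qed
      show "empirical N x \<in> U"
        using gx F by (intro subsetD[OF FU]) (auto simp: empirical_M1[OF N] integral_empirical[OF N] bcont_measurable)
    qed
    let ?L = "j / 2 - C / 2 + \<delta>"
    have "ennreal (exp (- \<beta> N * ?L)) * emeasure (config_space N) B
        = (\<integral>\<^sup>+ x. ennreal (exp (- \<beta> N * ?L)) * indicator B x \<partial>config_space N)"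
      using mB setsPN by (simp add: nn_integral_cmult_indicator)
    also have "\<dots> \<le> ZP_N V W \<beta> N A"
      unfolding ZP_N_def
    proof (intro nn_integral_mono)
      fix x
      show "ennreal (exp (- \<beta> N * ?L)) * indicator B x \<le> indicator {y. empirical N y \<in> A} x * gibbs_weight V W \<beta> N x"
      proof (cases "x \<in> B")
        case True
        then obtain h where h: "H_N V W N x = ereal h" "h \<le> ?L"
          using HB(1)[OF True] H_N_not_MInf[OF N, of x] by (cases "H_N V W N x") auto
        have "exp (- \<beta> N * ?L) \<le> exp (- \<beta> N * h)" using h(2) \<beta>_pos[of N] by simp
        then show ?thesis using True HB(2)[OF True] U(3) h
          by (auto simp: gibbs_weight_def intro!: ennreal_leI)
      qed simp
    qed
    finally have Z: "ennreal (exp (- \<beta> N * ?L)) * emeasure (config_space N) B \<le> ZP_N V W \<beta> N A" .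
    have "emeasure PN B = (\<integral>\<^sup>+ x. indicator B x \<partial>PiM {..<N} (\<lambda>_. density lborel f))"
      using mB by (simp add: PN_def \<nu>_def)
    also have "\<dots> \<le> ennreal M ^ card {..<N} * (\<integral>\<^sup>+ x. indicator B x \<partial>PiM {..<N} (\<lambda>_. lborel))"
      using mB setsPN prob fM by (intro nn_integral_PiM_density_le f) (auto simp: config_space_def)
    also have "(\<integral>\<^sup>+ x. indicator B x \<partial>PiM {..<N} (\<lambda>_. lborel)) = emeasure (config_space N) B"
      using mB setsPN by (simp add: config_space_def)
    finally have "emeasure PN B \<le> ennreal (M ^ N) * emeasure (config_space N) B"
      using M by (simp add: ennreal_power)
    moreover have "ennreal (\<eta> / 2) \<le> emeasure PN B"
      using PB by (simp only: PN.emeasure_eq_measure ennreal_leI)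
    ultimately have "ennreal (\<eta> / 2) \<le> ennreal (M ^ N) * emeasure (config_space N) B" by order
    then have "ennreal (exp (- \<beta> N * ?L) / M ^ N) * ennreal (\<eta> / 2)
        \<le> ennreal (exp (- \<beta> N * ?L) / M ^ N) * (ennreal (M ^ N) * emeasure (config_space N) B)"
      by (intro mult_left_mono) auto
    also have "\<dots> = ennreal (exp (- \<beta> N * ?L)) * emeasure (config_space N) B"
      using M by (simp add: mult.assoc[symmetric] ennreal_mult[symmetric])
    also note Z
    also have "ennreal (exp (- \<beta> N * ?L) / M ^ N) * ennreal (\<eta> / 2)
        = ennreal (exp (- \<beta> N * ?L - real N * ln M - (- ln (\<eta> / 2))))"
    proof -
      have "exp (- \<beta> N * ?L - real N * ln M - (- ln (\<eta> / 2))) = exp (- \<beta> N * ?L) / exp (real N * ln M) * exp (ln (\<eta> / 2))"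
        by (simp only: exp_diff[symmetric] exp_add[symmetric] diff_minus_eq_add)
      also have "exp (real N * ln M) = M ^ N" using M by (simp add: exp_of_nat_mult)
      also have "exp (ln (\<eta> / 2)) = \<eta> / 2" using \<eta> by simp
      finally have eq: "exp (- \<beta> N * ?L - real N * ln M - (- ln (\<eta> / 2))) = exp (- \<beta> N * ?L) / M ^ N * (\<eta> / 2)" .
      show ?thesis unfolding eq by (rule ennreal_mult[symmetric]) (use M \<eta> in auto)
    qed
    finally show ?case .
  qed
  then show ?thesis by blast
qed

end

section \<open>Conditioned measures and a measure of finite energy\<close>

lemma nn_integral_lborel_reflect:
  fixes h :: "'a::euclidean_space \<Rightarrow> ennreal"
  assumes "h \<in> borel_measurable borel"
  shows "(\<integral>\<^sup>+ y. h (x - y) \<partial>lborel) = (\<integral>\<^sup>+ z. h z \<partial>lborel)"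
proof -
  have "distr lborel borel (\<lambda>y. x + (- 1) *\<^sub>R y) = (lborel :: 'a measure)"
    by (subst (2) lborel_affine[of "-1" x]) (auto simp: density_1 one_ennreal_def[symmetric])
  then have "(\<integral>\<^sup>+ z. h z \<partial>lborel) = (\<integral>\<^sup>+ z. h z \<partial>distr lborel borel (\<lambda>y. x + (- 1) *\<^sub>R y))" by simp
  also have "\<dots> = (\<integral>\<^sup>+ y. h (x + (- 1) *\<^sub>R y) \<partial>lborel)"
    using assms by (intro nn_integral_distr) simp_all
  finally show ?thesis by simp
qed

lemma nn_integral_density_le:
  assumes "u \<in> borel_measurable M" "h \<in> borel_measurable M" "\<And>x. u x \<le> k"
  shows "(\<integral>\<^sup>+ x. h x \<partial>density M u) \<le> k * (\<integral>\<^sup>+ x. h x \<partial>M)"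
proof -
  have "(\<integral>\<^sup>+ x. h x \<partial>density M u) = (\<integral>\<^sup>+ x. u x * h x \<partial>M)"
    using assms by (intro nn_integral_density)
  also have "\<dots> \<le> (\<integral>\<^sup>+ x. k * h x \<partial>M)" using assms by (intro nn_integral_mono mult_right_mono) auto
  also have "\<dots> = k * (\<integral>\<^sup>+ x. h x \<partial>M)" using assms by (intro nn_integral_cmult)
  finally show ?thesis .
qed

context energy
begin

lemma V_bounded_above:
  assumes "compact K"
  obtains v where "0 \<le> v" "\<forall>x\<in>K. V x \<le> v"
proof -
  have "compact (V ` K)" by (intro compact_continuous_image continuous_on_subset[OF V_cont] assms) auto
  then obtain a where "\<forall>x\<in>K. \<bar>V x\<bar> \<le> a" by (auto dest!: compact_imp_bounded simp: bounded_iff)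
  then have "\<forall>x\<in>K. V x \<le> max 0 a" by (auto simp: le_max_iff_disj abs_le_iff)
  then show thesis by (rule that[rotated]) simp
qed

lemma phi_pair_measurable:
  "sets \<mu> = sets borel \<Longrightarrow> sets \<nu> = sets borel \<Longrightarrow> (\<lambda>p. e2ennreal (phi p)) \<in> borel_measurable (\<mu> \<Otimes>\<^sub>M \<nu>)"
proof -
  assume s: "sets \<mu> = sets (borel :: 'a measure)" "sets \<nu> = sets (borel :: 'a measure)"
  have "sets (\<mu> \<Otimes>\<^sub>M \<nu>) = sets (borel :: ('a \<times> 'a) measure)"
    using sets_pair_measure_cong[OF s] by (simp only: borel_prod)
  moreover have "(\<lambda>p. e2ennreal (phi p)) \<in> borel_measurable borel" using phi_measurable by measurable
  ultimately show ?thesis by (simp cong: measurable_cong_sets)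
qed

lemma J_iterated:
  assumes "\<mu> \<in> M1"
  shows "J \<mu> = (\<integral>\<^sup>+ x. \<integral>\<^sup>+ y. e2ennreal (phi (x, y)) \<partial>\<mu> \<partial>\<mu>)"
proof -
  interpret prob_space \<mu> by (rule M1_prob[OF assms])
  show ?thesis unfolding J_def
    using M1_sets[OF assms] by (intro nn_integral_fst[symmetric] phi_pair_measurable)
qed

text \<open>The density is at most 1 / c and phi is nonnegative, so the energy gains one factor 1 /
  c per variable. For a test function, the part over E is rescaled by 1 / c - 1 and has size at most
  b c, and the part over the complement is lost; each contributes b (1 - c).\<close>

lemma conditioned_measure:
  assumes \<mu>: "\<mu> \<in> M1" and E: "E \<in> sets borel" and c: "c = measure \<mu> E" "0 < c"
  defines "\<nu> \<equiv> density \<mu> (\<lambda>x. ennreal (indicator E x / c))"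
  shows "\<nu> \<in> M1" "J \<nu> \<le> ennreal ((1 / c)\<^sup>2) * J \<mu>"
    "\<And>(g :: 'a \<Rightarrow> real) b. g \<in> bcont \<Longrightarrow> (\<And>x. \<bar>g x\<bar> \<le> b) \<Longrightarrow> \<bar>(\<integral>x. g x \<partial>\<nu>) - (\<integral>x. g x \<partial>\<mu>)\<bar> \<le> 2 * b * (1 - c)"
proof -
  interpret prob_space \<mu> by (rule M1_prob[OF \<mu>])
  have [measurable]: "E \<in> sets \<mu>" using E M1_sets[OF \<mu>] by simp
  have c1: "c \<le> 1" using c by simp
  let ?u = "\<lambda>x. ennreal (indicator E x / c)"
  have u: "?u \<in> borel_measurable \<mu>" by measurable
  have "emeasure \<nu> (space \<nu>) = (\<integral>\<^sup>+ x. ennreal (1 / c) * indicator E x \<partial>\<mu>)"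
    unfolding \<nu>_def by (simp add: emeasure_density)
      (auto intro!: nn_integral_cong split: split_indicator)
  also have "\<dots> = ennreal (1 / c) * emeasure \<mu> E" by (simp add: nn_integral_cmult_indicator)
  also have "\<dots> = 1" using c by (simp add: emeasure_eq_measure ennreal_mult[symmetric])
  finally have "prob_space \<nu>" by (rule prob_spaceI)
  moreover have s\<nu>: "sets \<nu> = sets borel" using M1_sets[OF \<mu>] by (simp add: \<nu>_def)
  ultimately show \<nu>: "\<nu> \<in> M1" by (simp add: M1_def)
  have uk: "?u x \<le> ennreal (1 / c)" for x using c by (auto split: split_indicator)
  have m1: "(\<lambda>y. e2ennreal (phi (x, y))) \<in> borel_measurable \<mu>" for x
    using measurable_Pair2[OF phi_pair_measurable[OF M1_sets[OF \<mu>] M1_sets[OF \<mu>]], of x] M1_space[OF \<mu>] by simp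
  have m2: "(\<lambda>x. \<integral>\<^sup>+ y. e2ennreal (phi (x, y)) \<partial>\<mu>) \<in> borel_measurable \<mu>"
    using M1_sets[OF \<mu>] by (intro borel_measurable_nn_integral_fst phi_pair_measurable)
  have "J \<nu> \<le> (\<integral>\<^sup>+ x. ennreal (1 / c) * (\<integral>\<^sup>+ y. e2ennreal (phi (x, y)) \<partial>\<mu>) \<partial>\<nu>)"
    unfolding J_iterated[OF \<nu>] using nn_integral_density_le[OF u m1 uk]
    by (intro nn_integral_mono) (simp add: \<nu>_def)
  also have "\<dots> \<le> ennreal (1 / c) * (\<integral>\<^sup>+ x. ennreal (1 / c) * (\<integral>\<^sup>+ y. e2ennreal (phi (x, y)) \<partial>\<mu>) \<partial>\<mu>)"
    unfolding \<nu>_def using m2 by (intro nn_integral_density_le u uk borel_measurable_times) auto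
  also have "\<dots> = ennreal (1 / c) * (ennreal (1 / c) * J \<mu>)"
    unfolding J_iterated[OF \<mu>] using m2 by (simp add: nn_integral_cmult)
  also have "\<dots> = ennreal ((1 / c)\<^sup>2) * J \<mu>"
    using c by (simp add: mult.assoc[symmetric] ennreal_mult[symmetric] power2_eq_square)
  finally show "J \<nu> \<le> ennreal ((1 / c)\<^sup>2) * J \<mu>" .
  fix g :: "'a \<Rightarrow> real" and b assume g: "g \<in> bcont" and b: "\<And>x. \<bar>g x\<bar> \<le> b"
  have gm[measurable]: "g \<in> borel_measurable \<mu>" using bcont_measurable[OF g] M1_sets[OF \<mu>] by (simp cong: measurable_cong_sets)
  have gi: "integrable \<mu> g" by (rule integrable_bcont[OF g \<mu>])
  define X where "X = (\<integral>x. indicator E x * g x \<partial>\<mu>)"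
  define Y where "Y = (\<integral>x. indicator (- E) x * g x \<partial>\<mu>)"
  have E': "- E \<in> sets \<mu>" using E M1_sets[OF \<mu>] by (simp add: borel_comp)
  have int: "integrable \<mu> (\<lambda>x. indicator A x * g x)" if "A \<in> sets \<mu>" for A
    using integrable_mult_indicator[OF that gi] by simp
  have bound: "\<bar>\<integral>x. indicator A x * g x \<partial>\<mu>\<bar> \<le> b * measure \<mu> A" if A: "A \<in> sets \<mu>" for A
  proof -
    have "\<bar>\<integral>x. indicator A x * g x \<partial>\<mu>\<bar> \<le> (\<integral>x. \<bar>indicator A x * g x\<bar> \<partial>\<mu>)" by (rule integral_abs_bound)
    also have "\<dots> \<le> (\<integral>x. b * indicator A x \<partial>\<mu>)"
      using b A by (intro integral_mono integrable_abs int)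
        (auto simp: emeasure_eq_measure split: split_indicator)
    also have "\<dots> = b * measure \<mu> A" using A M1_space[OF \<mu>] by simp
    finally show ?thesis .
  qed
  have XY: "(\<integral>x. g x \<partial>\<mu>) = X + Y"
  proof -
    have "X + Y = (\<integral>x. indicator E x * g x + indicator (- E) x * g x \<partial>\<mu>)"
      unfolding X_def Y_def by (intro Bochner_Integration.integral_add[symmetric] int E') measurable
    also have "\<dots> = (\<integral>x. g x \<partial>\<mu>)" by (intro Bochner_Integration.integral_cong refl) (auto split: split_indicator)
    finally show ?thesis by simp
  qed
  have "(\<integral>x. g x \<partial>\<nu>) = (\<integral>x. (indicator E x / c) *\<^sub>R g x \<partial>\<mu>)"
    unfolding \<nu>_def using c by (intro integral_density) (auto simp: gm)
  also have "\<dots> = (1 / c) * X" by (simp add: X_def)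
  finally have eq: "(\<integral>x. g x \<partial>\<nu>) - (\<integral>x. g x \<partial>\<mu>) = (1 / c - 1) * X - Y" by (simp add: XY algebra_simps)
  have cE: "measure \<mu> (- E) = 1 - c"
    using prob_compl[of E] M1_space[OF \<mu>] c by (simp add: Compl_eq_Diff_UNIV)
  have "\<bar>(1 / c - 1) * X - Y\<bar> \<le> \<bar>(1 / c - 1) * X\<bar> + \<bar>Y\<bar>" by (rule abs_triangle_ineq4)
  also have "\<dots> \<le> (1 / c - 1) * (b * c) + b * (1 - c)"
    using bound[of E] bound[OF E'] c c1 unfolding X_def[symmetric] Y_def[symmetric] cE abs_mult
    by (intro add_mono mult_mono) (auto simp: field_simps)
  also have "\<dots> = 2 * b * (1 - c)" using c by (simp add: field_simps)
  finally show "\<bar>(\<integral>x. g x \<partial>\<nu>) - (\<integral>x. g x \<partial>\<mu>)\<bar> \<le> 2 * b * (1 - c)" by (simp add: eq)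
qed

text \<open>The uniform measure on the unit ball K works. For x and y in K, the pair itself competes
  in the supremum defining \<open>W_sup W K (x - y)\<close>, so W x y is at most w (x - y). After
  reflection, the inner integral is bounded by that of |w| over the ball of radius 2, which contains
  all differences.\<close>

lemma finite_energy_ac:
  assumes W_sup: "locally_integrable (W_sup W (cball 0 1))"
  shows "\<exists>\<mu>\<in>M1. absolutely_continuous lborel \<mu> \<and> I_fun V W \<mu> < \<infinity>"
proof -
  define K where "K = (cball 0 1 :: 'a set)"
  define w where "w = W_sup W K"
  have [measurable]: "w \<in> borel_measurable borel"
    using W_sup by (simp add: w_def K_def locally_integrable_def)
  have K[measurable]: "K \<in> sets borel" "compact K" by (simp_all add: K_def)
  have [measurable]: "cball (0::'a) 2 \<in> sets borel" by simp
  define vol where "vol = measure lborel K"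
  have vol: "emeasure lborel K = ennreal vol" "0 < vol"
  proof -
    show "emeasure lborel K = ennreal vol"
      unfolding vol_def K_def using emeasure_lborel_cball_finite[of "0::'a" 1]
      by (intro emeasure_eq_ennreal_measure) auto
    then show "0 < vol" using content_cball_pos[of 1 "0::'a"] by (simp add: vol_def K_def)
  qed
  obtain v where v: "0 \<le> v" "\<forall>x\<in>K. V x \<le> v" by (rule V_bounded_above[OF K(2)])
  define T where "T = (\<integral>\<^sup>+ z. e2ennreal \<bar>w z\<bar> * indicator (cball 0 2) z \<partial>lborel)"
  have T: "T < \<infinity>" using W_sup by (simp add: T_def w_def K_def locally_integrable_def)
  define u where "u x = ennreal (1 / vol) * indicator K x" for x :: 'a
  have [measurable]: "u \<in> borel_measurable borel" unfolding u_def[abs_def] by measurable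
  define \<mu> where "\<mu> = density lborel u"
  have "emeasure \<mu> (space \<mu>) = ennreal (1 / vol) * emeasure lborel K"
    unfolding \<mu>_def by (simp add: emeasure_density u_def nn_integral_cmult_indicator)
  also have "\<dots> = 1" using vol by (simp add: ennreal_mult[symmetric])
  finally have \<mu>: "\<mu> \<in> M1" by (simp add: M1_def \<mu>_def prob_spaceI)
  have ac: "absolutely_continuous lborel \<mu>"
    unfolding \<mu>_def by (intro absolutely_continuousI_density) simp
  have phi_le: "e2ennreal (phi (x, y)) \<le> ennreal (2 * v + C) + e2ennreal \<bar>w (x - y)\<bar>" if "x \<in> K" "y \<in> K" for x y
  proof -
    have "W x y \<in> {W x' y' | x' y'. x' \<in> K \<and> y' \<in> K \<and> norm (x' - y') \<ge> norm (x - y)}"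
      using that by blast
    then have "W x y \<le> w (x - y)"
      unfolding w_def W_sup_def Let_def by (auto intro: Sup_upper)
    also have "\<dots> \<le> \<bar>w (x - y)\<bar>" by (cases "w (x - y)") auto
    finally have "W x y \<le> \<bar>w (x - y)\<bar>" .
    moreover have "V x \<le> v" "V y \<le> v" using v(2) that by auto
    ultimately have "phi (x, y) \<le> ereal (2 * v + C) + \<bar>w (x - y)\<bar>"
      unfolding phi_def
      by (cases "W x y"; cases "w (x - y)") (auto simp: W_not_MInf)
    then have "e2ennreal (phi (x, y)) \<le> e2ennreal (ereal (2 * v + C) + \<bar>w (x - y)\<bar>)" by (rule e2ennreal_mono)
    also have "\<dots> = ennreal (2 * v + C) + e2ennreal \<bar>w (x - y)\<bar>"
    proof (cases "w (x - y)")
      case (real r)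
      then show ?thesis using v C by (simp add: e2ennreal_ereal)
    qed simp_all
    finally show ?thesis .
  qed
  have inner: "(\<integral>\<^sup>+ y. e2ennreal (phi (x, y)) \<partial>\<mu>) \<le> ennreal (1 / vol) * (ennreal (2 * v + C) * ennreal vol + T)"
    if x: "x \<in> K" for x
  proof -
    have m: "(\<lambda>y. e2ennreal (phi (x, y))) \<in> borel_measurable lborel"
      using measurable_Pair2[OF phi_pair_measurable[of lborel lborel], of x] by simp
    have "(\<integral>\<^sup>+ y. e2ennreal (phi (x, y)) \<partial>\<mu>) = (\<integral>\<^sup>+ y. u y * e2ennreal (phi (x, y)) \<partial>lborel)"
      unfolding \<mu>_def by (intro nn_integral_density m) simp
    also have "\<dots> \<le> (\<integral>\<^sup>+ y. ennreal (1 / vol) * (ennreal (2 * v + C) * indicator K y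
        + e2ennreal \<bar>w (x - y)\<bar> * indicator (cball 0 2) (x - y)) \<partial>lborel)"
    proof (intro nn_integral_mono)
      fix y
      show "u y * e2ennreal (phi (x, y)) \<le> ennreal (1 / vol) * (ennreal (2 * v + C) * indicator K y
        + e2ennreal \<bar>w (x - y)\<bar> * indicator (cball 0 2) (x - y))"
      proof (cases "y \<in> K")
        case True
        have "norm (x - y) \<le> 2"
          using norm_triangle_ineq4[of x y] x True by (simp add: K_def)
        then show ?thesis using phi_le[OF x True] True
          by (auto simp: u_def intro!: mult_left_mono)
      qed (simp add: u_def)
    qed
    also have "\<dots> = ennreal (1 / vol) * (ennreal (2 * v + C) * emeasure lborel K
        + (\<integral>\<^sup>+ y. e2ennreal \<bar>w (x - y)\<bar> * indicator (cball 0 2) (x - y) \<partial>lborel))"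
    proof -
      let ?h = "\<lambda>y. e2ennreal \<bar>w (x - y)\<bar> * indicator (cball 0 2) (x - y)"
      have "(\<lambda>z. e2ennreal \<bar>w z\<bar> * indicator (cball 0 2) z) \<in> borel_measurable borel" by measurable
      from measurable_compose[OF _ this, of "\<lambda>y. x - y" lborel]
      have [measurable]: "?h \<in> borel_measurable lborel" by simp
      have "(\<integral>\<^sup>+ y. ennreal (2 * v + C) * indicator K y + ?h y \<partial>lborel)
          = ennreal (2 * v + C) * emeasure lborel K + (\<integral>\<^sup>+ y. ?h y \<partial>lborel)"
        by (subst nn_integral_add) (auto simp: nn_integral_cmult_indicator)
      then show ?thesis by (subst nn_integral_cmult) auto
    qed
    also have "(\<integral>\<^sup>+ y. e2ennreal \<bar>w (x - y)\<bar> * indicator (cball 0 2) (x - y) \<partial>lborel) = T"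
      unfolding T_def
      by (rule nn_integral_lborel_reflect[where h = "\<lambda>z. e2ennreal \<bar>w z\<bar> * indicator (cball 0 2) z"]) measurable
    finally show ?thesis by (simp add: vol)
  qed
  interpret P: prob_space \<mu> by (rule M1_prob[OF \<mu>])
  have AEK: "AE x in \<mu>. x \<in> K"
    unfolding \<mu>_def by (subst AE_density) (auto simp: u_def split: split_indicator)
  have "J \<mu> \<le> (\<integral>\<^sup>+ x. ennreal (1 / vol) * (ennreal (2 * v + C) * ennreal vol + T) \<partial>\<mu>)"
    unfolding J_iterated[OF \<mu>] by (intro nn_integral_mono_AE eventually_mono[OF AEK] inner)
  also have "\<dots> < top" using T by (simp add: P.emeasure_space_1 ennreal_mult_less_top)
  finally have "J \<mu> < top" .
  then have "I_fun V W \<mu> < \<infinity>" by (cases "J \<mu>") (auto simp: I_fun_eq[OF \<mu>] enn2ereal_ennreal)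
  then show ?thesis using \<mu> ac by blast
qed

end

section \<open>Lower bound for absolutely continuous measures\<close>

context gas
begin

lemma one_over_\<beta>: "(\<lambda>N. 1 / \<beta> N) \<longlonglongrightarrow> 0"
proof (rule tendsto_sandwich[OF _ _ tendsto_const \<beta>_growth])
  show "\<forall>\<^sub>F N in sequentially. 0 \<le> 1 / \<beta> N" using \<beta>_pos by (simp add: less_imp_le)
  show "\<forall>\<^sub>F N in sequentially. 1 / \<beta> N \<le> real N / \<beta> N"
    using eventually_ge_at_top[of 1]
    by eventually_elim (use \<beta>_pos in \<open>auto intro!: divide_right_mono simp: less_imp_le\<close>)
qed

text \<open>Infinite energy gives the trivial bound minus infinity. Otherwise \<mu> is conditioned
  on a set of mass c close to 1: the energy grows by at most 1 / c^2, and the conditioned measure is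
  still in U.\<close>

lemma liminf_ZP_N_ge_ac:
  assumes \<mu>: "\<mu> \<in> M1" and ac: "absolutely_continuous lborel \<mu>"
    and U: "openin weak_top U" "\<mu> \<in> U" "U \<subseteq> A"
  shows "- I_fun V W \<mu> \<le> liminf (\<lambda>N. ereal (1 / \<beta> N) * eln (ZP_N V W \<beta> N A))"
proof (cases "J \<mu>")
  case top
  then show ?thesis by (simp add: I_fun_eq[OF \<mu>])
next
  case (real jm)
  interpret prob_space \<mu> by (rule M1_prob[OF \<mu>])
  have s\<mu>: "sets \<mu> = sets lborel" using M1_sets[OF \<mu>] by simp
  define f where "f = RN_deriv lborel \<mu>"
  have [measurable]: "f \<in> borel_measurable borel" unfolding f_def using borel_measurable_RN_deriv[of lborel \<mu>] by simp
  have f: "density lborel f = \<mu>" unfolding f_def by (intro sigma_finite_measure.density_RN_deriv sigma_finite_lborel ac s\<mu>)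
  have "AE x in lborel. f x \<noteq> \<infinity>"
    unfolding f_def by (intro sigma_finite_measure.RN_deriv_finite sigma_finite_lborel ac s\<mu>) unfold_locales
  then have ffin: "AE x in \<mu>. f x \<noteq> \<infinity>" by (rule absolutely_continuous_AE[OF s\<mu> ac])
  \<comment> \<open>Both bounds are needed: the first gives a bounded density, the second an upper
    bound on the continuous V. The density is finite almost everywhere, so these sets exhaust
    \<mu>.\<close>
  define E where "E n = {x. f x \<le> of_nat n \<and> norm x \<le> real n}" for n :: nat
  have Em[measurable]: "E n \<in> sets borel" for n unfolding E_def by measurable
  have "(\<lambda>n. measure \<mu> (E n)) \<longlonglongrightarrow> measure \<mu> (\<Union>n. E n)"
  proof (rule finite_Lim_measure_incseq)
    show "range E \<subseteq> events" using Em by (auto simp: s\<mu>)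
    show "incseq E" by (auto simp: incseq_def E_def intro: order_trans)
  qed
  also have "measure \<mu> (\<Union>n. E n) = 1"
  proof -
    have "AE x in \<mu>. x \<in> (\<Union>n. E n)"
      using ffin
    proof eventually_elim
      case (elim x)
      obtain n1 where n1: "f x < of_nat n1" using elim ennreal_Ex_less_of_nat[of "f x"] by (auto simp: less_top)
      obtain n2 where n2: "norm x \<le> real n2" using real_arch_simple by blast
      have "f x \<le> of_nat (max n1 n2)" using n1
        by (meson less_imp_le max.cobounded1 of_nat_mono order_trans)
      then have "x \<in> E (max n1 n2)" using n2 by (auto simp: E_def)
      then show ?case by blast
    qed
    then show ?thesis using Em by (intro prob_eq_1[THEN iffD2]) (auto simp: s\<mu>)
  qed
  finally have c1: "(\<lambda>n. measure \<mu> (E n)) \<longlonglongrightarrow> 1" .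
  have jm: "0 \<le> jm" "J \<mu> = ennreal jm" using real by auto
  have I: "I_fun V W \<mu> = ereal (jm / 2 - C / 2)"
    using jm by (simp add: I_fun_eq[OF \<mu>] enn2ereal_ennreal field_simps)
  let ?s = "liminf (\<lambda>N. ereal (1 / \<beta> N) * eln (ZP_N V W \<beta> N A))"
  \<comment> \<open>One \<delta> pays for conditioning, the other for the bounded-density
    estimate.\<close>
  have *: "ereal (- (jm / 2 - C / 2 + 2 * \<delta>)) \<le> ?s" if \<delta>: "0 < \<delta>" for \<delta>
  proof -
    obtain F e where F: "finite F" "F \<subseteq> bcont" and e: "0 < e"
      and FU: "{\<rho> \<in> M1. \<forall>g\<in>F. \<bar>(\<integral>x. g x \<partial>\<rho>) - (\<integral>x. g x \<partial>\<mu>)\<bar> < e} \<subseteq> U"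
      using U(1,2) by (rule weak_top_nbhd)
    obtain B where B: "\<And>g x. g \<in> F \<Longrightarrow> \<bar>g x\<bar> \<le> B g"
      using F(2) bcont_bounded by (metis subsetD)
    have "\<forall>g\<in>F. \<forall>\<^sub>F n in sequentially. 2 * B g * (1 - measure \<mu> (E n)) < e"
    proof
      fix g
      have "(\<lambda>n. 2 * B g * (1 - measure \<mu> (E n))) \<longlonglongrightarrow> 2 * B g * (1 - 1)" by (intro tendsto_intros c1)
      then show "\<forall>\<^sub>F n in sequentially. 2 * B g * (1 - measure \<mu> (E n)) < e" using e by (intro order_tendstoD) auto
    qed
    then have ev1: "\<forall>\<^sub>F n in sequentially. \<forall>g\<in>F. 2 * B g * (1 - measure \<mu> (E n)) < e"
      using F(1) by (simp add: eventually_ball_finite)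
    have "(\<lambda>n. (1 / measure \<mu> (E n))\<^sup>2 * jm / 2) \<longlonglongrightarrow> (1 / 1)\<^sup>2 * jm / 2" by (intro tendsto_intros c1) auto
    then have ev2: "\<forall>\<^sub>F n in sequentially. (1 / measure \<mu> (E n))\<^sup>2 * jm / 2 < jm / 2 + \<delta>"
      using \<delta> by (intro order_tendstoD) auto
    have ev3: "\<forall>\<^sub>F n in sequentially. 0 < measure \<mu> (E n)" using c1 by (rule order_tendstoD) simp
    \<comment> \<open>The level n is fixed before N tends to infinity, so M, v and c' below do not
      depend on N.\<close>
    obtain n where n: "\<forall>g\<in>F. 2 * B g * (1 - measure \<mu> (E n)) < e"
        "(1 / measure \<mu> (E n))\<^sup>2 * jm / 2 < jm / 2 + \<delta>" "0 < measure \<mu> (E n)" "1 \<le> n"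
      using eventually_conj[OF ev1 eventually_conj[OF ev2 eventually_conj[OF ev3 eventually_ge_at_top[of 1]]]]
      by (auto simp: eventually_sequentially)
    define c where "c = measure \<mu> (E n)"
    define \<nu> where "\<nu> = density \<mu> (\<lambda>x. ennreal (indicator (E n) x / c))"
    have c: "c = measure \<mu> (E n)" "0 < c" using n(3) by (auto simp: c_def)
    note cond = conditioned_measure[OF \<mu> Em c, folded \<nu>_def]
    have \<nu>: "\<nu> \<in> M1" by (rule cond(1))
    have \<nu>U: "\<nu> \<in> U"
    proof (rule subsetD[OF FU], safe)
      show "\<nu> \<in> M1" by (rule \<nu>)
      fix g assume g: "g \<in> F"
      have "\<bar>(\<integral>x. g x \<partial>\<nu>) - (\<integral>x. g x \<partial>\<mu>)\<bar> \<le> 2 * B g * (1 - c)"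
        using g F(2) B[OF g] by (intro cond(3)) auto
      also have "\<dots> < e" using n(1) g by (simp add: c_def)
      finally show "\<bar>(\<integral>x. g x \<partial>\<nu>) - (\<integral>x. g x \<partial>\<mu>)\<bar> < e" .
    qed
    have "J \<nu> \<le> ennreal ((1 / c)\<^sup>2 * jm)" using cond(2) jm c by (simp add: ennreal_mult)
    then obtain j where j: "J \<nu> = ennreal j" "0 \<le> j" "j \<le> (1 / c)\<^sup>2 * jm"
      using jm(1) by (cases "J \<nu>") (auto simp: top_unique)
    define h where "h x = f x * ennreal (indicator (E n) x / c)" for x
    have h: "\<nu> = density lborel h"
      unfolding \<nu>_def h_def[abs_def] f[symmetric] by (rule density_density_eq) measurable
    define M where "M = real n / c"
    obtain v where v: "0 \<le> v" "\<forall>x\<in>cball 0 (real n). V x \<le> v"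
      by (rule V_bounded_above[OF compact_cball])
    have "\<exists>c'. \<forall>\<^sub>F N in sequentially.
      ennreal (exp (- \<beta> N * (j / 2 - C / 2 + \<delta>) - real N * ln M - c')) \<le> ZP_N V W \<beta> N A"
    proof (rule ZP_N_ge_bounded_density[where f = h and U = U and v = v])
      show "h \<in> borel_measurable lborel" unfolding h_def[abs_def] by measurable
      show "h x \<le> ennreal M" for x
      proof (cases "x \<in> E n")
        case True
        then have "f x \<le> ennreal (real n)" by (simp add: E_def ennreal_of_nat_eq_real_of_nat)
        then have "h x \<le> ennreal (real n) * ennreal (1 / c)" using True unfolding h_def by (simp add: mult_right_mono)
        then show ?thesis using c by (simp add: M_def ennreal_mult[symmetric])
      qed (simp add: h_def)
      show "0 < M" using n(4) c by (simp add: M_def)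
      show "prob_space (density lborel h)" using M1_prob[OF \<nu>] h by simp
      have "AE x in \<nu>. V x \<le> v"
        unfolding \<nu>_def using v
        by (subst AE_density) (auto simp: E_def s\<mu> cong: measurable_cong_sets split: split_indicator_asm)
      then show "AE x in density lborel h. V x \<le> v" unfolding h .
      show "J (density lborel h) = ennreal j" using j h by simp
      show "density lborel h \<in> U" using \<nu>U h by simp
    qed (use j U \<delta> v in auto)
    then obtain c' where ev: "\<forall>\<^sub>F N in sequentially.
      ennreal (exp (- \<beta> N * (j / 2 - C / 2 + \<delta>) - real N * ln M - c')) \<le> ZP_N V W \<beta> N A" by blast
    have "\<forall>\<^sub>F N in sequentially. ereal (- (j / 2 - C / 2 + \<delta>) - real N / \<beta> N * ln M - 1 / \<beta> N * c')
        \<le> ereal (1 / \<beta> N) * eln (ZP_N V W \<beta> N A)"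
      using ev
    proof eventually_elim
      case (elim N)
      have "ereal (1 / \<beta> N) * ereal (- \<beta> N * (j / 2 - C / 2 + \<delta>) - real N * ln M - c')
          \<le> ereal (1 / \<beta> N) * eln (ZP_N V W \<beta> N A)"
        using \<beta>_pos[of N] by (intro ereal_mult_left_mono exp_le_eln elim) auto
      moreover have "1 / \<beta> N * (- \<beta> N * (j / 2 - C / 2 + \<delta>) - real N * ln M - c')
          = - (j / 2 - C / 2 + \<delta>) - real N / \<beta> N * ln M - 1 / \<beta> N * c'"
        using \<beta>_pos[of N] by (simp add: field_simps)
      ultimately show ?case by simp
    qed
    then have "liminf (\<lambda>N. ereal (- (j / 2 - C / 2 + \<delta>) - real N / \<beta> N * ln M - 1 / \<beta> N * c')) \<le> ?s"
      by (rule Liminf_mono)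
    also have "(\<lambda>N. ereal (- (j / 2 - C / 2 + \<delta>) - real N / \<beta> N * ln M - 1 / \<beta> N * c'))
        \<longlonglongrightarrow> ereal (- (j / 2 - C / 2 + \<delta>) - 0 * ln M - 0 * c')"
      by (intro tendsto_intros \<beta>_growth one_over_\<beta>)
    then have "liminf (\<lambda>N. ereal (- (j / 2 - C / 2 + \<delta>) - real N / \<beta> N * ln M - 1 / \<beta> N * c'))
        = ereal (- (j / 2 - C / 2 + \<delta>))"
      by (simp add: lim_imp_Liminf)
    finally have s: "ereal (- (j / 2 - C / 2 + \<delta>)) \<le> ?s" .
    have "- (jm / 2 - C / 2 + 2 * \<delta>) \<le> - (j / 2 - C / 2 + \<delta>)"
      using j(3) n(2) unfolding c_def by linarith
    then have "ereal (- (jm / 2 - C / 2 + 2 * \<delta>)) \<le> ereal (- (j / 2 - C / 2 + \<delta>))"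
      by (simp only: ereal_less_eq)
    from order_trans[OF this s] show ?thesis .
  qed
  show ?thesis
  proof (rule ereal_le_epsilon2)
    fix e :: real assume "0 < e"
    with *[of "e / 2"] have "ereal (- (jm / 2 - C / 2 + e)) \<le> ?s" by simp
    then show "- I_fun V W \<mu> \<le> ?s + ereal e"
      unfolding I by (cases ?s) auto
  qed
qed

theorem liminf_ZP_N_ge:
  "- (INF \<mu> \<in> {\<mu> \<in> weak_top interior_of A. absolutely_continuous lborel \<mu>}. I_fun V W \<mu>)
    \<le> liminf (\<lambda>N. ereal (1 / \<beta> N) * eln (ZP_N V W \<beta> N A))"
proof -
  let ?s = "liminf (\<lambda>N. ereal (1 / \<beta> N) * eln (ZP_N V W \<beta> N A))"
  have "- ?s \<le> (INF \<mu> \<in> {\<mu> \<in> weak_top interior_of A. absolutely_continuous lborel \<mu>}. I_fun V W \<mu>)"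
  proof (rule INF_greatest, clarify)
    fix \<mu> :: "'a measure" assume int: "\<mu> \<in> weak_top interior_of A" and ac: "absolutely_continuous lborel \<mu>"
    have "\<mu> \<in> M1" using int interior_of_subset_topspace[of weak_top A] by (auto simp: topspace_weak_top)
    then have "- I_fun V W \<mu> \<le> ?s"
      using ac int by (intro liminf_ZP_N_ge_ac[where U = "weak_top interior_of A"] openin_interior_of interior_of_subset)
    then show "- ?s \<le> I_fun V W \<mu>" by (simp add: ereal_uminus_le_reorder)
  qed
  then show ?thesis by (simp add: ereal_uminus_le_reorder)
qed

end

text \<open>Subtraction of a finite constant is invertible on the extended reals; the empty index
  set is included, with both sides infinite.\<close>

lemma INF_ereal_minus_const:
  fixes f :: "'b \<Rightarrow> ereal"
  shows "(INF x\<in>S. f x - ereal c) = (INF x\<in>S. f x) - ereal c"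
proof (rule antisym)
  have "(INF x\<in>S. f x - ereal c) + ereal c \<le> (INF x\<in>S. f x)"
  proof (rule INF_greatest)
    fix x assume "x \<in> S"
    then have "(INF x\<in>S. f x - ereal c) \<le> f x - ereal c" by (rule INF_lower)
    then have "(INF x\<in>S. f x - ereal c) + ereal c \<le> (f x - ereal c) + ereal c" by (rule add_right_mono)
    then show "(INF x\<in>S. f x - ereal c) + ereal c \<le> f x" by (cases "f x") auto
  qed
  then have "((INF x\<in>S. f x - ereal c) + ereal c) - ereal c \<le> (INF x\<in>S. f x) - ereal c"
    by (rule ereal_minus_mono) simp
  then show "(INF x\<in>S. f x - ereal c) \<le> (INF x\<in>S. f x) - ereal c"
    by (cases "INF x\<in>S. f x - ereal c") auto
  show "(INF x\<in>S. f x) - ereal c \<le> (INF x\<in>S. f x - ereal c)"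
    by (intro INF_greatest ereal_minus_mono INF_lower) auto
qed

lemma uminus_ereal_diff_real: "- (x - ereal c) = ereal c + - x"
  by (cases x) auto

subsection \<open>Measurability of the empirical measure\<close>

lemma empirical_cong: "(\<And>i. i < N \<Longrightarrow> x i = y i) \<Longrightarrow> empirical N x = empirical N y"
  unfolding empirical_def by (intro distr_cong) (auto simp: space_uniform_count_measure)

lemma continuous_map_empirical:
  assumes N: "0 < N"
  shows "continuous_map (euclidean :: (nat \<Rightarrow> 'a::euclidean_space) topology) weak_top (empirical N)"
  unfolding weak_top_def continuous_on_generated_topo_iff
proof (intro conjI allI impI)
  fix U assume "U \<in> {{M \<in> M1. (\<integral>x. f x \<partial>M) \<in> U} | (f :: 'a \<Rightarrow> real) U.
        continuous_on UNIV f \<and> bounded (range f) \<and> open U}"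
  then obtain f T where f: "f \<in> bcont" "open T" "U = {M \<in> M1. (\<integral>x. f x \<partial>M) \<in> T}"
    by (auto simp: bcont_def)
  have "continuous_on UNIV (\<lambda>x :: nat \<Rightarrow> 'a. f (x i))" for i
    by (rule continuous_on_compose2[OF bcont_continuous[OF f(1)] continuous_on_product_coordinates]) simp
  then have "continuous_on UNIV (\<lambda>x :: nat \<Rightarrow> 'a. (\<Sum>i<N. f (x i)) / real N)"
    using N by (intro continuous_on_divide continuous_on_sum continuous_on_const) auto
  then have "open ((\<lambda>x :: nat \<Rightarrow> 'a. (\<Sum>i<N. f (x i)) / real N) -` T)" using f(2) by (simp add: open_vimage)
  also have "(\<lambda>x :: nat \<Rightarrow> 'a. (\<Sum>i<N. f (x i)) / real N) -` T = empirical N -` U \<inter> topspace euclidean"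
    using f N by (auto simp: empirical_M1 integral_empirical bcont_measurable)
  finally show "openin euclidean (empirical N -` U \<inter> topspace euclidean)" by (simp only: open_openin)
next
  show "empirical N ` topspace euclidean \<subseteq> \<Union> {{M \<in> M1. (\<integral>x. f x \<partial>M) \<in> U} | (f :: 'a \<Rightarrow> real) U.
        continuous_on UNIV f \<and> bounded (range f) \<and> open U}"
    unfolding topology_generated_by_topspace[symmetric] weak_top_def[symmetric] topspace_weak_top
    using empirical_M1[OF N] by auto
qed

text \<open>Continuity of \<open>empirical N\<close> is formulated on full sequences, whereas
  \<open>config_space N\<close> has N coordinates. The map \<open>e\<close> pads with 0, which
  \<open>empirical N\<close> does not see, and the Borel sets of the sequence space are those of the
  countable product sigma-algebra.\<close>

lemma empirical_open_measurable:
  assumes N: "0 < N" and U: "openin weak_top U"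
  shows "{x \<in> space (config_space N). empirical N x \<in> U} \<in> sets (config_space N :: (nat \<Rightarrow> 'a::euclidean_space) measure)"
proof -
  define e where "e x i = (if i < N then x i else 0)" for x :: "nat \<Rightarrow> 'a" and i
  have "open (empirical N -` U :: (nat \<Rightarrow> 'a) set)"
    using openin_continuous_map_preimage[OF continuous_map_empirical[OF N] U]
    by (simp add: vimage_def)
  then have "empirical N -` U \<in> sets (borel :: (nat \<Rightarrow> 'a) measure)" by simp
  then have V: "empirical N -` U \<in> sets (PiM UNIV (\<lambda>_::nat. borel :: 'a measure))"
    by (simp add: sets_PiM_equal_borel)
  have "e \<in> measurable (config_space N) (PiM UNIV (\<lambda>_::nat. borel :: 'a measure))"
    unfolding e_def[abs_def]
  proof (rule measurable_PiM_single')
    show "(\<lambda>x. if i < N then x i else 0) \<in> borel_measurable (config_space N)" for i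
      using measurable_component_singleton[of i "{..<N}" "\<lambda>_. lborel :: 'a measure"]
      by (cases "i < N") (simp_all add: config_space_def)
  qed auto
  from measurable_sets[OF this V]
  have "e -` empirical N -` U \<inter> space (config_space N) \<in> sets (config_space N :: (nat \<Rightarrow> 'a) measure)" .
  also have "e -` empirical N -` U \<inter> space (config_space N) = {x \<in> space (config_space N). empirical N x \<in> U}"
  proof -
    have "empirical N (e x) = empirical N x" for x by (rule empirical_cong) (simp add: e_def)
    then show ?thesis by auto
  qed
  finally show ?thesis .
qed

section \<open>The Fortet-Mourier distance to a set\<close>

lemma integral_abs_le_one_M1:
  fixes f :: "'a::euclidean_space \<Rightarrow> real"
  assumes "\<mu> \<in> M1" "f \<in> bcont" "\<And>x. \<bar>f x\<bar> \<le> 1"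
  shows "\<bar>\<integral>x. f x \<partial>\<mu>\<bar> \<le> 1"
proof -
  have bd: "f x \<le> 1" "- 1 \<le> f x" for x using assms(3)[of x] by auto
  have "(\<integral>x. f x \<partial>\<mu>) \<le> (\<integral>x. 1 \<partial>\<mu>)" by (rule integral_M1_mono[OF assms(1,2) bcont_const bd(1)])
  moreover have "(\<integral>x. - 1 \<partial>\<mu>) \<le> (\<integral>x. f x \<partial>\<mu>)" by (rule integral_M1_mono[OF assms(1) bcont_const assms(2) bd(2)])
  ultimately show ?thesis by (simp only: integral_M1_const[OF assms(1)])
qed

text \<open>The zero function is a competitor. The bound 2 on all competitors makes the real
  supremum meaningful.\<close>

lemma d_FM_nonneg:
  fixes \<mu> \<nu> :: "'a::euclidean_space measure"
  assumes "\<mu> \<in> M1" "\<nu> \<in> M1"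
  shows "0 \<le> d_FM \<mu> \<nu>"
proof -
  let ?L = "{f :: 'a \<Rightarrow> real. (\<forall>x. \<bar>f x\<bar> \<le> 1) \<and> (\<forall>x y. \<bar>f x - f y\<bar> \<le> dist x y)}"
  have "(\<integral>x. f x \<partial>\<mu>) - (\<integral>x. f x \<partial>\<nu>) \<le> 2" if f: "f \<in> ?L" for f
  proof -
    have "1-lipschitz_on UNIV f" by (rule lipschitz_onI) (use f in \<open>auto simp: dist_real_def\<close>)
    then have "f \<in> bcont" using f by (intro bcontI[of _ 1] lipschitz_on_continuous_on) auto
    then show ?thesis
      using integral_abs_le_one_M1[OF assms(1), of f] integral_abs_le_one_M1[OF assms(2), of f] f by simp
  qed
  then have "bdd_above ((\<lambda>f. (\<integral>x. f x \<partial>\<mu>) - (\<integral>x. f x \<partial>\<nu>)) ` ?L)" by (rule bdd_aboveI2)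
  then have "(\<integral>x. (0::real) \<partial>\<mu>) - (\<integral>x. 0 \<partial>\<nu>) \<le> d_FM \<mu> \<nu>"
    unfolding d_FM_def by (intro cSUP_upper) auto
  then show ?thesis by simp
qed

lemma d_FM_set_nonneg:
  "\<mu> \<in> M1 \<Longrightarrow> S \<subseteq> M1 \<Longrightarrow> S \<noteq> {} \<Longrightarrow> 0 \<le> d_FM_set \<mu> S"
  unfolding d_FM_set_def by (intro cINF_greatest d_FM_nonneg) auto

lemma d_FM_set_le:
  "\<mu> \<in> M1 \<Longrightarrow> S \<subseteq> M1 \<Longrightarrow> \<nu> \<in> S \<Longrightarrow> d_FM_set \<mu> S \<le> d_FM \<mu> \<nu>"
  unfolding d_FM_set_def by (intro cINF_lower bdd_belowI2[of _ 0] d_FM_nonneg) auto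

lemma d_FM_set_weak_nbhd:
  fixes S :: "'a::euclidean_space measure set"
  assumes S: "S \<subseteq> M1" and e: "0 < e"
  obtains U where "openin weak_top U" "S \<subseteq> U" "\<And>\<mu>. \<mu> \<in> U \<Longrightarrow> d_FM_set \<mu> S < e"
proof -
  have "\<exists>U. openin weak_top U \<and> \<nu> \<in> U \<and> (\<forall>\<mu>\<in>U. d_FM \<mu> \<nu> < e)" if "\<nu> \<in> S" for \<nu>
    using d_FM_weak_nbhd[of \<nu> e] S that e by (metis subsetD)
  then obtain U where U: "\<And>\<nu>. \<nu> \<in> S \<Longrightarrow> openin weak_top (U \<nu>)" "\<And>\<nu>. \<nu> \<in> S \<Longrightarrow> \<nu> \<in> U \<nu>"
      "\<And>\<nu> \<mu>. \<nu> \<in> S \<Longrightarrow> \<mu> \<in> U \<nu> \<Longrightarrow> d_FM \<mu> \<nu> < e" by metis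
  show thesis
  proof (rule that[of "\<Union>\<nu>\<in>S. U \<nu>"])
    show "openin weak_top (\<Union>\<nu>\<in>S. U \<nu>)" using U(1) by blast
    show "S \<subseteq> (\<Union>\<nu>\<in>S. U \<nu>)" using U(2) by blast
    fix \<mu> assume "\<mu> \<in> (\<Union>\<nu>\<in>S. U \<nu>)"
    then obtain \<nu> where \<nu>: "\<nu> \<in> S" "\<mu> \<in> U \<nu>" by blast
    have "\<mu> \<in> M1" using openin_subset[OF U(1)[OF \<nu>(1)]] \<nu>(2) by (auto simp: topspace_weak_top)
    then have "d_FM_set \<mu> S \<le> d_FM \<mu> \<nu>" using S \<nu>(1) by (rule d_FM_set_le)
    then show "d_FM_set \<mu> S < e" using U(3)[OF \<nu>] by simp
  qed
qed

subsection \<open>Minimizers and the Gibbs measure\<close>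

context energy
begin

text \<open>The sets {I <= m + 1 / (n + 1)} within F are nonempty, nested and closed in one compact
  tight set, so they have a common point. With F = M1 this gives minimizers; with F the complement
  of a neighbourhood of the minimizers it gives a strict energy gap.\<close>

lemma I_fun_attains_INF:
  assumes F: "closedin weak_top F" and fin: "(INF \<mu> \<in> F. I_fun V W \<mu>) < \<infinity>"
  shows "\<exists>\<mu>\<in>F. I_fun V W \<mu> = (INF \<mu> \<in> F. I_fun V W \<mu>)"
proof -
  have FM: "F \<subseteq> M1" using closedin_subset[OF F] by (simp add: topspace_weak_top)
  have "ereal (- C / 2) \<le> (INF \<mu> \<in> F. I_fun V W \<mu>)" using FM by (intro INF_greatest I_fun_lower) auto
  then obtain m where m: "(INF \<mu> \<in> F. I_fun V W \<mu>) = ereal m"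
    using fin by (cases "INF \<mu> \<in> F. I_fun V W \<mu>") auto
  define T where "T = tight_set (\<lambda>x. V x + v0) ((2 * (m + 1) + C) / \<kappa>)"
  let ?X = "subtopology weak_top T"
  have TM: "T \<subseteq> M1" unfolding T_def by (auto simp: tight_set_M1)
  have top: "topspace ?X = T" using TM by (auto simp: topspace_weak_top)
  define r where "r n = m + 1 / real (Suc n)" for n
  define K where "K n = {\<mu> \<in> F. I_fun V W \<mu> \<le> ereal (r n)}" for n
  have r1: "r n \<le> m + 1" for n by (simp add: r_def)
  have Keq: "K n = (T \<inter> F) \<inter> {\<mu> \<in> topspace ?X. \<forall>k\<in>UNIV. Jn k \<mu> \<in> {..2 * r n + C}}" for n
  proof (intro equalityI subsetI)
    fix \<mu> assume \<mu>: "\<mu> \<in> K n"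
    then have "\<mu> \<in> M1" using FM by (auto simp: K_def)
    moreover have "I_fun V W \<mu> \<le> ereal (m + 1)" using \<mu> r1[of n] by (auto simp: K_def intro: order_trans)
    ultimately have "\<mu> \<in> T" unfolding T_def by (rule I_fun_le_tight)
    then show "\<mu> \<in> (T \<inter> F) \<inter> {\<mu> \<in> topspace ?X. \<forall>k\<in>UNIV. Jn k \<mu> \<in> {..2 * r n + C}}"
      using \<mu> \<open>\<mu> \<in> M1\<close> unfolding top by (auto simp: K_def I_fun_le_iff)
  next
    fix \<mu> assume "\<mu> \<in> (T \<inter> F) \<inter> {\<mu> \<in> topspace ?X. \<forall>k\<in>UNIV. Jn k \<mu> \<in> {..2 * r n + C}}"
    then show "\<mu> \<in> K n" using FM by (auto simp: K_def I_fun_le_iff subset_iff)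
  qed
  have "closedin ?X (K n)" for n
    unfolding Keq
  proof (rule closedin_Int)
    show "closedin ?X (T \<inter> F)" using F by (auto simp: closedin_subtopology Int_commute)
    show "closedin ?X {\<mu> \<in> topspace ?X. \<forall>k\<in>UNIV. Jn k \<mu> \<in> {..2 * r n + C}}"
      unfolding T_def by (rule closedin_Collect_ball[where Y = euclideanreal]) (auto intro: continuous_map_Jn)
  qed
  moreover have "K n \<noteq> {}" for n
  proof -
    have "(INF \<mu> \<in> F. I_fun V W \<mu>) < ereal (r n)" by (simp add: m r_def)
    then show ?thesis unfolding INF_less_iff K_def by (auto intro: less_imp_le)
  qed
  moreover have "decseq K"
  proof (rule decseq_SucI)
    fix n
    have "r (Suc n) \<le> r n" by (simp add: r_def frac_le)
    then show "K (Suc n) \<subseteq> K n" by (auto simp: K_def intro: order_trans)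
  qed
  moreover have "compact_space ?X"
    unfolding T_def by (intro compact_space_subtopology compactin_tight_set)
  ultimately have "(\<Inter>n. K n) \<noteq> {}" by (intro compact_space_imp_nest) auto
  then obtain \<mu> where \<mu>: "\<And>n. \<mu> \<in> K n" by blast
  then have \<mu>F: "\<mu> \<in> F" by (auto simp: K_def)
  have "I_fun V W \<mu> \<le> ereal m"
  proof (rule LIMSEQ_le_const)
    have "(\<lambda>n. ereal (m + 1 / real (Suc n))) \<longlonglongrightarrow> ereal (m + 0)"
      by (intro tendsto_intros LIMSEQ_Suc lim_1_over_n)
    then show "(\<lambda>n. ereal (r n)) \<longlonglongrightarrow> ereal m" by (simp add: r_def)
    show "\<exists>N. \<forall>n\<ge>N. I_fun V W \<mu> \<le> ereal (r n)" using \<mu> by (auto simp: K_def)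
  qed
  moreover have "ereal m \<le> I_fun V W \<mu>" unfolding m[symmetric] using \<mu>F by (rule INF_lower)
  ultimately show ?thesis using \<mu>F m by (intro bexI[of _ \<mu>]) auto
qed

text \<open>The approximants from \<open>H4\<close> eventually enter the interior because it is
  open, and their energies converge to that of \<nu>.\<close>

lemma INF_interior_ac_le:
  assumes "H4 V W"
  shows "(INF \<mu> \<in> {\<mu> \<in> weak_top interior_of A. absolutely_continuous lborel \<mu>}. I_fun V W \<mu>)
    \<le> (INF \<mu> \<in> weak_top interior_of A. I_fun V W \<mu>)"
proof (rule INF_greatest)
  let ?S = "{\<mu> \<in> weak_top interior_of A. absolutely_continuous lborel \<mu>}"
  fix \<nu> :: "'a measure" assume \<nu>: "\<nu> \<in> weak_top interior_of A"
  then have "\<nu> \<in> M1" using interior_of_subset_topspace[of weak_top A] by (auto simp: topspace_weak_top)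
  show "(INF \<mu> \<in> ?S. I_fun V W \<mu>) \<le> I_fun V W \<nu>"
  proof (cases "I_fun V W \<nu> < \<infinity>")
    case True
    then obtain \<nu>s where \<nu>s: "\<And>n. absolutely_continuous lborel (\<nu>s n)" "limitin weak_top \<nu>s \<nu> sequentially"
        "(\<lambda>n. I_fun V W (\<nu>s n)) \<longlonglongrightarrow> I_fun V W \<nu>"
      using assms \<open>\<nu> \<in> M1\<close> unfolding H4_def by blast
    have "\<forall>\<^sub>F n in sequentially. \<nu>s n \<in> weak_top interior_of A"
      using \<nu>s(2) \<nu> openin_interior_of[of weak_top A] unfolding limitin_def by blast
    then have "\<forall>\<^sub>F n in sequentially. (INF \<mu> \<in> ?S. I_fun V W \<mu>) \<le> I_fun V W (\<nu>s n)"
      by eventually_elim (use \<nu>s(1) in \<open>auto intro: INF_lower\<close>)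
    then show ?thesis using \<nu>s(3) by (intro tendsto_lowerbound) auto
  qed simp
qed

end

section \<open>Large deviations of the Gibbs measure and almost sure convergence\<close>

context gas
begin

lemma gibbs_weight_measurable: "0 < N \<Longrightarrow> gibbs_weight V W \<beta> N \<in> borel_measurable (config_space N)"
  unfolding gibbs_weight_def[abs_def] using H_N_measurable[of N] by measurable

lemma Z_N_eq: "0 < N \<Longrightarrow> Z_N V W \<beta> N = ZP_N V W \<beta> N M1"
  by (simp add: Z_N_def ZP_N_def empirical_M1)

context
  fixes m :: real
  assumes h4: "H4 V W" and m: "(INF \<mu> \<in> M1. I_fun V W \<mu>) = ereal m"
begin

text \<open>Both bounds are applied to the whole space, which equals its interior and its closure.
  The limit is minus the infimum of \<open>I_fun\<close> itself; the infimum of the normalised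
  functional I - m is 0.\<close>

lemma Z_N_tendsto: "(\<lambda>N. ereal (1 / \<beta> N) * eln (Z_N V W \<beta> N)) \<longlonglongrightarrow> ereal (- m)"
proof -
  let ?z = "\<lambda>N. ereal (1 / \<beta> N) * eln (ZP_N V W \<beta> N M1)"
  have int: "weak_top interior_of M1 = (M1 :: 'a measure set)"
    using interior_of_topspace[of weak_top] by (simp add: topspace_weak_top)
  have clo: "weak_top closure_of M1 = (M1 :: 'a measure set)"
    using closure_of_topspace[of weak_top] by (simp add: topspace_weak_top)
  have "limsup ?z \<le> - ereal m" using limsup_ZP_N_le[of M1] by (simp only: clo m)
  moreover have "- ereal m \<le> liminf ?z"
  proof -
    have "- ereal m \<le> - (INF \<mu> \<in> {\<mu> \<in> weak_top interior_of M1. absolutely_continuous lborel \<mu>}. I_fun V W \<mu>)"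
      using INF_interior_ac_le[OF h4, of M1] by (simp only: int m ereal_minus_le_minus)
    also have "\<dots> \<le> liminf ?z" by (rule liminf_ZP_N_ge)
    finally show ?thesis .
  qed
  ultimately have "liminf ?z = - ereal m \<and> limsup ?z = - ereal m"
    using Liminf_le_Limsup[of sequentially ?z] by (auto intro: antisym order_trans)
  then have "?z \<longlonglongrightarrow> - ereal m" by (simp add: tendsto_iff_Liminf_eq_Limsup)
  then have "?z \<longlonglongrightarrow> ereal (- m)" by simp
  then show ?thesis
  proof (rule Lim_transform_eventually)
    show "\<forall>\<^sub>F N in sequentially. ?z N = ereal (1 / \<beta> N) * eln (Z_N V W \<beta> N)"
      using eventually_gt_at_top[of 0] by eventually_elim (simp add: Z_N_eq)
  qed
qed

text \<open>Since the scaled logarithms have a finite limit, \<open>eln\<close> eventually takes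
  neither infinite value, which rules out both 0 and infinity.\<close>

lemma eventually_Z_N: "\<forall>\<^sub>F N in sequentially. 0 < Z_N V W \<beta> N \<and> Z_N V W \<beta> N < top"
proof -
  have "\<forall>\<^sub>F N in sequentially. ereal (- m - 1) < ereal (1 / \<beta> N) * eln (Z_N V W \<beta> N)"
    using Z_N_tendsto by (rule order_tendstoD) simp
  moreover have "\<forall>\<^sub>F N in sequentially. ereal (1 / \<beta> N) * eln (Z_N V W \<beta> N) < ereal (- m + 1)"
    using Z_N_tendsto by (rule order_tendstoD) simp
  ultimately show ?thesis
  proof eventually_elim
    case (elim N)
    then have "eln (Z_N V W \<beta> N) \<noteq> \<infinity>" "eln (Z_N V W \<beta> N) \<noteq> - \<infinity>" using \<beta>_pos[of N] by auto
    then show ?case by (auto simp: eln_def zero_less_iff_neq_zero less_top split: if_splits)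
  qed
qed

text \<open>Normalisation becomes the addition of a sequence with a finite limit, which can be
  pulled out of limsup and liminf even if the other term is infinite.\<close>

lemma eln_P_N_prob:
  "\<forall>\<^sub>F N in sequentially. - (ereal (1 / \<beta> N) * eln (Z_N V W \<beta> N)) + ereal (1 / \<beta> N) * eln (ZP_N V W \<beta> N A)
     = ereal (1 / \<beta> N) * eln (P_N_prob V W \<beta> N A)"
  using eventually_Z_N
proof eventually_elim
  case (elim N)
  define z where "z = ln (enn2real (Z_N V W \<beta> N))"
  have z: "eln (Z_N V W \<beta> N) = ereal z" using elim by (auto simp: eln_def z_def)
  show ?case
    unfolding P_N_prob_def eln_divide[OF conjunct1[OF elim] conjunct2[OF elim]] z
    using \<beta>_pos[of N] by (cases "eln (ZP_N V W \<beta> N A)") (auto simp: field_simps)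
qed

lemma tendsto_neg_Z_N: "(\<lambda>N. - (ereal (1 / \<beta> N) * eln (Z_N V W \<beta> N))) \<longlonglongrightarrow> ereal m"
  using tendsto_uminus_ereal[OF Z_N_tendsto] by simp

lemma limsup_P_N_prob_le:
  "limsup (\<lambda>N. ereal (1 / \<beta> N) * eln (P_N_prob V W \<beta> N A))
    \<le> - (INF \<mu> \<in> weak_top closure_of A. I_fun V W \<mu> - ereal m)"
proof -
  have "limsup (\<lambda>N. ereal (1 / \<beta> N) * eln (P_N_prob V W \<beta> N A))
      = limsup (\<lambda>N. - (ereal (1 / \<beta> N) * eln (Z_N V W \<beta> N)) + ereal (1 / \<beta> N) * eln (ZP_N V W \<beta> N A))"
    by (rule Limsup_eq) (use eln_P_N_prob[of A] in \<open>auto elim: eventually_mono\<close>)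
  also have "\<dots> = ereal m + limsup (\<lambda>N. ereal (1 / \<beta> N) * eln (ZP_N V W \<beta> N A))"
    by (rule ereal_limsup_lim_add[OF tendsto_neg_Z_N]) simp
  also have "\<dots> \<le> ereal m + - (INF \<mu> \<in> weak_top closure_of A. I_fun V W \<mu>)"
    by (intro add_left_mono limsup_ZP_N_le)
  finally show ?thesis by (simp only: INF_ereal_minus_const uminus_ereal_diff_real)
qed

lemma liminf_P_N_prob_ge:
  "- (INF \<mu> \<in> weak_top interior_of A. I_fun V W \<mu> - ereal m)
    \<le> liminf (\<lambda>N. ereal (1 / \<beta> N) * eln (P_N_prob V W \<beta> N A))"
proof -
  have "- (INF \<mu> \<in> weak_top interior_of A. I_fun V W \<mu>)
      \<le> - (INF \<mu> \<in> {\<mu> \<in> weak_top interior_of A. absolutely_continuous lborel \<mu>}. I_fun V W \<mu>)"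
    using INF_interior_ac_le[OF h4, of A] by (simp only: ereal_minus_le_minus)
  also have "\<dots> \<le> liminf (\<lambda>N. ereal (1 / \<beta> N) * eln (ZP_N V W \<beta> N A))" by (rule liminf_ZP_N_ge)
  finally have "ereal m + - (INF \<mu> \<in> weak_top interior_of A. I_fun V W \<mu>)
      \<le> ereal m + liminf (\<lambda>N. ereal (1 / \<beta> N) * eln (ZP_N V W \<beta> N A))" by (rule add_left_mono)
  also have "\<dots> = liminf (\<lambda>N. - (ereal (1 / \<beta> N) * eln (Z_N V W \<beta> N)) + ereal (1 / \<beta> N) * eln (ZP_N V W \<beta> N A))"
    by (rule ereal_liminf_lim_add[OF tendsto_neg_Z_N, symmetric]) simp
  also have "\<dots> = liminf (\<lambda>N. ereal (1 / \<beta> N) * eln (P_N_prob V W \<beta> N A))"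
    by (rule Liminf_eq) (use eln_P_N_prob[of A] in \<open>auto elim: eventually_mono\<close>)
  finally show ?thesis by (simp only: INF_ereal_minus_const uminus_ereal_diff_real)
qed

text \<open>On the closed complement F of U the energy gap to m is strictly positive, so the upper
  bound makes P_N(F) exponentially small in \<beta> N, hence summable. Borel-Cantelli uses only the
  marginal laws and therefore holds for every coupling of the \<open>X N\<close>.\<close>

lemma AE_eventually_near_minimizers:
  fixes \<Omega> :: "'w measure" and X :: "nat \<Rightarrow> 'w \<Rightarrow> nat \<Rightarrow> 'a"
  assumes \<Omega>: "prob_space \<Omega>"
    and X: "\<And>N. N0 \<le> N \<Longrightarrow> X N \<in> measurable \<Omega> (config_space N)"
      "\<And>N. N0 \<le> N \<Longrightarrow> distr \<Omega> (config_space N) (X N) = P_N V W \<beta> N"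
    and \<beta>_log: "\<And>k. \<forall>\<^sub>F N in sequentially. k * ln (real N) \<le> \<beta> N"
    and U: "openin weak_top U" "{\<mu> \<in> M1. I_fun V W \<mu> - ereal m = 0} \<subseteq> U"
  shows "AE \<omega> in \<Omega>. \<forall>\<^sub>F N in sequentially. empirical N (X N \<omega>) \<in> U"
proof -
  interpret prob_space \<Omega> by fact
  define F where "F = M1 - U"
  have F: "closedin weak_top F" unfolding F_def using U(1) by (metis closedin_diff closedin_topspace topspace_weak_top)
  \<comment> \<open>A gap of 0 would be attained by a point of F, which would be a minimizer outside
    U.\<close>
  have pos: "0 < (INF \<mu> \<in> F. I_fun V W \<mu> - ereal m)"
  proof (rule ccontr)
    assume "\<not> ?thesis"
    then have le: "(INF \<mu> \<in> F. I_fun V W \<mu>) - ereal m \<le> 0" by (simp add: INF_ereal_minus_const not_less)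
    then have "(INF \<mu> \<in> F. I_fun V W \<mu>) < \<infinity>" by (cases "INF \<mu> \<in> F. I_fun V W \<mu>") auto
    then obtain \<mu> where \<mu>: "\<mu> \<in> F" "I_fun V W \<mu> = (INF \<mu> \<in> F. I_fun V W \<mu>)"
      using I_fun_attains_INF[OF F] by blast
    have "ereal m \<le> I_fun V W \<mu>" unfolding m[symmetric] using \<mu>(1) by (intro INF_lower) (simp add: F_def)
    then have "I_fun V W \<mu> - ereal m = 0"
      using le unfolding \<mu>(2)[symmetric] by (cases "I_fun V W \<mu>") auto
    then show False using \<mu>(1) U(2) by (auto simp: F_def)
  qed
  then obtain \<eta> where \<eta>: "0 < \<eta>" "ereal \<eta> < (INF \<mu> \<in> F. I_fun V W \<mu> - ereal m)"
    using ereal_dense2 by (metis ereal_less(2))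
  have "limsup (\<lambda>N. ereal (1 / \<beta> N) * eln (P_N_prob V W \<beta> N F)) < ereal (- \<eta>)"
  proof -
    have "limsup (\<lambda>N. ereal (1 / \<beta> N) * eln (P_N_prob V W \<beta> N F)) \<le> - (INF \<mu> \<in> F. I_fun V W \<mu> - ereal m)"
      using limsup_P_N_prob_le[of F] by (simp only: closure_of_closedin[OF F])
    also have "\<dots> < ereal (- \<eta>)" using \<eta>(2) by (simp add: ereal_uminus_less_reorder)
    finally show ?thesis .
  qed
  then have ev1: "\<forall>\<^sub>F N in sequentially. ereal (1 / \<beta> N) * eln (P_N_prob V W \<beta> N F) < ereal (- \<eta>)"
    by (rule Limsup_lessD)
  define B where "B N = (if N0 \<le> N \<and> 0 < N then {\<omega> \<in> space \<Omega>. empirical N (X N \<omega>) \<in> F} else {})" for N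
  have Fm: "{x \<in> space (config_space N). empirical N x \<in> F} \<in> sets (config_space N)" if "0 < N" for N
  proof -
    have "{x \<in> space (config_space N). empirical N x \<in> F}
        = space (config_space N) - {x \<in> space (config_space N). empirical N x \<in> U}"
      using empirical_M1[OF that] by (auto simp: F_def)
    then show ?thesis using empirical_open_measurable[OF that U(1)] by auto
  qed
  have Beq: "B N = X N -` {x \<in> space (config_space N). empirical N x \<in> F} \<inter> space \<Omega>" if "N0 \<le> N" "0 < N" for N
    using that measurable_space[OF X(1)[OF that(1)]] by (auto simp: B_def)
  have Bm: "B N \<in> sets \<Omega>" for N
    using Beq[of N] measurable_sets[OF X(1) Fm, of N] by (cases "N0 \<le> N \<and> 0 < N") (auto simp: B_def)
  have BP: "emeasure \<Omega> (B N) = P_N_prob V W \<beta> N F" if N: "N0 \<le> N" "0 < N" for N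
  proof -
    let ?F = "{x \<in> space (config_space N). empirical N x \<in> F}"
    have [measurable]: "gibbs_weight V W \<beta> N \<in> borel_measurable (config_space N)"
      by (rule gibbs_weight_measurable[OF N(2)])
    have "emeasure \<Omega> (B N) = emeasure (distr \<Omega> (config_space N) (X N)) ?F"
      unfolding Beq[OF N] by (intro emeasure_distr[symmetric] X N Fm)
    also have "\<dots> = (\<integral>\<^sup>+ x. gibbs_weight V W \<beta> N x / Z_N V W \<beta> N * indicator ?F x \<partial>config_space N)"
      unfolding X(2)[OF N(1)] P_N_def by (intro emeasure_density Fm N) measurable
    also have "\<dots> = (\<integral>\<^sup>+ x. (indicator ?F x * gibbs_weight V W \<beta> N x) / Z_N V W \<beta> N \<partial>config_space N)"
      by (intro nn_integral_cong) (auto split: split_indicator)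
    also have "\<dots> = (\<integral>\<^sup>+ x. indicator ?F x * gibbs_weight V W \<beta> N x \<partial>config_space N) / Z_N V W \<beta> N"
      by (intro nn_integral_divide borel_measurable_times_ennreal borel_measurable_indicator Fm N) measurable
    also have "(\<integral>\<^sup>+ x. indicator ?F x * gibbs_weight V W \<beta> N x \<partial>config_space N) = ZP_N V W \<beta> N F"
      unfolding ZP_N_def by (intro nn_integral_cong) (auto split: split_indicator)
    finally show ?thesis by (simp add: P_N_prob_def)
  qed
  have "\<forall>\<^sub>F N in sequentially. norm (prob (B N)) \<le> real N powr - 2"
    using ev1 \<beta>_log[of "2 / \<eta>"] eventually_gt_at_top[of 0] eventually_ge_at_top[of N0]
  \<comment> \<open>Taking 2 / \<eta> in \<open>\<beta>_log\<close> turns exp (- \<eta> \<beta> N)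
    into at most N^(-2), a summable bound.\<close>
  proof eventually_elim
    case (elim N)
    have "eln (P_N_prob V W \<beta> N F) < ereal (- \<eta> * \<beta> N)"
      using elim(1) \<beta>_pos[of N] by (cases "eln (P_N_prob V W \<beta> N F)") (auto simp: field_simps)
    then have "\<not> ennreal (exp (- \<eta> * \<beta> N)) \<le> P_N_prob V W \<beta> N F"
      using exp_le_eln[of "- \<eta> * \<beta> N"] by (meson not_le)
    then have "emeasure \<Omega> (B N) \<le> ennreal (exp (- \<eta> * \<beta> N))" using BP elim by simp
    then have "prob (B N) \<le> exp (- \<eta> * \<beta> N)" by (simp add: emeasure_eq_measure)
    also have "\<dots> \<le> exp (- 2 * ln (real N))" using elim(2) \<eta>(1) by (simp add: field_simps)
    also have "\<dots> = real N powr - 2" using elim(3) by (simp add: powr_def)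
    finally show ?case by simp
  qed
  then have "summable (\<lambda>N. prob (B N))"
    by (rule summable_comparison_test_ev) (simp add: summable_real_powr_iff)
  then have "AE \<omega> in \<Omega>. \<forall>\<^sub>F N in sequentially. \<omega> \<in> space \<Omega> - B N"
    by (intro borel_cantelli_AE1 Bm) (simp_all add: emeasure_eq_measure)
  then show ?thesis
  proof eventually_elim
    case (elim \<omega>)
    then show ?case using eventually_gt_at_top[of 0] eventually_ge_at_top[of N0]
    proof eventually_elim
      case (elim N)
      then show ?case using empirical_M1[of N "X N \<omega>"] by (auto simp: B_def F_def)
    qed
  qed
qed

text \<open>Only the radii 1 / (n + 1) are treated, so that countably many exceptional null sets
  arise.\<close>

lemma AE_d_FM_set_tendsto:
  fixes \<Omega> :: "'w measure" and X :: "nat \<Rightarrow> 'w \<Rightarrow> nat \<Rightarrow> 'a"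
  assumes \<Omega>: "prob_space \<Omega>"
    and X: "\<And>N. N0 \<le> N \<Longrightarrow> X N \<in> measurable \<Omega> (config_space N)"
      "\<And>N. N0 \<le> N \<Longrightarrow> distr \<Omega> (config_space N) (X N) = P_N V W \<beta> N"
    and \<beta>_log: "\<And>k. \<forall>\<^sub>F N in sequentially. k * ln (real N) \<le> \<beta> N"
    and ne: "{\<mu> \<in> M1. I_fun V W \<mu> - ereal m = 0} \<noteq> {}"
  shows "AE \<omega> in \<Omega>. (\<lambda>N. d_FM_set (empirical N (X N \<omega>)) {\<mu> \<in> M1. I_fun V W \<mu> - ereal m = 0}) \<longlonglongrightarrow> 0"
proof -
  let ?S = "{\<mu> \<in> M1. I_fun V W \<mu> - ereal m = 0}"
  have S: "?S \<subseteq> M1" by auto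
  have "AE \<omega> in \<Omega>. \<forall>\<^sub>F N in sequentially. d_FM_set (empirical N (X N \<omega>)) ?S < 1 / real (Suc n)" for n
  proof -
    have "(0::real) < 1 / real (Suc n)" by simp
    then obtain U where U: "openin weak_top U" "?S \<subseteq> U" "\<And>\<mu>. \<mu> \<in> U \<Longrightarrow> d_FM_set \<mu> ?S < 1 / real (Suc n)"
      by (rule d_FM_set_weak_nbhd[OF S]) blast
    have "AE \<omega> in \<Omega>. \<forall>\<^sub>F N in sequentially. empirical N (X N \<omega>) \<in> U"
      by (rule AE_eventually_near_minimizers[OF \<Omega> X \<beta>_log U(1,2)])
    then show ?thesis by eventually_elim (erule eventually_mono, rule U(3))
  qed
  then have "AE \<omega> in \<Omega>. \<forall>n. \<forall>\<^sub>F N in sequentially. d_FM_set (empirical N (X N \<omega>)) ?S < 1 / real (Suc n)"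
    by (simp add: AE_all_countable)
  then show ?thesis
  proof eventually_elim
    case (elim \<omega>)
    show ?case
    proof (rule order_tendstoI)
      fix a :: real assume a: "a < 0"
      show "\<forall>\<^sub>F N in sequentially. a < d_FM_set (empirical N (X N \<omega>)) ?S"
        using eventually_gt_at_top[of 0]
      proof eventually_elim
        case (elim N)
        then show ?case using d_FM_set_nonneg[OF empirical_M1 S ne, of N "X N \<omega>"] a by simp
      qed
    next
      fix a :: real assume "0 < a"
      then obtain n where n: "1 / real (Suc n) < a" using nat_approx_posE by blast
      from elim have "\<forall>\<^sub>F N in sequentially. d_FM_set (empirical N (X N \<omega>)) ?S < 1 / real (Suc n)" by blast
      then show "\<forall>\<^sub>F N in sequentially. d_FM_set (empirical N (X N \<omega>)) ?S < a"
        by eventually_elim (use n in simp)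
    qed
  qed
qed

end

end

section \<open>From the hypotheses to the constants of the proof\<close>

lemma eventually_superlogarithmic:
  assumes g: "filterlim (\<lambda>N. \<beta> N / (real N * ln (real N))) at_top sequentially"
  shows "\<forall>\<^sub>F N in sequentially. k * real N \<le> \<beta> N \<and> k * ln (real N) \<le> \<beta> N"
proof -
  have "\<forall>\<^sub>F N in sequentially. max k 0 \<le> \<beta> N / (real N * ln (real N))"
    using g unfolding filterlim_at_top by blast
  then show ?thesis
    \<comment> \<open>From N >= 3 >= exp 1 follows ln N >= 1, so N ln N dominates both N and ln N;
      \<open>max k 0\<close> covers negative k.\<close>
    using eventually_ge_at_top[of 3]
  proof eventually_elim
    case (elim N)
    have "exp 1 \<le> real N" using exp_le elim(2) by (meson le_trans of_nat_le_iff order_trans numeral_le_real_of_nat_iff)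
    then have ln: "1 \<le> ln (real N)" using elim(2) by (subst ln_ge_iff) auto
    have N: "1 \<le> real N" using elim(2) by simp
    have "0 < real N * ln (real N)" using ln N by (intro mult_pos_pos) linarith+
    then have b: "max k 0 * (real N * ln (real N)) \<le> \<beta> N"
      using elim(1) by (simp only: pos_le_divide_eq)
    have "k * real N \<le> max k 0 * (real N * ln (real N))"
      using ln N by (intro mult_mono) (auto simp: mult_le_cancel_left1)
    moreover have "k * ln (real N) \<le> max k 0 * (real N * ln (real N))"
      using ln N by (intro mult_mono) (auto simp: mult_le_cancel_right1)
    ultimately show ?case using b by simp
  qed
qed

lemma superlinear_imp_ratio_tendsto_0:
  assumes pos: "\<And>N. 0 < \<beta> N" and lin: "\<And>k. \<forall>\<^sub>F N in sequentially. k * real N \<le> \<beta> N"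
  shows "(\<lambda>N. real N / \<beta> N) \<longlonglongrightarrow> 0"
proof (rule order_tendstoI)
  fix a :: real assume "a < 0"
  then show "\<forall>\<^sub>F N in sequentially. a < real N / \<beta> N"
    using pos by (intro always_eventually allI) (simp add: less_le_trans[of a 0] less_imp_le)
next
  fix a :: real assume a: "0 < a"
  show "\<forall>\<^sub>F N in sequentially. real N / \<beta> N < a"
    using lin[of "2 / a"] eventually_gt_at_top[of 0]
  proof eventually_elim
    case (elim N)
    then have "2 * real N \<le> a * \<beta> N" using a by (simp add: field_simps)
    then show ?case using pos[of N] elim(2) by (simp add: field_simps)
  qed
qed

lemma gas_exists:
  fixes V :: "'a::euclidean_space \<Rightarrow> real" and W :: "'a \<Rightarrow> 'a \<Rightarrow> ereal"
  assumes h1: "H1 W" and h2: "H2 V" and h3: "H3 V W" and pos: "\<And>N. 0 < \<beta> N"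
    and ratio: "(\<lambda>N. real N / \<beta> N) \<longlonglongrightarrow> 0"
  shows "\<exists>v0 \<kappa> C q. gas V W v0 \<kappa> C \<beta> q"
proof -
  have Vc: "continuous_on UNIV V" and Vlim: "filterlim V at_top at_infinity"
    and Vint: "(\<integral>\<^sup>+ x. ennreal (exp (- V x)) \<partial>lborel) < \<infinity>" using h2 by (auto simp: H2_def)
  have Vbig: "\<exists>b. \<forall>x. b \<le> norm x \<longrightarrow> Z \<le> V x" for Z
    using Vlim unfolding filterlim_at_top eventually_at_infinity by blast
  obtain b where b: "\<And>x. b \<le> norm x \<Longrightarrow> 0 \<le> V x" using Vbig[of 0] by blast
  have "compact (V ` cball 0 b)" by (intro compact_continuous_image continuous_on_subset[OF Vc]) auto
  then obtain a where a: "\<forall>x\<in>cball 0 b. \<bar>V x\<bar> \<le> a"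
    by (auto dest!: compact_imp_bounded simp: bounded_iff)
  \<comment> \<open>V is nonnegative outside the ball of radius b and at least - a inside.\<close>
  define v0 where "v0 = max 0 a"
  have V0: "0 \<le> V x + v0" for x
  proof (cases "b \<le> norm x")
    case True
    then show ?thesis using b[of x] by (simp add: v0_def add_nonneg_nonneg)
  next
    case False
    then have "\<bar>V x\<bar> \<le> a" using a by auto
    then show ?thesis by (auto simp: v0_def)
  qed
  have cpt: "compact {x. V x + v0 \<le> r}" for r
  proof -
    obtain b' where b': "\<And>x. b' \<le> norm x \<Longrightarrow> r - v0 + 1 \<le> V x" using Vbig[of "r - v0 + 1"] by blast
    have "norm x \<le> b'" if "V x + v0 \<le> r" for x
      using b'[of x] that by (cases "b' \<le> norm x") auto
    then have "bounded {x. V x + v0 \<le> r}" by (auto simp: bounded_iff)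
    moreover have "closed {x. V x + v0 \<le> r}" by (intro closed_Collect_le continuous_intros Vc)
    ultimately show ?thesis by (simp add: compact_eq_bounded_closed)
  qed
  obtain c e where e: "0 < e" "e < 1" "\<And>x y. ereal (c - e * (V x + V y)) \<le> W x y"
    using h3 unfolding H3_def by blast
  define \<kappa> where "\<kappa> = 1 - e"
  \<comment> \<open>As \<kappa> = 1 - e, the left side of \<open>W_lower\<close> equals - e (V x + V
    y) + 2 \<kappa> v0 - C; comparison with the bound from \<open>H3\<close> asks for C at least 2
    \<kappa> v0 - c.\<close>
  define C where "C = max 0 (2 * \<kappa> * v0 - c)"
  have Wl: "ereal (\<kappa> * ((V x + v0) + (V y + v0)) - (V x + V y + C)) \<le> W x y" for x y
  proof -
    have "\<kappa> * ((V x + v0) + (V y + v0)) - (V x + V y + C) \<le> c - e * (V x + V y)"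
      by (simp add: C_def \<kappa>_def algebra_simps max_def)
    then show ?thesis using e(3)[of x y] by (meson ereal_less_eq(3) order_trans)
  qed
  have "(\<integral>\<^sup>+ x. ennreal (exp (- (V x + v0))) \<partial>lborel) \<le> (\<integral>\<^sup>+ x. ennreal (exp (- V x)) \<partial>lborel)"
    by (intro nn_integral_mono ennreal_leI) (simp add: v0_def)
  with Vint obtain t where t: "(\<integral>\<^sup>+ x. ennreal (exp (- (V x + v0))) \<partial>lborel) \<le> ennreal t"
    by (cases "\<integral>\<^sup>+ x. ennreal (exp (- V x)) \<partial>lborel") auto
  have bounds: "0 < \<kappa>" "\<kappa> \<le> 1" "0 \<le> v0" "0 \<le> C" using e by (auto simp: \<kappa>_def v0_def C_def)
  \<comment> \<open>The maximum with 1 keeps the argument of the logarithm positive.\<close>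
  have "gas V W v0 \<kappa> C \<beta> (ln (max 1 t))"
  proof unfold_locales
    show "continuous_on UNIV (\<lambda>p. W (fst p) (snd p))" "\<And>x y. W x y = W y x"
      using h1 by (auto simp: H1_def)
    show "(\<integral>\<^sup>+ x. ennreal (exp (- (V x + v0))) \<partial>lborel) \<le> ennreal (exp (ln (max 1 t)))"
      using t by (simp add: order_trans[OF _ ennreal_leI])
  qed (simp_all only: Vc V0 cpt Wl pos ratio bounds)
  then show ?thesis by blast
qed

text \<open>The limit of the scaled log Z_N is stated as - inf I, the value that (2) yields for the
  whole space; inf I_star is 0 by normalisation. The configurations in (4) may be coupled in any
  way.\<close>

theorem theorem1p1:
  fixes V :: "'a::euclidean_space \<Rightarrow> real"
    and W :: "'a \<Rightarrow> 'a \<Rightarrow> ereal"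
    and \<beta> :: "nat \<Rightarrow> real"
  assumes h1: "H1 W" and h2: "H2 V" and h3: "H3 V W"
    and beta_pos: "\<forall>N. 0 < \<beta> N"
    and beta_growth: "filterlim (\<lambda>N. \<beta> N / (real N * ln (real N))) at_top sequentially"
  shows
    \<comment> \<open>(1) compact level sets, finite infimum\<close>
    "((\<forall>r::real. compactin weak_top {\<mu> \<in> M1. I_fun V W \<mu> \<le> ereal r})
     \<and> (INF \<mu> \<in> M1. I_fun V W \<mu>) > - \<infinity>)
    \<comment> \<open>(2) upper and lower bounds for Z_N P_N\<close>
     \<and> (\<forall>A \<in> weak_borel.
       limsup (\<lambda>N. ereal (1 / \<beta> N) * eln (ZP_N V W \<beta> N A))
         \<le> - (INF \<mu> \<in> weak_top closure_of A. I_fun V W \<mu>)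
     \<and> liminf (\<lambda>N. ereal (1 / \<beta> N) * eln (ZP_N V W \<beta> N A))
         \<ge> - (INF \<mu> \<in> {\<mu> \<in> weak_top interior_of A. absolutely_continuous lborel \<mu>}. I_fun V W \<mu>))
    \<comment> \<open>(3) full LDP under (H4)\<close>
     \<and> (H4 V W \<longrightarrow>
       (\<forall>A \<in> weak_borel.
          - (INF \<mu> \<in> weak_top interior_of A. I_fun V W \<mu> - (INF \<nu> \<in> M1. I_fun V W \<nu>))
            \<le> liminf (\<lambda>N. ereal (1 / \<beta> N) * eln (P_N_prob V W \<beta> N A))
          \<and> liminf (\<lambda>N. ereal (1 / \<beta> N) * eln (P_N_prob V W \<beta> N A))
            \<le> limsup (\<lambda>N. ereal (1 / \<beta> N) * eln (P_N_prob V W \<beta> N A))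
          \<and> limsup (\<lambda>N. ereal (1 / \<beta> N) * eln (P_N_prob V W \<beta> N A))
            \<le> - (INF \<mu> \<in> weak_top closure_of A. I_fun V W \<mu> - (INF \<nu> \<in> M1. I_fun V W \<nu>)))
       \<and> (\<lambda>N. ereal (1 / \<beta> N) * eln (Z_N V W \<beta> N)) \<longlonglongrightarrow> - (INF \<mu> \<in> M1. I_fun V W \<mu>))
    \<comment> \<open>(4) minimizers exist; almost sure convergence under (H4)\<close>
     \<and> ({\<mu> \<in> M1. I_fun V W \<mu> - (INF \<nu> \<in> M1. I_fun V W \<nu>) = 0} \<noteq> {})
     \<and> (H4 V W \<longrightarrow>
       (\<forall>(\<Omega> :: 'w measure) (X :: nat \<Rightarrow> 'w \<Rightarrow> (nat \<Rightarrow> 'a)) (N0 :: nat).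
          prob_space \<Omega> \<and>
          (\<forall>N \<ge> N0. X N \<in> measurable \<Omega> (config_space N) \<and>
                     distr \<Omega> (config_space N) (X N) = P_N V W \<beta> N)
          \<longrightarrow> (AE \<omega> in \<Omega>. (\<lambda>N. d_FM_set (empirical N (X N \<omega>))
                   {\<mu> \<in> M1. I_fun V W \<mu> - (INF \<nu> \<in> M1. I_fun V W \<nu>) = 0}) \<longlonglongrightarrow> 0)))"
proof -
  have growth: "\<forall>\<^sub>F N in sequentially. k * real N \<le> \<beta> N" "\<forall>\<^sub>F N in sequentially. k * ln (real N) \<le> \<beta> N" for k
    using eventually_superlogarithmic[OF beta_growth, of k] by (auto elim: eventually_mono)
  have "(\<lambda>N. real N / \<beta> N) \<longlonglongrightarrow> 0"
    using beta_pos growth(1) by (intro superlinear_imp_ratio_tendsto_0) auto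
  then obtain v0 \<kappa> C q where "gas V W v0 \<kappa> C \<beta> q"
    using gas_exists[OF h1 h2 h3] beta_pos by blast
  then interpret gas V W v0 \<kappa> C \<beta> q .
  have "locally_integrable (W_sup W (cball 0 1))" using h1 by (simp add: H1_def)
  \<comment> \<open>The infimum is a real number m: finite above through the local integrability in
    \<open>H1\<close>, below through coercivity. All subtractions of the infimum are then of a
    finite value.\<close>
  then obtain \<mu>0 where \<mu>0: "\<mu>0 \<in> M1" "I_fun V W \<mu>0 < \<infinity>" using finite_energy_ac by blast
  have fin: "(INF \<mu> \<in> M1. I_fun V W \<mu>) < \<infinity>" using \<mu>0 by (meson INF_lower order.strict_trans1)
  have "ereal (- C / 2) \<le> (INF \<mu> \<in> M1. I_fun V W \<mu>)" by (intro INF_greatest I_fun_lower)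
  then obtain m where m: "(INF \<mu> \<in> M1. I_fun V W \<mu>) = ereal m"
    using fin by (cases "INF \<mu> \<in> M1. I_fun V W \<mu>") auto
  have "closedin weak_top (M1 :: 'a measure set)" by (metis closedin_topspace topspace_weak_top)
  then obtain \<mu>1 where "\<mu>1 \<in> M1" "I_fun V W \<mu>1 = ereal m"
    using I_fun_attains_INF fin m by metis
  then have ne: "{\<mu> \<in> M1. I_fun V W \<mu> - ereal m = 0} \<noteq> {}" by auto
  show ?thesis
    unfolding m
  proof (intro conjI allI ballI impI)
    fix \<Omega> :: "'w measure" and X :: "nat \<Rightarrow> 'w \<Rightarrow> (nat \<Rightarrow> 'a)" and N0 :: nat
    assume h4: "H4 V W" and "prob_space \<Omega> \<and> (\<forall>N \<ge> N0. X N \<in> measurable \<Omega> (config_space N) \<and>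
                     distr \<Omega> (config_space N) (X N) = P_N V W \<beta> N)"
    then show "AE \<omega> in \<Omega>. (\<lambda>N. d_FM_set (empirical N (X N \<omega>))
        {\<mu> \<in> M1. I_fun V W \<mu> - ereal m = 0}) \<longlonglongrightarrow> 0"
      using growth(2) ne by (intro AE_d_FM_set_tendsto[OF h4 m, of \<Omega> N0 X]) auto
  next
    assume h4: "H4 V W"
    show "(\<lambda>N. ereal (1 / \<beta> N) * eln (Z_N V W \<beta> N)) \<longlonglongrightarrow> - ereal m"
      using Z_N_tendsto[OF h4 m] by simp
    fix A :: "'a measure set"
    show "- (INF \<mu> \<in> weak_top interior_of A. I_fun V W \<mu> - ereal m)
        \<le> liminf (\<lambda>N. ereal (1 / \<beta> N) * eln (P_N_prob V W \<beta> N A))"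
      by (rule liminf_P_N_prob_ge[OF h4 m])
    show "limsup (\<lambda>N. ereal (1 / \<beta> N) * eln (P_N_prob V W \<beta> N A))
        \<le> - (INF \<mu> \<in> weak_top closure_of A. I_fun V W \<mu> - ereal m)"
      by (rule limsup_P_N_prob_le[OF h4 m])
    show "liminf (\<lambda>N. ereal (1 / \<beta> N) * eln (P_N_prob V W \<beta> N A))
        \<le> limsup (\<lambda>N. ereal (1 / \<beta> N) * eln (P_N_prob V W \<beta> N A))"
      by (rule Liminf_le_Limsup) simp
  qed (use compactin_level_set ne limsup_ZP_N_le liminf_ZP_N_ge in auto)
qed

end
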